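(* Let $n\ge1$, $p\ge1$ be integers and let $i\in\{0,1,2\}$. For $l=1,\dots,n$, let $(u_l,\omega_l)$ be the $l$-th exact eigenpair of $-u''=\omega^2u$ in $(0,1)$ subject to the boundary conditions of type $i$ (frequencies $\omega_l\ge0$ in increasing order), and let $(u_{h,l},\omega_{h,l})$ be its approximation, i.e., the $l$-th eigenpair (frequencies $\omega_{h,l}\ge 0$ in ascending order) of the discrete problem: find non-trivial $u\in\mathbb{S}^{\mathrm{opt}}_{p,n,i}$ and $\omega^2\in\mathbb{R}$ such that $$(u',v')=\omega^2(u,v),\qquad\forall v\in\mathbb{S}^{\mathrm{opt}}_{p,n,i}.$$ Then, for every $l=1,\dots,n$, $$\omega_l\le\omega_{h,l}\le\frac{\omega_l}{1-\left(\frac{\omega_l}{\omega_{n+1}}\right)^{p+1}}.$$ Moreover, $$\frac{\|u_l-u_{h,l}\|}{\|u_l\|}\le2(1+\rho_l)\left(\frac{\omega_l}{\omega_{n+1}}\right)^{p+1},$$ where the eigenfunctions are normalized such that $\|u_l\|=\|u_{h,l}\|$ and $(u_l,u_{h,l})>0$, and $$\rho_l:=\max_{\substack{j=1,\dots,n\\ j\ne l}}\frac{\omega_l^2}{|\omega_l^2-\omega_{h,j}^2|}$$ is the $l$-th separation constant.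
   Context: $(\cdot,\cdot)$ and $\|\cdot\|$ are the inner product and norm of $L^2(0,1)$. Boundary conditions: type $0$ (Dirichlet) $u(0)=u(1)=0$; type $1$ (Neumann) $u'(0)=u'(1)=0$; type $2$ (mixed) $u(0)=u'(1)=0$. The exact eigenpairs (eigenfunctions up to scaling), in increasing order, $l=1,2,\dots$, are: type $0$: $u_l(x)=\sin(\omega_lx)$, $\omega_l=l\pi$; type $1$: $u_l(x)=\cos(\omega_lx)$, $\omega_l=(l-1)\pi$; type $2$: $u_l(x)=\sin(\omega_lx)$, $\omega_l=(l-1/2)\pi$. The discrete eigenfunctions are taken from an $L^2$-orthogonal eigenbasis of the discrete problem. In $\rho_l$, the maximum over the empty set is $0$, and a quotient with vanishing denominator is $+\infty$. Splines: for break points $\boldsymbol\tau=(0=\tau_0<\tau_1<\dots<\tau_{n_{\mathrm{el}}}=1)$ and $p\ge1$, $\mathbb{S}_{p,\boldsymbol\tau}$ is the space of $s\in C^{p-1}[0,1]$ that are polynomials of degree at most $p$ on each $[\tau_{j-1},\tau_j)$, $j<n_{\mathrm{el}}$, and on $[\tau_{n_{\mathrm{el}}-1},\tau_{n_{\mathrm{el}}}]$. Set (derivatives at the endpoints are one-sided) - $\mathbb{S}^p_{p,\boldsymbol\tau,0}=\{s\in\mathbb{S}_{p,\boldsymbol\tau}: s^{(\alpha)}(0)=s^{(\alpha)}(1)=0,\ 0\le\alpha\le p,\ \alpha\text{ even}\}$; - $\mathbb{S}^p_{p,\boldsymbol\tau,1}=\{s\in\mathbb{S}_{p,\boldsymbol\tau}: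 s^{(\alpha)}(0)=s^{(\alpha)}(1)=0,\ 0\le\alpha\le p,\ \alpha\text{ odd}\}$; - $\mathbb{S}^p_{p,\boldsymbol\tau,2}=\{s\in\mathbb{S}_{p,\boldsymbol\tau}: s^{(\alpha_0)}(0)=s^{(\alpha_1)}(1)=0,\ 0\le\alpha_0,\alpha_1\le p,\ \alpha_0\text{ even},\ \alpha_1\text{ odd}\}$. Optimal break points: - $\boldsymbol\tau^{\mathrm{opt}}_{p,n,0}=\left(0,\frac{1}{n+1},\frac{2}{n+1},\dots,\frac{n}{n+1},1\right)$ for $p$ odd, and $\left(0,\frac{1/2}{n+1},\frac{3/2}{n+1},\dots,\frac{n+1/2}{n+1},1\right)$ for $p$ even; - $\boldsymbol\tau^{\mathrm{opt}}_{p,n,1}=\left(0,\frac{1/2}{n},\frac{3/2}{n},\dots,\frac{n-1/2}{n},1\right)$ for $p$ odd, and $\left(0,\frac1n,\frac2n,\dots,\frac{n-1}{n},1\right)$ for $p$ even; - $\boldsymbol\tau^{\mathrm{opt}}_{p,n,2}=\left(0,\frac{2}{2n+1},\frac{4}{2n+1},\dots,\frac{2n}{2n+1},1\right)$ for $p$ odd, and $\left(0,\frac{1}{2n+1},\frac{3}{2n+1},\dots,\frac{2n-1}{2n+1},1\right)$ for $p$ even. The optimal spline spaces are $\mathbb{S}^{\mathrm{opt}}_{p,n,i}:=\mathbb{S}^p_{p,\boldsymbol\tau^{\mathrm{opt}}_{p,n,i},i}$, each of dimension $n$. *)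

theory Defs
  imports "HOL-Analysis.Analysis" "HOL-Computational_Algebra.Polynomial"
begin

text \<open>
  Functions on $[0,1]$ are represented by total functions of type \<open>real \<Rightarrow> real\<close>;
  only their values on \<open>{0..1}\<close> matter, in all definitions below.
\<close>

subsection \<open>The space $L^2(0,1)$\<close>

text \<open>For square-integrable functions the Henstock-Kurzweil integral of the product coincides
  with the Lebesgue integral.\<close>

definition L2_inner :: "(real \<Rightarrow> real) \<Rightarrow> (real \<Rightarrow> real) \<Rightarrow> real" where
  "L2_inner f g = integral {0..1} (\<lambda>x. f x * g x)"

definition L2_norm :: "(real \<Rightarrow> real) \<Rightarrow> real" where
  "L2_norm f = sqrt (L2_inner f f)"


subsection \<open>Derivatives on $[0,1]$\<close>

text \<open>The derivative within \<open>{0..1}\<close> is two-sided in the interior and one-sided at the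
  endpoints. Its value is unspecified where the function is not differentiable (e.g. at the finitely
  many interior break points, for a spline of degree 1).\<close>

definition D01 :: "(real \<Rightarrow> real) \<Rightarrow> real \<Rightarrow> real" where
  "D01 f x = vector_derivative f (at x within {0..1})"

definition Ck01 :: "nat \<Rightarrow> (real \<Rightarrow> real) set" where
  "Ck01 k = {f. (\<forall>j<k. (D01 ^^ j) f differentiable_on {0..1}) \<and>
                (\<forall>j\<le>k. continuous_on {0..1} ((D01 ^^ j) f))}"


subsection \<open>Boundary conditions and exact eigenpairs\<close>

text \<open>The types 0, 1 and 2 of boundary conditions.\<close>

datatype bc_type = Dirichlet | Neumann | Mixed

fun satisfies_bc :: "bc_type \<Rightarrow> (real \<Rightarrow> real) \<Rightarrow> bool" where
  "satisfies_bc Dirichlet u \<longleftrightarrow> u 0 = 0 \<and> u 1 = 0"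
| "satisfies_bc Neumann u \<longleftrightarrow> D01 u 0 = 0 \<and> D01 u 1 = 0"
| "satisfies_bc Mixed u \<longleftrightarrow> u 0 = 0 \<and> D01 u 1 = 0"

definition exact_eigenpair :: "bc_type \<Rightarrow> (real \<Rightarrow> real) \<Rightarrow> real \<Rightarrow> bool" where
  "exact_eigenpair i u \<omega> \<longleftrightarrow>
     \<omega> \<ge> 0 \<and> u \<in> Ck01 2 \<and> (\<exists>x\<in>{0..1}. u x \<noteq> 0) \<and> satisfies_bc i u \<and>
     (\<forall>x\<in>{0<..<1}. - (D01 ^^ 2) u x = \<omega>\<^sup>2 * u x)"

text \<open>\<open>(u l, \<omega> l)\<close> is the \<open>l\<close>-th exact eigenpair, for every \<open>l \<ge> 1\<close> (index 0 is not used).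
  All eigenvalues are simple, so the increasing enumeration is strict. Each \<open>u l\<close> is determined
  up to a nonzero factor, which is left free: for \<open>i\<close> = Dirichlet, Neumann, Mixed it is a multiple of
  $\sin(\omega_l x)$, $\cos(\omega_l x)$, $\sin(\omega_l x)$ with
  $\omega_l = l\pi$, $(l-1)\pi$, $(l-1/2)\pi$, respectively.\<close>

definition exact_eigenpairs :: "bc_type \<Rightarrow> (nat \<Rightarrow> real \<Rightarrow> real) \<Rightarrow> (nat \<Rightarrow> real) \<Rightarrow> bool" where
  "exact_eigenpairs i u \<omega> \<longleftrightarrow>
     (\<forall>l\<ge>1. exact_eigenpair i (u l) (\<omega> l)) \<and>
     strict_mono_on {1..} \<omega> \<and>
     (\<forall>v w. exact_eigenpair i v w \<longrightarrow> (\<exists>l\<ge>1. w = \<omega> l))"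


subsection \<open>Optimal spline spaces\<close>

text \<open>A sequence of break points $(\tau_0,\dots,\tau_m)$ is the list of its \<open>m + 1\<close> entries.\<close>

definition spline_space :: "nat \<Rightarrow> real list \<Rightarrow> (real \<Rightarrow> real) set" where
  "spline_space p \<tau> = {s \<in> Ck01 (p - 1).
     let m = length \<tau> - 1 in
       (\<forall>j\<in>{1..<m}. \<exists>q::real poly. degree q \<le> p \<and> (\<forall>x\<in>{\<tau> ! (j - 1)..<\<tau> ! j}. s x = poly q x)) \<and>
       (\<exists>q::real poly. degree q \<le> p \<and> (\<forall>x\<in>{\<tau> ! (m - 1)..\<tau> ! m}. s x = poly q x))}"

fun spline_bc :: "nat \<Rightarrow> bc_type \<Rightarrow> (real \<Rightarrow> real) \<Rightarrow> bool" where
  "spline_bc p Dirichlet s \<longleftrightarrow>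
     (\<forall>\<alpha>\<le>p. even \<alpha> \<longrightarrow> (D01 ^^ \<alpha>) s 0 = 0 \<and> (D01 ^^ \<alpha>) s 1 = 0)"
| "spline_bc p Neumann s \<longleftrightarrow>
     (\<forall>\<alpha>\<le>p. odd \<alpha> \<longrightarrow> (D01 ^^ \<alpha>) s 0 = 0 \<and> (D01 ^^ \<alpha>) s 1 = 0)"
| "spline_bc p Mixed s \<longleftrightarrow>
     (\<forall>\<alpha>\<le>p. even \<alpha> \<longrightarrow> (D01 ^^ \<alpha>) s 0 = 0) \<and>
     (\<forall>\<alpha>\<le>p. odd \<alpha> \<longrightarrow> (D01 ^^ \<alpha>) s 1 = 0)"

fun inner_breaks :: "nat \<Rightarrow> nat \<Rightarrow> bc_type \<Rightarrow> real list" where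
  "inner_breaks p n Dirichlet =
     (if odd p then map (\<lambda>k. real k / (real n + 1)) [1..<n + 1]
               else map (\<lambda>k. (real k + 1 / 2) / (real n + 1)) [0..<n + 1])"
| "inner_breaks p n Neumann =
     (if odd p then map (\<lambda>k. (real k + 1 / 2) / real n) [0..<n]
               else map (\<lambda>k. real k / real n) [1..<n])"
| "inner_breaks p n Mixed =
     (if odd p then map (\<lambda>k. (2 * real k) / (2 * real n + 1)) [1..<n + 1]
               else map (\<lambda>k. (2 * real k - 1) / (2 * real n + 1)) [1..<n + 1])"

definition opt_breaks :: "nat \<Rightarrow> nat \<Rightarrow> bc_type \<Rightarrow> real list" where
  "opt_breaks p n i = 0 # inner_breaks p n i @ [1]"

definition opt_spline_space :: "nat \<Rightarrow> nat \<Rightarrow> bc_type \<Rightarrow> (real \<Rightarrow> real) set" where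
  "opt_spline_space p n i = {s \<in> spline_space p (opt_breaks p n i). spline_bc p i s}"


subsection \<open>Discrete eigenpairs\<close>

definition discrete_eigenpair :: "(real \<Rightarrow> real) set \<Rightarrow> (real \<Rightarrow> real) \<Rightarrow> real \<Rightarrow> bool" where
  "discrete_eigenpair S u \<omega> \<longleftrightarrow>
     \<omega> \<ge> 0 \<and> u \<in> S \<and> (\<exists>x\<in>{0..1}. u x \<noteq> 0) \<and>
     (\<forall>v\<in>S. L2_inner (D01 u) (D01 v) = \<omega>\<^sup>2 * L2_inner u v)"

text \<open>\<open>(uh l, \<omega>h l)\<close>, for \<open>l = 1, \<dots>, n\<close>, is a complete list of discrete eigenpairs in ascending order,
  counted with multiplicity, whose eigenfunctions form an $L^2$-orthogonal basis of the
  \<open>n\<close>-dimensional space \<open>S\<close> (linear independence follows from orthogonality).\<close>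

definition discrete_eigenbasis ::
  "(real \<Rightarrow> real) set \<Rightarrow> nat \<Rightarrow> (nat \<Rightarrow> real \<Rightarrow> real) \<Rightarrow> (nat \<Rightarrow> real) \<Rightarrow> bool" where
  "discrete_eigenbasis S n uh \<omega>h \<longleftrightarrow>
     (\<forall>l\<in>{1..n}. discrete_eigenpair S (uh l) (\<omega>h l)) \<and>
     mono_on {1..n} \<omega>h \<and>
     (\<forall>j\<in>{1..n}. \<forall>l\<in>{1..n}. j \<noteq> l \<longrightarrow> L2_inner (uh j) (uh l) = 0) \<and>
     (\<forall>s\<in>S. \<exists>c. \<forall>x\<in>{0..1}. s x = (\<Sum>l=1..n. c l * uh l x))"


subsection \<open>Separation constants\<close>

definition separation_quotient :: "real \<Rightarrow> real \<Rightarrow> ereal" where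
  "separation_quotient w wh =
     (if w\<^sup>2 - wh\<^sup>2 = 0 then \<infinity> else ereal (w\<^sup>2 / \<bar>w\<^sup>2 - wh\<^sup>2\<bar>))"

definition separation_constant :: "nat \<Rightarrow> (nat \<Rightarrow> real) \<Rightarrow> (nat \<Rightarrow> real) \<Rightarrow> nat \<Rightarrow> ereal" where
  "separation_constant n \<omega> \<omega>h l =
     (let J = {1..n} - {l} in
        if J = {} then 0 else Max ((\<lambda>j. separation_quotient (\<omega> l) (\<omega>h j)) ` J))"

end

theory Submission
  imports Defs
begin

text \<open>
  The mesh has half width \<open>1 / M\<close> with \<open>\<omega> (n + 1) = M \<pi> / 2\<close>, and differentiation maps an optimal spline
  space into the optimal spline space of one degree less for the dual boundary conditions, on
  the same mesh. In degree 0 the spaces consist of step functions whose pieces are centered at nodes, and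
  the approximation estimate \<open>\<parallel>v - s\<parallel> \<le> \<parallel>v'\<parallel> / \<omega> (n + 1)\<close> follows from the sharp Poincare inequality
  for functions vanishing at one end of a half cell. A duality argument for the Ritz
  projection \<open>R\<close> lifts it to all degrees, and \<open>\<parallel>v - R v\<parallel> \<le> \<parallel>v^(p+1)\<parallel> / \<omega> (n + 1)^(p+1)\<close> results by iteration.

  Upper bound: in the span of \<open>u 1, \<dots>, u l\<close> pick \<open>v \<noteq> 0\<close> with \<open>R v\<close> orthogonal to the first \<open>l - 1\<close>
  discrete eigenfunctions and compare Rayleigh quotients. Lower bound: in the span of the first \<open>l\<close> discrete
  eigenfunctions pick \<open>v \<noteq> 0\<close> orthogonal to the step functions on the coarser mesh that belongs to \<open>\<omega> l\<close>,
  a space of dimension \<open>l - 1\<close>, and apply the degree 0 estimate on that mesh. Eigenfunctions: expand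
  \<open>R (u l)\<close> in the discrete eigenbasis.
\<close>

section \<open>Piecewise continuous functions and their primitives\<close>

text \<open>One argument covers all degrees and types because the mesh size \<open>M\<close>, hence
  the constant \<open>1 / \<omega> (n + 1)\<close>, is the same for a type and its dual: the
  induction on the degree treats both at once and loses nothing at any step. Duality works since
  zeros of an error and of a primitive of it can be prescribed at complementary ends. The one
  obstacle is a dual type with zeros at both ends, where the constant of integration does not
  suffice; therefore the Ritz projection preserves the mean in the Neumann case. A lower bound by
  the usual min-max principle would rest on completeness of the exact eigenfunctions. Here a
  function orthogonal to step functions is its own approximation error, and the sharp degree 0
  estimate bounds its Rayleigh quotient from below. In the upper bound the orthogonality conditions
  are expressed through \<open>v\<close> itself, so that linearity of \<open>R\<close> does not
  enter; \<open>R v\<close> is nonzero because its error is a proper fraction of \<open>v\<close>.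
  The zero frequency of the Neumann problem needs extra care throughout: energy identities carry no
  information about constants.\<close>

definition pc :: "(real \<Rightarrow> real) \<Rightarrow> bool" where
  "pc f \<longleftrightarrow> bounded (f ` {0..1}) \<and>
     (\<exists>F. finite F \<and> (\<forall>x\<in>{0..1} - F. continuous (at x within {0..1}) f))"

lemma pc_cong:
  assumes "pc f" "\<And>x. x \<in> {0..1} \<Longrightarrow> g x = f x"
  shows "pc g"
proof -
  have "g ` {0..1} = f ` {0..1}" using assms(2) by auto
  moreover have "continuous (at x within {0..1}) g"
    if "continuous (at x within {0..1}) f" "x \<in> {0..1}" for x
    using continuous_transform_within[OF that(1) zero_less_one that(2)] assms(2) by metis
  ultimately show ?thesis using assms(1) unfolding pc_def by (metis DiffE)
qed

lemma pc_continuous: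
  assumes "continuous_on {0..1} f"
  shows "pc f"
proof -
  have "bounded (f ` {0..1})"
    using assms compact_continuous_image compact_imp_bounded by blast
  moreover have "\<forall>x\<in>{0..1} - {}. continuous (at x within {0..1}) f"
    using assms by (simp add: continuous_on_eq_continuous_within)
  ultimately show ?thesis unfolding pc_def by blast
qed

lemma pc_const: "pc (\<lambda>x. c)"
  by (rule pc_continuous) simp

lemma pc_add:
  assumes "pc f" "pc g"
  shows "pc (\<lambda>x. f x + g x)"
proof -
  obtain F where F: "finite F" "\<forall>x\<in>{0..1} - F. continuous (at x within {0..1}) f"
    using assms(1) unfolding pc_def by blast
  obtain G where G: "finite G" "\<forall>x\<in>{0..1} - G. continuous (at x within {0..1}) g"
    using assms(2) unfolding pc_def by blast
  have "bounded ((\<lambda>x. f x + g x) ` {0..1})"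
    using assms unfolding pc_def by (auto intro: bounded_plus_comp)
  moreover have "\<forall>x\<in>{0..1} - (F \<union> G). continuous (at x within {0..1}) (\<lambda>x. f x + g x)"
    using F(2) G(2) by (auto intro!: continuous_add)
  ultimately show ?thesis unfolding pc_def using F(1) G(1) by (meson finite_UnI)
qed

lemma pc_mult:
  assumes "pc f" "pc g"
  shows "pc (\<lambda>x. f x * g x)"
proof -
  obtain F where F: "finite F" "\<forall>x\<in>{0..1} - F. continuous (at x within {0..1}) f"
    using assms(1) unfolding pc_def by blast
  obtain G where G: "finite G" "\<forall>x\<in>{0..1} - G. continuous (at x within {0..1}) g"
    using assms(2) unfolding pc_def by blast
  obtain A where A: "\<forall>x\<in>{0..1}. \<bar>f x\<bar> \<le> A"
    using assms(1) unfolding pc_def bounded_real by auto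
  obtain B where B: "\<forall>x\<in>{0..1}. \<bar>g x\<bar> \<le> B"
    using assms(2) unfolding pc_def bounded_real by auto
  have "\<bar>f x * g x\<bar> \<le> A * B" if "x \<in> {0..1}" for x
    unfolding abs_mult using A B that by (intro mult_mono) (auto intro: order_trans[OF abs_ge_zero])
  then have "bounded ((\<lambda>x. f x * g x) ` {0..1})"
    unfolding bounded_real by (intro exI[of _ "A * B"]) auto
  moreover have "\<forall>x\<in>{0..1} - (F \<union> G). continuous (at x within {0..1}) (\<lambda>x. f x * g x)"
    using F(2) G(2) by (auto intro!: continuous_mult)
  ultimately show ?thesis unfolding pc_def using F(1) G(1) by (meson finite_UnI)
qed

lemma pc_cmult: "pc f \<Longrightarrow> pc (\<lambda>x. c * f x)"
  by (intro pc_mult pc_const)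

lemma pc_uminus: "pc f \<Longrightarrow> pc (\<lambda>x. - f x)"
  using pc_cmult[of f "-1"] by simp

lemma pc_diff: "pc f \<Longrightarrow> pc g \<Longrightarrow> pc (\<lambda>x. f x - g x)"
  using pc_add[of f "\<lambda>x. - g x"] pc_uminus by simp

lemma pc_sum: "(\<And>i. i \<in> S \<Longrightarrow> pc (f i)) \<Longrightarrow> pc (\<lambda>x. \<Sum>i\<in>S. f i x)"
  by (induction S rule: infinite_finite_induct) (auto intro: pc_const pc_add)

lemma pc_indicator: "pc (indicat_real {a..<b})"
proof -
  have "continuous (at x within {0..1}) (indicat_real {a..<b})" if "x \<in> {0..1} - {a, b}" for x
  proof -
    have "x \<notin> frontier {a..<b}"
    proof (cases "a < b")
      case True
      then show ?thesis using that by (simp add: frontier_def)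
    qed simp
    then have "isCont (indicat_real {a..<b}) x"
      by (simp add: isCont_indicator)
    then show ?thesis by (rule continuous_at_imp_continuous_at_within)
  qed
  moreover have "bounded (indicat_real {a..<b} ` {0..1})"
    unfolding bounded_real by (intro exI[of _ 1]) (auto simp: indicator_def)
  ultimately show ?thesis unfolding pc_def by (meson finite.emptyI finite.insertI)
qed

lemma pc_integrable:
  assumes "pc f"
  shows "f integrable_on {0..1}"
proof -
  obtain F where F: "finite F" "\<forall>x\<in>{0..1} - F. continuous (at x within {0..1}) f"
    using assms unfolding pc_def by blast
  obtain B where B: "\<forall>x\<in>{0..1}. \<bar>f x\<bar> \<le> B"
    using assms unfolding pc_def bounded_real by auto
  have sets: "{0..1} - F \<in> sets lebesgue"
    using F(1) by (simp add: finite_imp_closed borel_closed sets.Diff)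
  have "continuous_on ({0..1} - F) f"
    unfolding continuous_on_eq_continuous_within
    using F(2) by (meson Diff_subset continuous_within_subset)
  then have "f \<in> borel_measurable (lebesgue_on ({0..1} - F))"
    using sets by (intro continuous_imp_measurable_on_sets_lebesgue)
  moreover have N: "negligible F" "negligible ({0..1} - F - {0..1})" using F(1) by auto
  have "(\<lambda>x::real. B) integrable_on {0..1}" by (rule integrable_const_ivl)
  then have "(\<lambda>x::real. B) integrable_on ({0..1} - F)"
    by (rule integrable_spike_set)
      (auto intro: negligible_subset[OF N(1)] negligible_subset[OF N(2)])
  ultimately have "f integrable_on ({0..1} - F)"
    using B sets by (intro measurable_bounded_by_integrable_imp_integrable[of f _ "\<lambda>x. B"]) auto
  then show ?thesis
    by (rule integrable_spike_set) (auto intro: negligible_subset[OF N(1)] negligible_subset[OF N(2)])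
qed

lemma pc_integrable_sub:
  assumes "pc f" "0 \<le> a" "b \<le> 1"
  shows "f integrable_on {a..b}"
  using integrable_on_subinterval[OF pc_integrable[OF assms(1)]] assms by simp

text \<open>Stands for \<open>f\<close> in \<open>H^1\<close> with derivative \<open>g\<close>.
  Naming the derivative and using integrals avoids \<open>D01\<close>, whose values are unspecified
  at the kinks of a degree 1 spline; \<open>g\<close> is determined up to finitely many
  points.\<close>

definition is_prim :: "(real \<Rightarrow> real) \<Rightarrow> (real \<Rightarrow> real) \<Rightarrow> bool" where
  "is_prim f g \<longleftrightarrow> pc g \<and> (\<forall>x\<in>{0..1}. f x - f 0 = integral {0..x} g)"

lemma is_prim_pc_deriv: "is_prim f g \<Longrightarrow> pc g"
  by (simp add: is_prim_def)

lemma is_prim_eq: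
  assumes "is_prim f g" "x \<in> {0..1}"
  shows "f x = f 0 + integral {0..x} g"
proof -
  have "f x - f 0 = integral {0..x} g" using assms unfolding is_prim_def by blast
  then show ?thesis by linarith
qed

lemma is_prim_integral:
  assumes "is_prim f g" "0 \<le> x" "x \<le> y" "y \<le> 1"
  shows "f y - f x = integral {x..y} g"
proof -
  have "integral {0..x} g + integral {x..y} g = integral {0..y} g"
    using assms by (intro Henstock_Kurzweil_Integration.integral_combine pc_integrable_sub)
      (auto simp: is_prim_def)
  moreover have "f y - f 0 = integral {0..y} g" "f x - f 0 = integral {0..x} g"
    using assms unfolding is_prim_def by auto
  ultimately show ?thesis by simp
qed

lemma is_prim_continuous:
  assumes "is_prim f g"
  shows "continuous_on {0..1} f"
proof -
  have "continuous_on {0..1} (\<lambda>x. f 0 + integral {0..x} g)"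
    using assms by (intro continuous_intros indefinite_integral_continuous_1 pc_integrable)
      (simp add: is_prim_def)
  then show ?thesis
    by (rule continuous_on_eq) (simp only: is_prim_eq[OF assms])
qed

lemma is_prim_pc: "is_prim f g \<Longrightarrow> pc f"
  by (intro pc_continuous is_prim_continuous)

lemma is_prim_Lipschitz:
  assumes "is_prim f g"
  obtains B where "B \<ge> 0" "\<And>x y. x \<in> {0..1} \<Longrightarrow> y \<in> {0..1} \<Longrightarrow> \<bar>f x - f y\<bar> \<le> B * \<bar>x - y\<bar>"
proof -
  have pc: "pc g" using assms by (simp add: is_prim_def)
  then obtain B where B: "\<forall>x\<in>{0..1}. \<bar>g x\<bar> \<le> B"
    unfolding pc_def bounded_real by auto
  have B0: "B \<ge> 0" using B[rule_format, of 0] by simp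
  have *: "\<bar>f y - f x\<bar> \<le> B * (y - x)" if "0 \<le> x" "x \<le> y" "y \<le> 1" for x y
  proof -
    have "norm (integral {x..y} g) \<le> B * (y - x)"
      using has_integral_bound[of B g "integral {x..y} g" x y]
        pc_integrable_sub[OF pc, of x y] that B B0 by (auto simp: integrable_integral)
    then show ?thesis using is_prim_integral[OF assms that] by simp
  qed
  show thesis
  proof (rule that[OF B0])
    fix x y :: real assume "x \<in> {0..1}" "y \<in> {0..1}"
    then show "\<bar>f x - f y\<bar> \<le> B * \<bar>x - y\<bar>"
      using *[of x y] *[of y x] by (cases "x \<le> y") (auto simp: abs_minus_commute)
  qed
qed

lemma is_prim_has_derivative_at:
  assumes "is_prim f g" "x \<in> {0..1}" "continuous (at x within {0..1}) g"
  shows "(f has_vector_derivative g x) (at x within {0..1})"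
proof -
  have "((\<lambda>u. integral {0..u} g) has_vector_derivative g x) (at x within ({0..1} - {}))"
    using assms by (intro integral_has_vector_derivative_continuous_at pc_integrable)
      (auto simp: is_prim_def)
  then have "((\<lambda>u. f 0 + integral {0..u} g) has_vector_derivative g x) (at x within {0..1})"
    by (auto intro!: derivative_eq_intros)
  then show ?thesis
    by (rule has_vector_derivative_transform[OF assms(2), rotated])
      (rule is_prim_eq[OF assms(1)])
qed

lemma is_prim_has_derivative:
  assumes "is_prim f g"
  obtains F where "finite F"
    "\<And>x. x \<in> {0..1} - F \<Longrightarrow> (f has_vector_derivative g x) (at x within {0..1})"
proof -
  obtain F where F: "finite F" "\<forall>x\<in>{0..1} - F. continuous (at x within {0..1}) g"
    using assms unfolding is_prim_def pc_def by blast
  show ?thesis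
    by (rule that[OF F(1)]) (use F(2) is_prim_has_derivative_at[OF assms] in blast)
qed

lemma is_primI:
  assumes "continuous_on {0..1} f" "pc g" "finite F"
    and "\<And>x. x \<in> {0..1} - F \<Longrightarrow> (f has_vector_derivative g x) (at x within {0..1})"
  shows "is_prim f g"
  unfolding is_prim_def
proof (intro conjI ballI assms(2))
  fix x :: real assume x: "x \<in> {0..1}"
  have "(g has_integral f x - f 0) {0..x}"
  proof (rule fundamental_theorem_of_calculus_interior_strong[OF assms(3)])
    show "0 \<le> x" using x by simp
    show "continuous_on {0..x} f" using assms(1) by (rule continuous_on_subset) (use x in auto)
    fix y assume y: "y \<in> {0<..<x} - F"
    then have "(f has_vector_derivative g y) (at y within {0..1})" using x assms(4) by auto
    moreover have "at y within {0..1} = at y" using x y by (intro at_within_interior) auto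
    ultimately show "(f has_vector_derivative g y) (at y)" by simp
  qed
  then show "f x - f 0 = integral {0..x} g" by (simp add: integral_unique)
qed

lemma is_prim_add:
  assumes "is_prim f f'" "is_prim g g'"
  shows "is_prim (\<lambda>x. f x + g x) (\<lambda>x. f' x + g' x)"
  unfolding is_prim_def
proof (intro conjI ballI)
  show "pc (\<lambda>x. f' x + g' x)" using assms by (intro pc_add) (auto simp: is_prim_def)
  fix x :: real assume x: "x \<in> {0..1}"
  have "integral {0..x} (\<lambda>x. f' x + g' x) = integral {0..x} f' + integral {0..x} g'"
    using assms x by (intro Henstock_Kurzweil_Integration.integral_add pc_integrable_sub)
      (auto simp: is_prim_def)
  then show "f x + g x - (f 0 + g 0) = integral {0..x} (\<lambda>x. f' x + g' x)"
    using is_prim_eq[OF assms(1) x] is_prim_eq[OF assms(2) x] by linarith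
qed

lemma is_prim_cmult:
  assumes "is_prim f f'"
  shows "is_prim (\<lambda>x. c * f x) (\<lambda>x. c * f' x)"
  unfolding is_prim_def
proof (intro conjI ballI)
  show "pc (\<lambda>x. c * f' x)" using assms by (intro pc_cmult) (auto simp: is_prim_def)
  fix x :: real assume x: "x \<in> {0..1}"
  have "f x - f 0 = integral {0..x} f'" using assms x unfolding is_prim_def by blast
  then have "c * (f x - f 0) = c * integral {0..x} f'" by (rule arg_cong)
  then show "c * f x - c * f 0 = integral {0..x} (\<lambda>x. c * f' x)"
    by (simp only: right_diff_distrib integral_mult_right)
qed

lemma is_prim_diff: "is_prim f f' \<Longrightarrow> is_prim g g' \<Longrightarrow> is_prim (\<lambda>x. f x - g x) (\<lambda>x. f' x - g' x)"
  using is_prim_add[of f f' "\<lambda>x. - g x" "\<lambda>x. - g' x"] is_prim_cmult[of g g' "-1"] by simp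

lemma is_prim_const: "is_prim (\<lambda>x. c) (\<lambda>x. 0)"
  unfolding is_prim_def by (simp add: pc_const)

lemma is_prim_sum:
  "(\<And>i. i \<in> S \<Longrightarrow> is_prim (f i) (f' i)) \<Longrightarrow> is_prim (\<lambda>x. \<Sum>i\<in>S. f i x) (\<lambda>x. \<Sum>i\<in>S. f' i x)"
  by (induction S rule: infinite_finite_induct) (auto intro: is_prim_const is_prim_add)

lemma is_prim_cong:
  "is_prim f g \<Longrightarrow> (\<And>x. x \<in> {0..1} \<Longrightarrow> f1 x = f x) \<Longrightarrow> is_prim f1 g"
  unfolding is_prim_def by simp

lemma is_prim_indefinite: "pc g \<Longrightarrow> is_prim (\<lambda>x. c + integral {0..x} g) g"
  unfolding is_prim_def by simp

subsection \<open>The inner product\<close>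

lemma L2_inner_commute: "L2_inner f g = L2_inner g f"
  by (simp add: L2_inner_def mult.commute)

lemma L2_inner_cong:
  "(\<And>x. x \<in> {0..1} \<Longrightarrow> f x = f1 x) \<Longrightarrow> (\<And>x. x \<in> {0..1} \<Longrightarrow> g x = g1 x) \<Longrightarrow> L2_inner f g = L2_inner f1 g1"
  unfolding L2_inner_def by (rule Henstock_Kurzweil_Integration.integral_cong) auto

lemma L2_inner_spike:
  assumes "finite F" "\<And>x. x \<in> {0..1} - F \<Longrightarrow> f x = f1 x" "\<And>x. x \<in> {0..1} - F \<Longrightarrow> g x = g1 x"
  shows "L2_inner f g = L2_inner f1 g1"
  unfolding L2_inner_def
  by (rule integral_spike[of F]) (use assms in auto)

lemma L2_inner_add_left:
  "pc f \<Longrightarrow> pc g \<Longrightarrow> pc h \<Longrightarrow> L2_inner (\<lambda>x. f x + g x) h = L2_inner f h + L2_inner g h"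
  unfolding L2_inner_def distrib_right by (intro Henstock_Kurzweil_Integration.integral_add pc_integrable pc_mult)

lemma L2_inner_diff_left:
  "pc f \<Longrightarrow> pc g \<Longrightarrow> pc h \<Longrightarrow> L2_inner (\<lambda>x. f x - g x) h = L2_inner f h - L2_inner g h"
  unfolding L2_inner_def left_diff_distrib by (intro Henstock_Kurzweil_Integration.integral_diff pc_integrable pc_mult)

lemma L2_inner_cmult_left: "L2_inner (\<lambda>x. c * f x) h = c * L2_inner f h"
  unfolding L2_inner_def by (simp add: mult.assoc)

lemma L2_inner_sum_left:
  assumes "\<And>i. i \<in> S \<Longrightarrow> pc (f i)" "pc h"
  shows "L2_inner (\<lambda>x. \<Sum>i\<in>S. f i x) h = (\<Sum>i\<in>S. L2_inner (f i) h)"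
  using assms(1)
proof (induction S rule: infinite_finite_induct)
  case (insert i S)
  then show ?case by (simp add: L2_inner_add_left pc_sum assms(2))
qed (simp_all add: L2_inner_def)

lemma L2_inner_add_right:
  "pc f \<Longrightarrow> pc g \<Longrightarrow> pc h \<Longrightarrow> L2_inner h (\<lambda>x. f x + g x) = L2_inner h f + L2_inner h g"
  by (simp add: L2_inner_commute[of h] L2_inner_add_left)

lemma L2_inner_diff_right:
  "pc f \<Longrightarrow> pc g \<Longrightarrow> pc h \<Longrightarrow> L2_inner h (\<lambda>x. f x - g x) = L2_inner h f - L2_inner h g"
  by (simp add: L2_inner_commute[of h] L2_inner_diff_left)

lemma L2_inner_cmult_right: "L2_inner h (\<lambda>x. c * f x) = c * L2_inner h f"
  by (simp add: L2_inner_commute[of h] L2_inner_cmult_left)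

lemma L2_inner_sum_right:
  "(\<And>i. i \<in> S \<Longrightarrow> pc (f i)) \<Longrightarrow> pc h \<Longrightarrow>
    L2_inner h (\<lambda>x. \<Sum>i\<in>S. f i x) = (\<Sum>i\<in>S. L2_inner h (f i))"
  by (simp add: L2_inner_commute[of h] L2_inner_sum_left)

lemma L2_inner_nonneg: "L2_inner f f \<ge> 0"
  unfolding L2_inner_def
  by (cases "(\<lambda>x. f x * f x) integrable_on {0..1}")
    (auto intro: Henstock_Kurzweil_Integration.integral_nonneg simp: not_integrable_integral)

lemma L2_norm_nonneg: "L2_norm f \<ge> 0"
  by (simp add: L2_norm_def L2_inner_nonneg)

lemma L2_norm_sq: "(L2_norm f)\<^sup>2 = L2_inner f f"
  by (simp add: L2_norm_def L2_inner_nonneg)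

lemma L2_norm_cong: "(\<And>x. x \<in> {0..1} \<Longrightarrow> f x = g x) \<Longrightarrow> L2_norm f = L2_norm g"
  unfolding L2_norm_def using L2_inner_cong[of f g f g] by simp

lemma L2_norm_cmult: "L2_norm (\<lambda>x. c * f x) = \<bar>c\<bar> * L2_norm f"
  unfolding L2_norm_def L2_inner_cmult_left L2_inner_cmult_right
  by (simp add: mult.assoc[symmetric] real_sqrt_mult)

lemma L2_norm_minus_commute: "L2_norm (\<lambda>x. f x - g x) = L2_norm (\<lambda>x. g x - f x)"
  using L2_norm_cmult[of "-1" "\<lambda>x. g x - f x"] by simp

lemma L2_inner_diff_diff:
  assumes "pc f" "pc g"
  shows "L2_inner (\<lambda>x. f x - g x) (\<lambda>x. f x - g x) = L2_inner f f - 2 * L2_inner f g + L2_inner g g"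
  using assms by (simp add: L2_inner_diff_left L2_inner_diff_right pc_diff L2_inner_commute[of g f])

lemma L2_Cauchy_Schwarz:
  assumes "pc f" "pc g"
  shows "\<bar>L2_inner f g\<bar> \<le> L2_norm f * L2_norm g"
proof -
  let ?a = "L2_inner f f" and ?b = "L2_inner f g" and ?c = "L2_inner g g"
  have q: "0 \<le> ?a - 2 * t * ?b + t\<^sup>2 * ?c" for t
    using L2_inner_nonneg[of "\<lambda>x. f x - t * g x"]
      L2_inner_diff_diff[OF assms(1) pc_cmult[OF assms(2), of t]]
    by (simp add: L2_inner_cmult_left L2_inner_cmult_right power2_eq_square algebra_simps)
  have "?b\<^sup>2 \<le> ?a * ?c"
  proof (cases "?c = 0")
    case True
    have "?b = 0"
    proof (rule ccontr)
      assume "?b \<noteq> 0"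
      \<comment> \<open>The inner product is only semidefinite, so \<open>g\<close> itself need not
        vanish. The quadratic in \<open>t\<close> degenerates to an affine function, and the chosen
        \<open>t\<close> gives it the value -1.\<close>
      then show False using q[of "(?a + 1) / (2 * ?b)"] True by simp
    qed
    then show ?thesis using True by simp
  next
    case False
    then have c: "?c > 0" using L2_inner_nonneg[of g] by simp
    have "0 \<le> ?a - 2 * (?b / ?c) * ?b + (?b / ?c)\<^sup>2 * ?c" by (rule q)
    also have "\<dots> = ?a - ?b\<^sup>2 / ?c" using c by (simp add: power2_eq_square field_simps)
    finally show ?thesis using c by (simp add: field_simps)
  qed
  then have "sqrt (?b\<^sup>2) \<le> sqrt (?a * ?c)" by (rule real_sqrt_le_mono)
  then show ?thesis by (simp add: L2_norm_def real_sqrt_mult)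
qed

lemma L2_norm_triangle:
  assumes "pc f" "pc g"
  shows "L2_norm (\<lambda>x. f x + g x) \<le> L2_norm f + L2_norm g"
proof (rule power2_le_imp_le)
  have "(L2_norm (\<lambda>x. f x + g x))\<^sup>2 = L2_inner f f + 2 * L2_inner f g + L2_inner g g"
    using assms by (simp add: L2_norm_sq L2_inner_add_left L2_inner_add_right pc_add L2_inner_commute[of g f])
  also have "\<dots> \<le> L2_inner f f + 2 * (L2_norm f * L2_norm g) + L2_inner g g"
    using L2_Cauchy_Schwarz[OF assms] by simp
  also have "\<dots> = (L2_norm f + L2_norm g)\<^sup>2" by (simp add: power2_sum L2_norm_sq[symmetric])
  finally show "(L2_norm (\<lambda>x. f x + g x))\<^sup>2 \<le> (L2_norm f + L2_norm g)\<^sup>2" .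
qed (simp add: L2_norm_nonneg)

lemma L2_norm_triangle_diff:
  assumes "pc f" "pc g" "pc h"
  shows "L2_norm (\<lambda>x. f x - h x) \<le> L2_norm (\<lambda>x. f x - g x) + L2_norm (\<lambda>x. g x - h x)"
  using L2_norm_triangle[of "\<lambda>x. f x - g x" "\<lambda>x. g x - h x"] assms by (simp add: pc_diff)

lemma L2_pythagoras:
  assumes "pc f" "pc g" "L2_inner f g = 0"
  shows "(L2_norm (\<lambda>x. f x - g x))\<^sup>2 = (L2_norm f)\<^sup>2 + (L2_norm g)\<^sup>2"
  using assms by (simp add: L2_norm_sq L2_inner_diff_diff)

lemma L2_integration_by_parts:
  assumes "is_prim f f'" "is_prim g g'"
  shows "L2_inner f g' + L2_inner f' g = f 1 * g 1 - f 0 * g 0"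
proof -
  obtain F where F: "finite F"
    "\<And>x. x \<in> {0..1} - F \<Longrightarrow> (f has_vector_derivative f' x) (at x within {0..1})"
    using is_prim_has_derivative[OF assms(1)] by blast
  obtain G where G: "finite G"
    "\<And>x. x \<in> {0..1} - G \<Longrightarrow> (g has_vector_derivative g' x) (at x within {0..1})"
    using is_prim_has_derivative[OF assms(2)] by blast
  have pcs: "pc f" "pc f'" "pc g" "pc g'" using assms is_prim_pc is_prim_pc_deriv by blast+
  have "is_prim (\<lambda>x. f x * g x) (\<lambda>x. f x * g' x + f' x * g x)"
  proof (rule is_primI)
    show "continuous_on {0..1} (\<lambda>x. f x * g x)"
      using assms is_prim_continuous by (intro continuous_intros) auto
    show "pc (\<lambda>x. f x * g' x + f' x * g x)" by (intro pc_add pc_mult pcs)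
    show "finite (F \<union> G)" using F G by simp
    show "((\<lambda>x. f x * g x) has_vector_derivative f x * g' x + f' x * g x) (at x within {0..1})"
      if "x \<in> {0..1} - (F \<union> G)" for x
      using F(2)[of x] G(2)[of x] that by (intro has_vector_derivative_mult) auto
  qed
  from is_prim_integral[OF this, of 0 1]
  have "f 1 * g 1 - f 0 * g 0 = integral {0..1} (\<lambda>x. f x * g' x + f' x * g x)" by simp
  also have "\<dots> = L2_inner f g' + L2_inner f' g"
    unfolding L2_inner_def by (intro Henstock_Kurzweil_Integration.integral_add pc_integrable pc_mult pcs)
  finally show ?thesis by simp
qed

section \<open>Poincare inequalities\<close>

lemma mult_cos_le_sin:
  fixes z :: real
  assumes "0 \<le> z" "z \<le> pi / 2"
  shows "z * cos z \<le> sin z"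
proof -
  have "sin 0 - 0 * cos 0 \<le> sin z - z * cos z"
  proof (rule DERIV_nonneg_imp_nondecreasing[OF assms(1)])
    fix x :: real assume x: "0 \<le> x" "x \<le> z"
    have "((\<lambda>z. sin z - z * cos z) has_real_derivative x * sin x) (at x)"
      by (auto intro!: derivative_eq_intros)
    moreover have "x * sin x \<ge> 0" using x assms pi_half_less_two by (intro mult_nonneg_nonneg sin_ge_zero) (use pi_gt_zero in linarith)+
    ultimately show "\<exists>y. ((\<lambda>z. sin z - z * cos z) has_real_derivative y) (at x) \<and> 0 \<le> y" by blast
  qed
  then show ?thesis by simp
qed

text \<open>Tames the pole of the cotangent in the Poincare inequality below, where it meets a
  factor that vanishes linearly.\<close>

lemma abs_mult_cot_le_1:
  fixes z :: real
  assumes "\<bar>z\<bar> \<le> pi / 2"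
  shows "\<bar>z * cot z\<bar> \<le> 1"
proof -
  have *: "\<bar>z * cot z\<bar> \<le> 1" if "0 < z" "z \<le> pi / 2" for z :: real
  proof -
    have "sin z > 0" using that pi_gt_zero by (intro sin_gt_zero) linarith+
    moreover have "cos z \<ge> 0" using that by (intro cos_ge_zero) linarith+
    ultimately show ?thesis
      using mult_cos_le_sin[of z] that by (simp add: cot_def abs_mult divide_le_eq)
  qed
  consider "z > 0" | "z = 0" | "z < 0" by linarith
  then show ?thesis
  proof cases
    case 3
    then show ?thesis using *[of "-z"] assms by simp
  qed (use * assms in auto)
qed

text \<open>With \<open>c x = k cot (k (x - \<gamma>))\<close> one has \<open>c' = - k\<^sup>2 - c\<^sup>2\<close>, so that
  \<open>g\<^sup>2 - k\<^sup>2 f\<^sup>2 = (g - f c)\<^sup>2 + (f\<^sup>2 c)'\<close> for \<open>f = v - v \<gamma>\<close>, and \<open>f\<^sup>2 c\<close> vanishes at both ends.\<close>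

lemma poincare_endpoint:
  assumes prim: "is_prim v g" and ab: "0 \<le> \<alpha>" "\<alpha> < \<beta>" "\<beta> \<le> 1" and \<gamma>: "\<gamma> = \<alpha> \<or> \<gamma> = \<beta>"
  shows "integral {\<alpha>..\<beta>} (\<lambda>x. (v x - v \<gamma>)\<^sup>2) \<le> (2 * (\<beta> - \<alpha>) / pi)\<^sup>2 * integral {\<alpha>..\<beta>} (\<lambda>x. (g x)\<^sup>2)"
proof -
  \<comment> \<open>The first eigenfrequency of an interval of length
    \<open>\<beta> - \<alpha>\<close> with the function fixed at one end:
    \<open>k * (\<beta> - \<alpha>) = pi / 2\<close> puts a zero of the cotangent at the end
    opposite to \<open>\<gamma>\<close> and leaves \<open>\<gamma>\<close> as its only pole in the
    interval.\<close>
  define k where "k = pi / (2 * (\<beta> - \<alpha>))"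
  have k: "k > 0" using ab by (simp add: k_def)
  define f where "f x = v x - v \<gamma>" for x
  define c where "c x = k * cot (k * (x - \<gamma>))" for x
  define G where "G x = (f x)\<^sup>2 * c x" for x
  define G' where "G' x = 2 * f x * g x * c x - (f x)\<^sup>2 * (k\<^sup>2 + (c x)\<^sup>2)" for x
  have pcg: "pc g" using prim by (rule is_prim_pc_deriv)
  have \<gamma>01: "\<gamma> \<in> {0..1}" using \<gamma> ab by auto
  have f_prim: "is_prim f g"
    using is_prim_diff[OF prim is_prim_const[of "v \<gamma>"]] unfolding f_def by simp
  have "\<And>L::real. L > 0 \<Longrightarrow> pi / (2 * L) * L = pi / 2" by simp
  from this[of "\<beta> - \<alpha>"] have kL: "k * (\<beta> - \<alpha>) = pi / 2"
    using ab by (simp only: k_def diff_gt_0_iff_gt)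
  have arg: "\<bar>k * (x - \<gamma>)\<bar> \<le> pi / 2" if "x \<in> {\<alpha>..\<beta>}" for x
  proof -
    have "\<bar>k * (x - \<gamma>)\<bar> \<le> k * (\<beta> - \<alpha>)"
      using \<gamma> that k by (auto simp: abs_mult)
    then show ?thesis by (simp only: kL)
  qed
  have sin_nz: "sin (k * (x - \<gamma>)) \<noteq> 0" if "x \<in> {\<alpha>..\<beta>}" "x \<noteq> \<gamma>" for x
  proof
    assume s: "sin (k * (x - \<gamma>)) = 0"
    define z where "z = k * (x - \<gamma>)"
    have "- pi < z" "z < pi"
      using arg[OF that(1)] pi_gt_zero unfolding z_def[symmetric] by linarith+
    then have "z = 0" using s unfolding z_def[symmetric] by (rule sin_eq_0_pi)
    then have "k * (x - \<gamma>) = 0" by (simp only: z_def)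
    then show False using that k by simp
  qed
  have dc: "(c has_real_derivative - (k\<^sup>2 + (c x)\<^sup>2)) (at x)" if "x \<in> {\<alpha>..\<beta>}" "x \<noteq> \<gamma>" for x
  proof -
    define z where "z = k * (x - \<gamma>)"
    have snz: "sin z \<noteq> 0" unfolding z_def by (rule sin_nz[OF that])
    have "inverse ((sin z)\<^sup>2) = ((sin z)\<^sup>2 + (cos z)\<^sup>2) / (sin z)\<^sup>2"
      by (simp add: divide_inverse)
    also have "\<dots> = 1 + (cot z)\<^sup>2"
      using snz unfolding add_divide_distrib by (simp add: cot_def power_divide)
    finally have inv: "inverse ((sin z)\<^sup>2) = 1 + (cot z)\<^sup>2" .
    have "(cot has_real_derivative - inverse ((sin z)\<^sup>2)) (at (k * (x - \<gamma>)))"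
      using DERIV_cot[OF snz] by (simp add: z_def)
    moreover have "((\<lambda>x. k * (x - \<gamma>)) has_real_derivative k) (at x)"
      by (auto intro!: derivative_eq_intros)
    ultimately have "((\<lambda>x. cot (k * (x - \<gamma>))) has_real_derivative - inverse ((sin z)\<^sup>2) * k) (at x)"
      by (rule DERIV_chain2)
    then have "(c has_real_derivative k * (- inverse ((sin z)\<^sup>2) * k)) (at x)"
      unfolding c_def by (rule DERIV_cmult)
    also have "k * (- inverse ((sin z)\<^sup>2) * k) = - (k\<^sup>2 + (c x)\<^sup>2)"
      unfolding inv by (simp add: c_def z_def power_mult_distrib algebra_simps) (simp add: power2_eq_square)
    finally show ?thesis .
  qed
  have ends: "G \<alpha> = 0" "G \<beta> = 0"
  proof -
    have "G x = 0" if "x = \<alpha> \<or> x = \<beta>" for x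
    proof (cases "x = \<gamma>")
      case True then show ?thesis by (simp add: G_def f_def)
    next
      case False
      then have "x - \<gamma> = \<beta> - \<alpha> \<or> x - \<gamma> = - (\<beta> - \<alpha>)" using that \<gamma> by auto
      then have "k * (x - \<gamma>) = pi / 2 \<or> k * (x - \<gamma>) = - (pi / 2)"
        using kL by (metis mult_minus_right)
      then have "cos (k * (x - \<gamma>)) = 0" by (metis cos_minus cos_pi_half)
      then have "c x = 0" by (simp add: c_def cot_def)
      then show ?thesis by (simp add: G_def)
    qed
    then show "G \<alpha> = 0" "G \<beta> = 0" by auto
  qed
  obtain B where B: "B \<ge> 0" "\<And>x y. x \<in> {0..1} \<Longrightarrow> y \<in> {0..1} \<Longrightarrow> \<bar>f x - f y\<bar> \<le> B * \<bar>x - y\<bar>"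
    using is_prim_Lipschitz[OF f_prim] by blast
  \<comment> \<open>A Lipschitz function vanishing at \<open>\<gamma>\<close> contributes two
    factors \<open>\<bar>x - \<gamma>\<bar>\<close>, one of which cancels the pole of
    \<open>c\<close>. So \<open>G\<close> is continuous at \<open>\<gamma>\<close>, where
    \<open>c\<close> is not.\<close>
  have Gbound: "norm (G x) \<le> B\<^sup>2 * \<bar>x - \<gamma>\<bar>" if "x \<in> {\<alpha>..\<beta>}" for x
  proof -
    have f: "\<bar>f x\<bar> \<le> B * \<bar>x - \<gamma>\<bar>"
      using B(2)[of x \<gamma>] that ab \<gamma>01 by (simp add: f_def)
    have "\<bar>f x\<bar>\<^sup>2 \<le> (B * \<bar>x - \<gamma>\<bar>)\<^sup>2" by (rule power_mono[OF f]) simp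
    then have "\<bar>(f x)\<^sup>2 * c x\<bar> \<le> (B * \<bar>x - \<gamma>\<bar>)\<^sup>2 * \<bar>c x\<bar>"
      by (simp add: abs_mult mult_right_mono)
    also have "\<dots> = B\<^sup>2 * \<bar>x - \<gamma>\<bar> * (\<bar>x - \<gamma>\<bar> * \<bar>c x\<bar>)" by (simp add: power2_eq_square)
    also have "\<bar>x - \<gamma>\<bar> * \<bar>c x\<bar> = \<bar>k * (x - \<gamma>) * cot (k * (x - \<gamma>))\<bar>"
      using k by (simp add: c_def abs_mult)
    also have "\<dots> \<le> 1" by (rule abs_mult_cot_le_1[OF arg[OF that]])
    finally show ?thesis by (simp add: G_def mult_left_mono)
  qed
  have f_cont: "continuous_on {\<alpha>..\<beta>} f"
    using is_prim_continuous[OF f_prim] by (rule continuous_on_subset) (use ab in auto)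
  have cont: "continuous_on {\<alpha>..\<beta>} G"
    unfolding continuous_on_eq_continuous_within
  proof
    fix x assume x: "x \<in> {\<alpha>..\<beta>}"
    show "continuous (at x within {\<alpha>..\<beta>}) G"
    proof (cases "x = \<gamma>")
      case True
      have "(G \<longlongrightarrow> 0) (at \<gamma> within {\<alpha>..\<beta>})"
      proof (rule Lim_null_comparison)
        show "\<forall>\<^sub>F x in at \<gamma> within {\<alpha>..\<beta>}. norm (G x) \<le> B\<^sup>2 * \<bar>x - \<gamma>\<bar>"
          using Gbound by (auto simp: eventually_at_filter)
        have "((\<lambda>x. B\<^sup>2 * \<bar>x - \<gamma>\<bar>) \<longlongrightarrow> B\<^sup>2 * \<bar>\<gamma> - \<gamma>\<bar>) (at \<gamma> within {\<alpha>..\<beta>})"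
          by (intro tendsto_intros)
        then show "((\<lambda>x. B\<^sup>2 * \<bar>x - \<gamma>\<bar>) \<longlongrightarrow> 0) (at \<gamma> within {\<alpha>..\<beta>})" by simp
      qed
      moreover have "G \<gamma> = 0" using ends \<gamma> by auto
      ultimately show ?thesis unfolding True continuous_within by simp
    next
      case False
      have "continuous (at x within {\<alpha>..\<beta>}) f"
        using f_cont x by (simp add: continuous_on_eq_continuous_within)
      moreover have "continuous (at x within {\<alpha>..\<beta>}) c"
        using DERIV_isCont[OF dc[OF x False]] by (rule continuous_at_imp_continuous_at_within)
      ultimately show ?thesis unfolding G_def by (intro continuous_intros)
    qed
  qed
  obtain F where F: "finite F"
    "\<And>x. x \<in> {0..1} - F \<Longrightarrow> (f has_vector_derivative g x) (at x within {0..1})"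
    using is_prim_has_derivative[OF f_prim] by blast
  have "(G' has_integral G \<beta> - G \<alpha>) {\<alpha>..\<beta>}"
  proof (rule fundamental_theorem_of_calculus_interior_strong[OF F(1) _ _ cont])
    show "\<alpha> \<le> \<beta>" using ab by simp
    fix x assume x: "x \<in> {\<alpha><..<\<beta>} - F"
    have "at x within {0..1} = at x" using x ab by (intro at_within_interior) auto
    then have df: "(f has_real_derivative g x) (at x)"
      using F(2)[of x] x ab by (simp add: has_real_derivative_iff_has_vector_derivative)
    have dc: "(c has_real_derivative - (k\<^sup>2 + (c x)\<^sup>2)) (at x)"
      using x \<gamma> by (intro dc) auto
    have "(G has_real_derivative G' x) (at x)"
      unfolding G_def G'_def
      by (rule derivative_eq_intros df dc refl)+ (simp add: algebra_simps)
    then show "(G has_vector_derivative G' x) (at x)"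
      by (simp add: has_real_derivative_iff_has_vector_derivative)
  qed
  then have int0: "(G' has_integral 0) {\<alpha>..\<beta>}" using ends by simp
  have ig: "(\<lambda>x. (g x)\<^sup>2) integrable_on {\<alpha>..\<beta>}"
    unfolding power2_eq_square using ab by (intro pc_integrable_sub pc_mult pcg) auto
  have if': "(\<lambda>x. (f x)\<^sup>2) integrable_on {\<alpha>..\<beta>}"
    unfolding power2_eq_square using ab by (intro pc_integrable_sub pc_mult is_prim_pc[OF f_prim]) auto
  have "((\<lambda>x. (g x)\<^sup>2 - k\<^sup>2 * (f x)\<^sup>2) has_integral
      integral {\<alpha>..\<beta>} (\<lambda>x. (g x)\<^sup>2) - k\<^sup>2 * integral {\<alpha>..\<beta>} (\<lambda>x. (f x)\<^sup>2)) {\<alpha>..\<beta>}"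
    by (intro has_integral_diff has_integral_mult_right integrable_integral ig if')
  moreover have "G' x \<le> (g x)\<^sup>2 - k\<^sup>2 * (f x)\<^sup>2" for x
  proof -
    have "(g x)\<^sup>2 - k\<^sup>2 * (f x)\<^sup>2 - G' x = (g x - f x * c x)\<^sup>2"
      by (simp add: G'_def power2_eq_square algebra_simps)
    also have "\<dots> \<ge> 0" by simp
    finally show ?thesis by simp
  qed
  ultimately have "0 \<le> integral {\<alpha>..\<beta>} (\<lambda>x. (g x)\<^sup>2) - k\<^sup>2 * integral {\<alpha>..\<beta>} (\<lambda>x. (f x)\<^sup>2)"
    using has_integral_le[OF int0] by blast
  then have "integral {\<alpha>..\<beta>} (\<lambda>x. (f x)\<^sup>2) \<le> (1 / k)\<^sup>2 * integral {\<alpha>..\<beta>} (\<lambda>x. (g x)\<^sup>2)"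
    using k by (simp add: field_simps)
  then show ?thesis by (simp add: f_def k_def)
qed

lemma integral_grid_split:
  assumes "pc f" "K \<le> M" "M > 0"
  shows "integral {0..real K / real M} f = (\<Sum>m<K. integral {real m / real M..(real m + 1) / real M} f)"
  using assms(2)
proof (induction K)
  case (Suc K)
  have "integral {0..real K / real M} f + integral {real K / real M..(real K + 1) / real M} f
      = integral {0..(real K + 1) / real M} f"
    using Suc.prems assms(3)
    by (intro Henstock_Kurzweil_Integration.integral_combine pc_integrable_sub assms(1))
      (auto simp: divide_simps)
  then show ?case using Suc by (simp add: add.commute)
qed simp

section \<open>The spaces\<close>

text \<open>The grid \<open>j / M\<close> consists of break points and nodes: the \<open>j\<close> with \<open>even j = a\<close> are the nodes, and the
  break points are the remaining ones. Each piece is centered at a node, where the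
  end pieces may be halved; on a halved piece the functions in \<open>opt_space M 0 a\<close> vanish.\<close>

definition node_step :: "nat \<Rightarrow> nat \<Rightarrow> real \<Rightarrow> real" where
  "node_step M j = indicat_real {(real j - 1) / real M ..< (real j + 1) / real M}"

definition inner_nodes :: "nat \<Rightarrow> bool \<Rightarrow> nat set" where
  "inner_nodes M a = {j \<in> {1..<M}. even j = a}"

text \<open>The endpoints are the grid points 0 and \<open>M\<close>, and zeros are imposed at those
  that are nodes. For \<open>a\<close> true this is Dirichlet if \<open>M\<close> is even and Mixed
  if \<open>M\<close> is odd; for \<open>a\<close> false it is Neumann if \<open>M\<close> is even
  and Mixed with the ends exchanged if \<open>M\<close> is odd. Negating \<open>a\<close>
  complements the condition at each end.\<close>

definition end_zeros :: "nat \<Rightarrow> bool \<Rightarrow> (real \<Rightarrow> real) \<Rightarrow> bool" where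
  "end_zeros M a s \<longleftrightarrow> (a \<longrightarrow> s 0 = 0) \<and> (a = even M \<longrightarrow> s 1 = 0)"

text \<open>Recursion through the derivative turns the conditions on derivatives of every order into
  plain zeros, one order per level, and flipping \<open>a\<close> takes care of the parities. In
  degree 0 only inner nodes carry coefficients, which encodes the end conditions of the last
  level.\<close>

primrec opt_space :: "nat \<Rightarrow> nat \<Rightarrow> bool \<Rightarrow> (real \<Rightarrow> real) set" where
  "opt_space M 0 a = {s. \<exists>c. \<forall>x\<in>{0..1}. s x = (\<Sum>j\<in>inner_nodes M a. c j * node_step M j x)}"
| "opt_space M (Suc q) a = {s. \<exists>t\<in>opt_space M q (\<not> a). is_prim s t \<and> end_zeros M a s}"

lemma finite_inner_nodes [simp]: "finite (inner_nodes M a)"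
  by (simp add: inner_nodes_def)

lemma pc_node_step: "pc (node_step M j)"
  unfolding node_step_def by (rule pc_indicator)

text \<open>Of the neighbours \<open>m\<close> and \<open>m + 1\<close> exactly one has the parity
  of the nodes, so a half cell meets a single step. If that node is 0 or \<open>M\<close>, it
  carries no coefficient and the value is 0.\<close>

lemma node_sum_eval:
  fixes a :: bool
  assumes "M > 0" "m < M" "real m / real M \<le> x" "x < (real m + 1) / real M"
    and k_def: "k = (if even m = a then m else m + 1)"
  shows "(\<Sum>j\<in>inner_nodes M a. c j * node_step M j x) = (if k \<in> {1..<M} then c k else 0)"
proof -
  have x: "real m \<le> x * M" "x * M < real m + 1" using assms by (auto simp: field_simps)
  have step: "node_step M j x = (if j = k then 1 else 0)" if "j \<in> inner_nodes M a" for j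
  proof -
    have "(node_step M j x = 1) \<longleftrightarrow> real j - 1 \<le> x * M \<and> x * M < real j + 1"
      using assms(1) by (auto simp: node_step_def indicator_def field_simps)
    also have "\<dots> \<longleftrightarrow> j = m \<or> j = m + 1"
    proof
      assume h: "real j - 1 \<le> x * M \<and> x * M < real j + 1"
      then have "real j < real m + 2" "real m < real j + 1" using x by linarith+
      then show "j = m \<or> j = m + 1" by linarith
    qed (use x in auto)
    also have "\<dots> \<longleftrightarrow> j = k" using that by (auto simp: inner_nodes_def k_def)
    finally show ?thesis by (auto simp: node_step_def indicator_def)
  qed
  have "(\<Sum>j\<in>inner_nodes M a. c j * node_step M j x) = (\<Sum>j\<in>inner_nodes M a. if k = j then c j else 0)"
    by (rule sum.cong) (auto simp: step)
  also have "\<dots> = (if k \<in> inner_nodes M a then c k else 0)" by (simp add: sum.delta')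
  also have "k \<in> inner_nodes M a \<longleftrightarrow> k \<in> {1..<M}"
    by (auto simp: inner_nodes_def k_def)
  finally show ?thesis .
qed

section \<open>Linear structure and orthogonal projections\<close>

lemma opt_space_pc: "s \<in> opt_space M q a \<Longrightarrow> pc s"
proof (cases q)
  case 0
  assume "s \<in> opt_space M q a"
  with 0 obtain c where c: "\<forall>x\<in>{0..1}. s x = (\<Sum>j\<in>inner_nodes M a. c j * node_step M j x)" by auto
  have "pc (\<lambda>x. \<Sum>j\<in>inner_nodes M a. c j * node_step M j x)"
    by (intro pc_sum pc_cmult pc_node_step)
  then show ?thesis by (rule pc_cong) (use c in auto)
qed (auto intro: is_prim_pc)

lemma opt_space_lin:
  "s \<in> opt_space M q a \<Longrightarrow> s' \<in> opt_space M q a \<Longrightarrow> (\<lambda>x. \<alpha> * s x + \<beta> * s' x) \<in> opt_space M q a"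
proof (induction q arbitrary: s s' a)
  case 0
  then obtain c c' where
    "\<forall>x\<in>{0..1}. s x = (\<Sum>j\<in>inner_nodes M a. c j * node_step M j x)"
    "\<forall>x\<in>{0..1}. s' x = (\<Sum>j\<in>inner_nodes M a. c' j * node_step M j x)" by auto
  then have "\<forall>x\<in>{0..1}. \<alpha> * s x + \<beta> * s' x
      = (\<Sum>j\<in>inner_nodes M a. (\<alpha> * c j + \<beta> * c' j) * node_step M j x)"
    by (simp add: sum_distrib_left sum.distrib algebra_simps)
  then show ?case by auto
next
  case (Suc q)
  then obtain t t' where t: "t \<in> opt_space M q (\<not> a)" "is_prim s t" "end_zeros M a s"
    "t' \<in> opt_space M q (\<not> a)" "is_prim s' t'" "end_zeros M a s'" by auto
  have "(\<lambda>x. \<alpha> * t x + \<beta> * t' x) \<in> opt_space M q (\<not> a)" by (rule Suc.IH[OF t(1,4)])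
  moreover have "is_prim (\<lambda>x. \<alpha> * s x + \<beta> * s' x) (\<lambda>x. \<alpha> * t x + \<beta> * t' x)"
    by (intro is_prim_add is_prim_cmult t)
  moreover have "end_zeros M a (\<lambda>x. \<alpha> * s x + \<beta> * s' x)"
    using t by (auto simp: end_zeros_def)
  ultimately show ?case by auto
qed

lemma opt_space_zero: "(\<lambda>x. 0) \<in> opt_space M q a"
proof (induction q arbitrary: a)
  case 0
  show ?case by (auto intro!: exI[of _ "\<lambda>_. 0"])
next
  case (Suc q)
  then show ?case by (auto simp: end_zeros_def intro!: bexI[of _ "\<lambda>_. 0"] is_prim_const)
qed

lemma opt_space_diff:
  "s \<in> opt_space M q a \<Longrightarrow> s' \<in> opt_space M q a \<Longrightarrow> (\<lambda>x. s x - s' x) \<in> opt_space M q a"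
  using opt_space_lin[of s M q a s' 1 "-1"] by simp

text \<open>Lets an orthogonality relation be tested against constants. With \<open>M\<close> even
  and \<open>a\<close> false neither end is a node, so only full pieces occur and they fill
  \<open>[0, 1)\<close>; in degree 0 the half-open steps miss the point 1.\<close>

lemma opt_space_const:
  assumes "even M" "M > 0"
  shows "\<exists>e\<in>opt_space M q False. \<forall>x\<in>{0..<1}. e x = 1"
proof (cases q)
  case 0
  define e where "e x = (\<Sum>j\<in>inner_nodes M False. 1 * node_step M j x)" for x
  have "e x = 1" if x: "x \<in> {0..<1}" for x
  proof -
    define m where "m = nat \<lfloor>x * M\<rfloor>"
    have m: "real m \<le> x * M" "x * M < real m + 1" using x by (auto simp: m_def)
    have "x * M < M" using x assms(2) by simp
    then have "m < M" using m(1) by linarith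
    moreover have "odd m \<or> m + 1 < M" using \<open>m < M\<close> assms by (cases "m + 1 = M") auto
    ultimately show ?thesis
      unfolding e_def using m assms(2)
      by (subst node_sum_eval[OF _ _ _ _ refl, of M m]) (auto simp: field_simps elim: oddE)
  qed
  moreover have "e \<in> opt_space M 0 False" by (auto simp: e_def intro!: exI[of _ "\<lambda>_. 1"])
  ultimately show ?thesis using 0 by blast
next
  case (Suc q')
  have "end_zeros M False (\<lambda>x. 1)" using assms(1) by (simp add: end_zeros_def)
  then have "\<exists>t\<in>opt_space M q' True. is_prim (\<lambda>x. 1) t \<and> end_zeros M False (\<lambda>x. 1)"
    using opt_space_zero is_prim_const by (intro bexI[of _ "\<lambda>x. 0"] conjI)
  then have "(\<lambda>x. 1) \<in> opt_space M q False" unfolding Suc by simp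
  then show ?thesis by (rule bexI[rotated]) simp
qed

text \<open>Primitives of the generators together with the constant 1 generate the next degree. They
  ignore the end conditions and may lie outside the space, which is good enough for the existence of
  projections.\<close>

lemma opt_space_finite_dim:
  "\<exists>k g. (\<forall>i<k. pc (g i)) \<and> (\<forall>s\<in>opt_space M q a. \<exists>c. \<forall>x\<in>{0..1}. s x = (\<Sum>i<(k::nat). c i * g i x))"
proof (induction q arbitrary: a)
  case 0
  show ?case
  proof (intro exI[of _ M] exI[of _ "node_step M"] conjI ballI allI impI pc_node_step)
    fix s assume "s \<in> opt_space M 0 a"
    then obtain c where c: "\<forall>x\<in>{0..1}. s x = (\<Sum>j\<in>inner_nodes M a. c j * node_step M j x)" by auto
    have "(\<Sum>j\<in>inner_nodes M a. c j * node_step M j x)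
        = (\<Sum>j<M. (if j \<in> inner_nodes M a then c j else 0) * node_step M j x)" for x
      by (rule sum.mono_neutral_cong_left) (auto simp: inner_nodes_def)
    with c show "\<exists>c. \<forall>x\<in>{0..1}. s x = (\<Sum>i<M. c i * node_step M i x)" by auto
  qed
next
  case (Suc q)
  obtain k g where "\<forall>i<k. pc (g i)"
    and span: "\<forall>s\<in>opt_space M q (\<not> a). \<exists>c. \<forall>x\<in>{0..1}. s x = (\<Sum>i<(k::nat). c i * g i x)"
    using Suc[of "\<not> a"] by (elim exE conjE)
  then have g: "\<And>i. i < k \<Longrightarrow> pc (g i)" by blast
  define h where "h i x = (if i = k then 1 else integral {0..x} (g i))" for i x
  have "pc (h i)" if "i < Suc k" for i
  proof (cases "i = k")
    case True then show ?thesis using pc_const[of 1] by (simp add: h_def[abs_def])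
  next
    case False
    then have "h i = (\<lambda>x. 0 + integral {0..x} (g i))" by (auto simp: h_def)
    then show ?thesis using False that is_prim_pc[OF is_prim_indefinite[OF g(1)[of i]], of 0] by simp
  qed
  moreover have "\<exists>c. \<forall>x\<in>{0..1}. s x = (\<Sum>i<Suc k. c i * h i x)" if "s \<in> opt_space M (Suc q) a" for s
  proof -
    obtain t where t: "t \<in> opt_space M q (\<not> a)" "is_prim s t" using \<open>s \<in> _\<close> by auto
    obtain c where c: "\<forall>x\<in>{0..1}. t x = (\<Sum>i<k. c i * g i x)" using span t(1) by blast
    have "s x = (\<Sum>i<Suc k. (c(k := s 0)) i * h i x)" if x: "x \<in> {0..1}" for x
    proof -
      have "integral {0..x} t = integral {0..x} (\<lambda>x. \<Sum>i<k. c i * g i x)"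
        by (rule Henstock_Kurzweil_Integration.integral_cong) (use c x in auto)
      also have "\<dots> = (\<Sum>i<k. integral {0..x} (\<lambda>x. c i * g i x))"
        by (rule Henstock_Kurzweil_Integration.integral_sum)
          (use x in \<open>auto intro!: pc_integrable_sub pc_cmult g\<close>)
      also have "\<dots> = (\<Sum>i<k. c i * h i x)" by (auto simp: h_def)
      finally have "integral {0..x} t = (\<Sum>i<k. c i * h i x)" .
      moreover have "(\<Sum>i<Suc k. (c(k := s 0)) i * h i x) = s 0 + (\<Sum>i<k. c i * h i x)"
        by (simp add: h_def)
      ultimately show ?thesis using is_prim_eq[OF t(2) x] by simp
    qed
    then show ?thesis by blast
  qed
  ultimately show ?case by blast
qed

text \<open>Gram-Schmidt by induction on the number of generators, which may lie outside
  \<open>S\<close>. The elements of \<open>S\<close> that do without the last generator form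
  \<open>S'\<close>; a single further element of \<open>S\<close>, made orthogonal to
  \<open>S'\<close>, accounts for the rest.\<close>

lemma orthogonal_projection_exists:
  assumes lin: "\<And>s s' \<alpha> \<beta>. s \<in> S \<Longrightarrow> s' \<in> S \<Longrightarrow> (\<lambda>x. \<alpha> * s x + \<beta> * s' x) \<in> S"
    and pcS: "\<And>s. s \<in> S \<Longrightarrow> pc s" and zero: "(\<lambda>x. 0) \<in> S"
    and span: "\<And>s. s \<in> S \<Longrightarrow> \<exists>c. \<forall>x\<in>{0..1}. s x = (\<Sum>i<(k::nat). c i * g i x)"
    and pcf: "pc f"
  shows "\<exists>s\<in>S. \<forall>t\<in>S. L2_inner (\<lambda>x. f x - s x) t = 0"
  using assms
proof (induction k arbitrary: S f)
  case 0
  have "L2_inner (\<lambda>x. f x - 0) t = 0" if "t \<in> S" for t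
  proof -
    have "L2_inner (\<lambda>x. f x - 0) t = L2_inner (\<lambda>x. f x - 0) (\<lambda>x. 0)"
      by (rule L2_inner_cong) (use 0(4)[OF that] in auto)
    then show ?thesis by (simp add: L2_inner_def)
  qed
  then show ?case using 0(3) by (intro bexI[of _ "\<lambda>x. 0"] ballI)
next
  case (Suc k)
  define S' where "S' = {s \<in> S. \<exists>c. \<forall>x\<in>{0..1}. s x = (\<Sum>i<k. c i * g i x)}"
  have linS': "(\<lambda>x. \<alpha> * s x + \<beta> * s' x) \<in> S'" if ss: "s \<in> S'" "s' \<in> S'" for s s' \<alpha> \<beta>
  proof -
    obtain c c' where "\<forall>x\<in>{0..1}. s x = (\<Sum>i<k. c i * g i x)" "\<forall>x\<in>{0..1}. s' x = (\<Sum>i<k. c' i * g i x)"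
      using ss unfolding S'_def by blast
    then have "\<forall>x\<in>{0..1}. \<alpha> * s x + \<beta> * s' x = (\<Sum>i<k. (\<alpha> * c i + \<beta> * c' i) * g i x)"
      by (simp add: sum_distrib_left sum.distrib algebra_simps)
    moreover have "(\<lambda>x. \<alpha> * s x + \<beta> * s' x) \<in> S" using ss Suc.prems(1) by (simp add: S'_def)
    ultimately show ?thesis unfolding S'_def by (intro CollectI conjI exI)
  qed
  have zeroS': "(\<lambda>x. 0) \<in> S'"
    using Suc.prems(3) by (auto simp: S'_def intro!: exI[of _ "\<lambda>_. 0"])
  have proj': "\<exists>s\<in>S'. \<forall>t\<in>S'. L2_inner (\<lambda>x. h x - s x) t = 0" if "pc h" for h
    by (rule Suc.IH) (use linS' zeroS' Suc.prems(2) that in \<open>auto simp: S'_def\<close>)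
  show ?case
  proof (cases "S' = S")
    case True
    show ?thesis using proj'[OF Suc.prems(5)] unfolding True .
  next
    case False
    moreover have "S' \<subseteq> S" unfolding S'_def by (rule Collect_restrict)
    ultimately obtain s0 where s0: "s0 \<in> S" "s0 \<notin> S'" by blast
    obtain d where d: "\<forall>x\<in>{0..1}. s0 x = (\<Sum>i<Suc k. d i * g i x)" using Suc.prems(4)[OF s0(1)] by (elim exE)
    have dk: "d k \<noteq> 0"
    proof
      assume "d k = 0"
      then have "\<forall>x\<in>{0..1}. s0 x = (\<Sum>i<k. d i * g i x)" using d by simp
      then have "s0 \<in> S'" using s0(1) unfolding S'_def by (intro CollectI conjI exI)
      then show False using s0(2) by contradiction
    qed
    obtain r where r: "r \<in> S'" "\<And>t. t \<in> S' \<Longrightarrow> L2_inner (\<lambda>x. s0 x - r x) t = 0"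
      using proj'[OF Suc.prems(2)[OF s0(1)]] by (elim exE bexE, blast)
    define e where "e x = s0 x - r x" for x
    have rS: "r \<in> S" using r(1) by (simp add: S'_def)
    have eS: "e \<in> S" using Suc.prems(1)[OF s0(1) rS, of 1 "-1"] by (simp add: e_def[abs_def])
    have pce: "pc e" using eS by (rule Suc.prems(2))
    obtain s1 where s1: "s1 \<in> S'" "\<And>t. t \<in> S' \<Longrightarrow> L2_inner (\<lambda>x. f x - s1 x) t = 0"
      using proj'[OF Suc.prems(5)] by (elim exE bexE, blast)
    \<comment> \<open>If \<open>e\<close> has norm 0, this quotient is 0 by convention, and
      \<open>L2_inner f e\<close> vanishes as well by Cauchy-Schwarz.\<close>
    define \<beta> where "\<beta> = L2_inner f e / L2_inner e e"
    define s where "s x = 1 * s1 x + \<beta> * e x" for x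
    have s1S: "s1 \<in> S" using s1(1) by (simp add: S'_def)
    have sS: "s \<in> S" using Suc.prems(1)[OF s1S eS, of 1 \<beta>] by (simp add: s_def[abs_def])
    have pcs: "pc s" "pc s1" "pc s0" "pc r" using sS s1S s0 rS Suc.prems(2) by auto
    note pcf = Suc.prems(5)
    have fs: "(\<lambda>x. f x - s x) = (\<lambda>x. (f x - s1 x) - \<beta> * e x)" by (auto simp: s_def)
    have e_orth: "L2_inner e t = 0" if "t \<in> S'" for t using r(2)[OF that] by (simp add: e_def[abs_def])
    have 1: "L2_inner (\<lambda>x. f x - s x) t = 0" if t: "t \<in> S'" for t
    proof -
      have "pc t" using t Suc.prems(2) by (simp add: S'_def)
      then show ?thesis
        unfolding fs using pcf pcs pce s1(2)[OF t] e_orth[OF t]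
        by (subst L2_inner_diff_left) (auto intro: pc_diff pc_cmult simp: L2_inner_cmult_left)
    qed
    have 2: "L2_inner (\<lambda>x. f x - s x) e = 0"
    proof -
      have "L2_inner (\<lambda>x. f x - s x) e = L2_inner f e - \<beta> * L2_inner e e"
        unfolding fs using pcf pcs pce e_orth[OF s1(1)]
        by (simp add: L2_inner_diff_left pc_diff pc_cmult L2_inner_cmult_left L2_inner_commute[of s1 e])
      also have "\<dots> = 0"
      proof (cases "L2_inner e e = 0")
        case True
        then have "\<bar>L2_inner f e\<bar> \<le> 0"
          using L2_Cauchy_Schwarz[OF pcf pce] by (simp add: L2_norm_def)
        then show ?thesis using True by simp
      qed (simp add: \<beta>_def)
      finally show ?thesis .
    qed
    have "L2_inner (\<lambda>x. f x - s x) t = 0" if t: "t \<in> S" for t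
    proof -
      obtain c where c: "\<forall>x\<in>{0..1}. t x = (\<Sum>i<Suc k. c i * g i x)" using Suc.prems(4)[OF t] by (elim exE)
      \<comment> \<open>Chosen to cancel the last generator, so that \<open>t'\<close> lies in
        \<open>S'\<close>; \<open>t\<close> is recovered as
        \<open>t' + \<gamma> e + \<gamma> r\<close>.\<close>
      define \<gamma> where "\<gamma> = c k / d k"
      define t' where "t' x = 1 * t x + (-\<gamma>) * s0 x" for x
      have "t' \<in> S" using Suc.prems(1)[OF t s0(1), of 1 "-\<gamma>"] by (simp add: t'_def[abs_def])
      moreover have "\<forall>x\<in>{0..1}. t' x = (\<Sum>i<k. (c i - \<gamma> * d i) * g i x)"
      proof
        fix x :: real assume "x \<in> {0..1}"
        then have "t' x = (\<Sum>i<Suc k. c i * g i x) - \<gamma> * (\<Sum>i<Suc k. d i * g i x)"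
          using c d by (simp add: t'_def)
        also have "\<dots> = (\<Sum>i<Suc k. (c i - \<gamma> * d i) * g i x)"
          by (simp only: sum_distrib_left left_diff_distrib sum_subtractf mult.assoc)
        also have "\<dots> = (\<Sum>i<k. (c i - \<gamma> * d i) * g i x)" using dk by (simp add: \<gamma>_def)
        finally show "t' x = (\<Sum>i<k. (c i - \<gamma> * d i) * g i x)" .
      qed
      ultimately have t'S: "t' \<in> S'" unfolding S'_def by (intro CollectI conjI exI)
      have "L2_inner (\<lambda>x. f x - s x) t
          = L2_inner (\<lambda>x. f x - s x) (\<lambda>x. t' x + (\<gamma> * e x + \<gamma> * r x))"
        by (rule L2_inner_cong) (auto simp: t'_def e_def algebra_simps)
      also have "\<dots> = 0"
        using 1[OF t'S] 1[OF r(1)] 2 \<open>t' \<in> S\<close> Suc.prems(2) pcf pcs pce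
        by (simp add: L2_inner_add_right pc_add pc_cmult pc_diff L2_inner_cmult_right)
      finally show ?thesis .
    qed
    then show ?thesis using sS by (intro bexI[of _ s] ballI)
  qed
qed

lemma opt_space_projection:
  assumes "pc f"
  shows "\<exists>s\<in>opt_space M q a. \<forall>t\<in>opt_space M q a. L2_inner (\<lambda>x. f x - s x) t = 0"
proof -
  obtain k g where "\<forall>s\<in>opt_space M q a. \<exists>c. \<forall>x\<in>{0..1}. s x = (\<Sum>i<(k::nat). c i * g i x)"
    using opt_space_finite_dim[of M q a] by (elim exE conjE)
  then have span: "\<exists>c. \<forall>x\<in>{0..1}. s x = (\<Sum>i<k. c i * g i x)" if "s \<in> opt_space M q a" for s
    using that by (rule bspec)
  show ?thesis
  proof (rule orthogonal_projection_exists[OF _ _ _ span assms])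
    show "(\<lambda>x. \<alpha> * s x + \<beta> * s' x) \<in> opt_space M q a"
      if "s \<in> opt_space M q a" "s' \<in> opt_space M q a" for s s' \<alpha> \<beta>
      using that by (rule opt_space_lin)
  qed (auto intro: opt_space_pc opt_space_zero)
qed

section \<open>Approximation and the Ritz projection\<close>

definition approx_const :: "nat \<Rightarrow> real" where
  "approx_const M = 2 / (real M * pi)"

lemma approx_const_pos: "M > 0 \<Longrightarrow> approx_const M > 0"
  by (simp add: approx_const_def)

text \<open>The interpolant takes on each piece the value of \<open>v\<close> at its node. On a
  halved end piece the space admits only 0, which is the value of \<open>v\<close> there by the end
  conditions. So \<open>v - s\<close> vanishes at one end of every half cell, an interval of length
  \<open>1 / M\<close>.\<close>

lemma step_approximation:
  assumes M: "M > 0" and v: "is_prim v g" "end_zeros M a v"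
  shows "\<exists>s\<in>opt_space M 0 a. L2_norm (\<lambda>x. v x - s x) \<le> approx_const M * L2_norm g"
proof -
  define s where "s x = (\<Sum>j\<in>inner_nodes M a. v (real j / real M) * node_step M j x)" for x
  have s: "s \<in> opt_space M 0 a" by (auto simp: s_def)
  have pcg: "pc g" and pce: "pc (\<lambda>x. v x - s x)"
    using is_prim_pc_deriv[OF v(1)] is_prim_pc[OF v(1)] opt_space_pc[OF s] by (auto intro: pc_diff)
  have loc: "integral {real m / real M..(real m + 1) / real M} (\<lambda>x. (v x - s x) * (v x - s x))
      \<le> (approx_const M)\<^sup>2 * integral {real m / real M..(real m + 1) / real M} (\<lambda>x. g x * g x)"
    if m: "m < M" for m
  proof -
    define k where "k = (if even m = a then m else m + 1)"
    define \<alpha> \<beta> \<gamma> where "\<alpha> = real m / real M" "\<beta> = (real m + 1) / real M" "\<gamma> = real k / real M"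
    have ab: "0 \<le> \<alpha>" "\<alpha> < \<beta>" "\<beta> \<le> 1" "\<gamma> = \<alpha> \<or> \<gamma> = \<beta>"
      using m M by (auto simp: \<alpha>_\<beta>_\<gamma>_def k_def divide_simps)
    have sv: "s x = v \<gamma>" if x: "\<alpha> \<le> x" "x < \<beta>" for x
    proof -
      have "s x = (if k \<in> {1..<M} then v (real k / real M) else 0)"
        unfolding s_def using x
        by (intro node_sum_eval[OF M m _ _ k_def]) (auto simp: \<alpha>_\<beta>_\<gamma>_def)
      moreover have "v \<gamma> = 0" if "k \<notin> {1..<M}"
      proof -
        have "k = 0 \<or> k = M" using that m by (auto simp: k_def split: if_splits)
        then show ?thesis
        proof
          assume "k = 0"
          then have "a" by (auto simp: k_def split: if_splits)
          then show ?thesis using v(2) \<open>k = 0\<close> by (simp add: end_zeros_def \<alpha>_\<beta>_\<gamma>_def)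
        next
          assume k: "k = M"
          then have "a = even M" by (auto simp: k_def split: if_splits)
          then show ?thesis using v(2) k M by (simp add: end_zeros_def \<alpha>_\<beta>_\<gamma>_def)
        qed
      qed
      ultimately show ?thesis by (simp add: \<alpha>_\<beta>_\<gamma>_def)
    qed
    have "integral {\<alpha>..\<beta>} (\<lambda>x. (v x - s x) * (v x - s x)) = integral {\<alpha>..\<beta>} (\<lambda>x. (v x - v \<gamma>)\<^sup>2)"
      by (rule integral_spike[of "{\<beta>}"]) (auto simp: sv power2_eq_square)
    also have "\<dots> \<le> (2 * (\<beta> - \<alpha>) / pi)\<^sup>2 * integral {\<alpha>..\<beta>} (\<lambda>x. (g x)\<^sup>2)"
      by (rule poincare_endpoint[OF v(1) ab])
    also have "2 * (\<beta> - \<alpha>) / pi = approx_const M"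
      by (simp add: \<alpha>_\<beta>_\<gamma>_def approx_const_def flip: diff_divide_distrib)
    finally show ?thesis by (simp add: \<alpha>_\<beta>_\<gamma>_def power2_eq_square)
  qed
  have "L2_inner (\<lambda>x. v x - s x) (\<lambda>x. v x - s x) \<le> (approx_const M)\<^sup>2 * L2_inner g g"
    using integral_grid_split[OF pc_mult[OF pce pce] order_refl M]
      integral_grid_split[OF pc_mult[OF pcg pcg] order_refl M] M
    by (auto simp: L2_inner_def sum_distrib_left intro!: sum_mono loc)
  then have "(L2_norm (\<lambda>x. v x - s x))\<^sup>2 \<le> (approx_const M * L2_norm g)\<^sup>2"
    by (simp add: L2_norm_sq power_mult_distrib)
  then have "L2_norm (\<lambda>x. v x - s x) \<le> approx_const M * L2_norm g"
    using M by (rule_tac power2_le_imp_le) (auto simp: L2_norm_nonneg approx_const_def)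
  then show ?thesis using s by blast
qed

text \<open>\<open>s\<close> is the Ritz projection of the primitive \<open>v\<close> of \<open>g\<close> in \<open>opt_space M (Suc q) a\<close>, and \<open>t\<close> is the
  derivative of \<open>s\<close>; the last condition normalizes the Neumann case.\<close>

definition ritz_pair :: "nat \<Rightarrow> nat \<Rightarrow> bool \<Rightarrow> (real \<Rightarrow> real) \<Rightarrow> (real \<Rightarrow> real) \<Rightarrow> (real \<Rightarrow> real) \<Rightarrow> (real \<Rightarrow> real) \<Rightarrow> bool" where
  "ritz_pair M q a v g s t \<longleftrightarrow>
     t \<in> opt_space M q (\<not> a) \<and> is_prim s t \<and> end_zeros M a s \<and>
     (\<forall>t'\<in>opt_space M q (\<not> a). L2_inner (\<lambda>x. g x - t x) t' = 0) \<and>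
     (\<not> a \<and> even M \<longrightarrow> integral {0..1} (\<lambda>x. v x - s x) = 0)"

lemma ritz_pair_mem: "ritz_pair M q a v g s t \<Longrightarrow> s \<in> opt_space M (Suc q) a"
  by (auto simp: ritz_pair_def)

text \<open>\<open>t\<close> is the orthogonal projection of \<open>g\<close>, and one constant of
  integration remains to be chosen. In the Dirichlet case it must serve both ends; this works
  because the dual space contains the constant 1 up to a point, so that \<open>t\<close> has the
  same mean as \<open>g\<close>, namely 0.\<close>

lemma ritz_pair_exists:
  assumes M: "M > 0" and v: "is_prim v g" "end_zeros M a v"
  shows "\<exists>s t. ritz_pair M q a v g s t"
proof -
  have pcg: "pc g" and pcv: "pc v" using is_prim_pc_deriv[OF v(1)] is_prim_pc[OF v(1)] .
  obtain t where t: "t \<in> opt_space M q (\<not> a)"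
    "\<forall>t'\<in>opt_space M q (\<not> a). L2_inner (\<lambda>x. g x - t x) t' = 0"
    using opt_space_projection[OF pcg, of M q "\<not> a"] by blast
  have pct: "pc t" using t(1) by (rule opt_space_pc)
  define T where "T x = integral {0..x} t" for x
  \<comment> \<open>Gives a zero at 0 if \<open>a\<close> holds; otherwise a zero at 1 if
    \<open>M\<close> is odd, and the mean of \<open>v\<close> in the Neumann case.\<close>
  define c where "c = (if a then 0 else if odd M then - T 1 else integral {0..1} v - integral {0..1} T)"
  define s where "s x = c + integral {0..x} t" for x
  have prim: "is_prim s t" unfolding s_def by (rule is_prim_indefinite[OF pct])
  have pcT: "pc T" using is_prim_pc[OF is_prim_indefinite[OF pct, of 0]] by (simp add: T_def[abs_def])
  have T1: "T 1 = 0" if aM: "a" "even M"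
  proof -
    obtain e where e: "e \<in> opt_space M q False" "\<forall>x\<in>{0..<1}. e x = 1"
      using opt_space_const[OF aM(2) M] by blast
    have "0 = L2_inner (\<lambda>x. g x - t x) e" using t(2) e(1) that by simp
    also have "\<dots> = L2_inner (\<lambda>x. g x - t x) (\<lambda>x. 1)"
      by (rule L2_inner_spike[of "{1}"]) (use e(2) in auto)
    also have "\<dots> = integral {0..1} g - integral {0..1} t"
      unfolding L2_inner_def
      using Henstock_Kurzweil_Integration.integral_diff[OF pc_integrable[OF pcg] pc_integrable[OF pct]] by simp
    also have "integral {0..1} g = v 1 - v 0" using is_prim_integral[OF v(1), of 0 1] by simp
    also have "\<dots> = 0" using v(2) that by (simp add: end_zeros_def)
    finally show ?thesis by (simp add: T_def)
  qed
  have "end_zeros M a s"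
    using T1 by (auto simp: end_zeros_def s_def c_def T_def)
  moreover have "integral {0..1} (\<lambda>x. v x - s x) = 0" if "\<not> a" "even M"
  proof -
    have "integral {0..1} (\<lambda>x. v x - s x) = integral {0..1} v - integral {0..1} (\<lambda>x. c + T x)"
      unfolding s_def T_def[symmetric]
      by (intro Henstock_Kurzweil_Integration.integral_diff pc_integrable pcv pc_add pc_const pcT)
    also have "integral {0..1} (\<lambda>x. c + T x) = c + integral {0..1} T"
      using Henstock_Kurzweil_Integration.integral_add[OF pc_integrable[OF pc_const[of c]] pc_integrable[OF pcT]]
      by simp
    finally show ?thesis using that by (simp add: c_def)
  qed
  ultimately show ?thesis using t prim unfolding ritz_pair_def by blast
qed

text \<open>If the dual conditions are those of Dirichlet, a primitive vanishing at both ends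
  requires mean 0: the origin of the normalization in \<open>ritz_pair\<close>. In the other cases
  the constant of integration is enough.\<close>

lemma dual_primitive_exists:
  assumes pce: "pc e" and mean: "\<not> a \<Longrightarrow> even M \<Longrightarrow> integral {0..1} e = 0"
  shows "\<exists>z. is_prim z (\<lambda>x. - e x) \<and> end_zeros M (\<not> a) z"
proof -
  define z where "z x = (if a \<and> odd M then integral {0..1} e else 0) - integral {0..x} e" for x
  have "is_prim z (\<lambda>x. - e x)"
    using is_prim_diff[OF is_prim_const is_prim_indefinite[OF pce, of 0]] by (simp add: z_def[abs_def])
  moreover have "end_zeros M (\<not> a) z"
    using mean by (auto simp: end_zeros_def z_def)
  ultimately show ?thesis by blast
qed

text \<open>Duality: with \<open>e = v - s\<close> and a primitive \<open>z\<close> of \<open>- e\<close> satisfying the dual end conditions,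
  \<open>(e, e) = (e', z) = (e', z - s')\<close> for all \<open>s'\<close> in the dual space.\<close>

lemma ritz_pair_error:
  assumes M: "M > 0" and v: "is_prim v g" "end_zeros M a v"
    and approx: "\<And>z z'. is_prim z z' \<Longrightarrow> end_zeros M (\<not> a) z \<Longrightarrow>
      \<exists>s\<in>opt_space M q (\<not> a). L2_norm (\<lambda>x. z x - s x) \<le> C * L2_norm z'"
    and C: "C \<ge> 0" and ritz: "ritz_pair M q a v g s t"
  shows "L2_norm (\<lambda>x. v x - s x) \<le> C * L2_norm (\<lambda>x. g x - t x)"
proof -
  define e where "e x = v x - s x" for x
  define \<eta> where "\<eta> x = g x - t x" for x
  have rp: "t \<in> opt_space M q (\<not> a)" "is_prim s t" "end_zeros M a s"
    and orth: "\<And>t'. t' \<in> opt_space M q (\<not> a) \<Longrightarrow> L2_inner \<eta> t' = 0"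
    and mean: "\<not> a \<Longrightarrow> even M \<Longrightarrow> integral {0..1} e = 0"
    using ritz by (auto simp: ritz_pair_def \<eta>_def[abs_def] e_def[abs_def])
  have e: "is_prim e \<eta>" using is_prim_diff[OF v(1) rp(2)] by (simp add: e_def[abs_def] \<eta>_def[abs_def])
  have pce: "pc e" and pc\<eta>: "pc \<eta>" using is_prim_pc[OF e] is_prim_pc_deriv[OF e] .
  have e_ends: "end_zeros M a e" using v(2) rp(3) by (auto simp: end_zeros_def e_def)
  obtain z where z: "is_prim z (\<lambda>x. - e x)" and z_ends: "end_zeros M (\<not> a) z"
    using dual_primitive_exists[OF pce mean] by blast
  obtain s' where s': "s' \<in> opt_space M q (\<not> a)" "L2_norm (\<lambda>x. z x - s' x) \<le> C * L2_norm (\<lambda>x. - e x)"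
    using approx[OF z z_ends] by blast
  have pcz: "pc z" "pc s'" using is_prim_pc[OF z] opt_space_pc[OF s'(1)] .
  have "L2_inner e (\<lambda>x. - e x) + L2_inner \<eta> z = e 1 * z 1 - e 0 * z 0"
    by (rule L2_integration_by_parts[OF e z])
  \<comment> \<open>The end conditions of \<open>e\<close> and \<open>z\<close> are complementary,
    so at each end one of the two factors vanishes.\<close>
  also have "\<dots> = 0" using e_ends z_ends by (auto simp: end_zeros_def)
  finally have "L2_inner e e = L2_inner \<eta> z"
    using L2_inner_cmult_right[of e "-1" e] by simp
  also have "\<dots> = L2_inner \<eta> (\<lambda>x. z x - s' x)"
    using orth[OF s'(1)] pcz pc\<eta> by (simp add: L2_inner_diff_right)
  also have "\<dots> \<le> L2_norm \<eta> * L2_norm (\<lambda>x. z x - s' x)"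
    using L2_Cauchy_Schwarz[OF pc\<eta> pc_diff[OF pcz]] by linarith
  also have "\<dots> \<le> L2_norm \<eta> * (C * L2_norm e)"
    using s'(2) L2_norm_cmult[of "-1" e] by (intro mult_left_mono) (auto simp: L2_norm_nonneg)
  finally have "L2_norm e * L2_norm e \<le> (C * L2_norm \<eta>) * L2_norm e"
    by (simp add: L2_norm_sq[symmetric] power2_eq_square algebra_simps)
  moreover have "C * L2_norm \<eta> \<ge> 0" using C by (simp add: L2_norm_nonneg)
  ultimately have "L2_norm e \<le> C * L2_norm \<eta>"
    using L2_norm_nonneg[of e] by (cases "L2_norm e = 0") auto
  then show ?thesis by (simp add: e_def[abs_def] \<eta>_def[abs_def])
qed

lemma ritz_pair_best:
  assumes pcg: "pc g" and ritz: "ritz_pair M q a v g s t" and s': "s' \<in> opt_space M q (\<not> a)"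
  shows "L2_norm (\<lambda>x. g x - t x) \<le> L2_norm (\<lambda>x. g x - s' x)"
proof (rule power2_le_imp_le)
  have t: "t \<in> opt_space M q (\<not> a)"
    and orth: "\<And>t'. t' \<in> opt_space M q (\<not> a) \<Longrightarrow> L2_inner (\<lambda>x. g x - t x) t' = 0"
    using ritz by (auto simp: ritz_pair_def)
  have pcs: "pc t" "pc s'" using t s' opt_space_pc by auto
  have "(L2_norm (\<lambda>x. (g x - t x) - (s' x - t x)))\<^sup>2
      = (L2_norm (\<lambda>x. g x - t x))\<^sup>2 + (L2_norm (\<lambda>x. s' x - t x))\<^sup>2"
    by (intro L2_pythagoras pc_diff pcg pcs orth opt_space_diff s' t)
  then show "(L2_norm (\<lambda>x. g x - t x))\<^sup>2 \<le> (L2_norm (\<lambda>x. g x - s' x))\<^sup>2" by simp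
qed (rule L2_norm_nonneg)

text \<open>Duality supplies the constant of the dual space of one degree less, while projecting the
  derivative leaves an error of at most \<open>L2_norm g\<close>. Hence the constant does not grow
  with the degree. The hypothesis is invoked for the negated \<open>a\<close>.\<close>

theorem opt_space_approximation:
  assumes "M > 0" "is_prim v g" "end_zeros M a v"
  shows "\<exists>s\<in>opt_space M q a. L2_norm (\<lambda>x. v x - s x) \<le> approx_const M * L2_norm g"
  using assms
proof (induction q arbitrary: a v g)
  case 0
  then show ?case by (rule step_approximation)
next
  case (Suc q)
  obtain s t where st: "ritz_pair M q a v g s t" using ritz_pair_exists[OF Suc.prems] by blast
  have C: "approx_const M \<ge> 0" using approx_const_pos[OF Suc.prems(1)] by simp
  have "L2_norm (\<lambda>x. v x - s x) \<le> approx_const M * L2_norm (\<lambda>x. g x - t x)"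
    by (rule ritz_pair_error[OF Suc.prems Suc.IH[OF Suc.prems(1)] C st])
  also have "\<dots> \<le> approx_const M * L2_norm g"
    using ritz_pair_best[OF is_prim_pc_deriv[OF Suc.prems(2)] st opt_space_zero] C
    by (intro mult_left_mono) simp_all
  finally show ?case using ritz_pair_mem[OF st] by blast
qed

text \<open>\<open>f m\<close> is the \<open>m\<close>-th derivative of \<open>f 0\<close>.\<close>

theorem ritz_pair_error_smooth:
  assumes M: "M > 0"
    and f: "\<And>m. is_prim (f m) (f (Suc m))" "\<And>m. end_zeros M (a = even m) (f m)"
    and ritz: "ritz_pair M q a (f 0) (f 1) s t"
  shows "L2_norm (\<lambda>x. f 0 x - s x) \<le> approx_const M ^ (q + 2) * L2_norm (f (q + 2))"
  using f ritz
proof (induction q arbitrary: a f s t)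
  case 0
  \<comment> \<open>In degree 0 there is no Ritz projection to recurse on; the step approximation of
    \<open>f 1\<close> gives the second factor.\<close>
  obtain s' where s': "s' \<in> opt_space M 0 (\<not> a)"
    "L2_norm (\<lambda>x. f 1 x - s' x) \<le> approx_const M * L2_norm (f 2)"
    using step_approximation[OF M 0(1)[of 1], of "\<not> a"] 0(2)[of 1] by (auto simp: numeral_2_eq_2)
  have C: "approx_const M \<ge> 0" using approx_const_pos[OF M] by simp
  have f0: "is_prim (f 0) (f 1)" "end_zeros M a (f 0)" using 0(1)[of 0] 0(2)[of 0] by simp_all
  have "L2_norm (\<lambda>x. f 0 x - s x) \<le> approx_const M * L2_norm (\<lambda>x. f 1 x - t x)"
    by (rule ritz_pair_error[OF M f0 opt_space_approximation[OF M] C 0(3)])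
  also have "\<dots> \<le> approx_const M * L2_norm (\<lambda>x. f 1 x - s' x)"
    by (intro mult_left_mono C ritz_pair_best[OF is_prim_pc_deriv[OF f0(1)] 0(3) s'(1)])
  also have "\<dots> \<le> approx_const M * (approx_const M * L2_norm (f 2))"
    by (intro mult_left_mono C s'(2))
  finally show ?case by (simp add: power2_eq_square mult.assoc numeral_2_eq_2)
next
  case (Suc q)
  have C: "approx_const M \<ge> 0" using approx_const_pos[OF M] by simp
  have f0: "is_prim (f 0) (f 1)" "end_zeros M a (f 0)" using Suc(2)[of 0] Suc(3)[of 0] by simp_all
  have f1: "is_prim (f 1) (f 2)" "end_zeros M (\<not> a) (f 1)"
    using Suc(2)[of 1] Suc(3)[of 1] by (simp_all add: numeral_2_eq_2)
  \<comment> \<open>The Ritz projection of \<open>f 1\<close> for the dual conditions competes with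
    \<open>t\<close>. The induction hypothesis supplies \<open>q + 2\<close> factors for it, and
    duality adds one more.\<close>
  obtain s' t' where st': "ritz_pair M q (\<not> a) (f 1) (f 2) s' t'"
    using ritz_pair_exists[OF M f1] by blast
  have ends: "end_zeros M ((\<not> a) = even m) (f (Suc m))" for m
    using Suc(3)[of "Suc m"] by (cases "even m"; cases a) auto
  have "L2_norm (\<lambda>x. f 1 x - s' x) \<le> approx_const M ^ (q + 2) * L2_norm (f (Suc (q + 2)))"
    using Suc.IH[of "\<lambda>m. f (Suc m)" "\<not> a" s' t'] Suc(2) ends st' by (simp add: numeral_2_eq_2)
  note IH = this
  have "L2_norm (\<lambda>x. f 0 x - s x) \<le> approx_const M * L2_norm (\<lambda>x. f 1 x - t x)"
    by (rule ritz_pair_error[OF M f0 opt_space_approximation[OF M] C Suc(4)])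
  also have "\<dots> \<le> approx_const M * L2_norm (\<lambda>x. f 1 x - s' x)"
    by (intro mult_left_mono C ritz_pair_best[OF is_prim_pc_deriv[OF f0(1)] Suc(4) ritz_pair_mem[OF st']])
  also have "\<dots> \<le> approx_const M * (approx_const M ^ (q + 2) * L2_norm (f (Suc (q + 2))))"
    by (intro mult_left_mono C IH)
  finally show ?case by (simp add: mult.assoc)
qed

section \<open>Splines\<close>

lemma D01_eq:
  assumes "x \<in> {0..1}" "(f has_vector_derivative y) (at x within {0..1})"
  shows "D01 f x = y"
  unfolding D01_def using vector_derivative_within_closed_interval[of 0 1 x f y] assms by simp

lemma D01_cong:
  assumes "\<And>x. x \<in> {0..1} \<Longrightarrow> f x = g x" "x \<in> {0..1}"
  shows "D01 f x = D01 g x"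
  unfolding D01_def using assms by (intro vector_derivative_cong_eq) (auto intro: always_eventually)

lemma D01_funpow_cong:
  assumes "\<And>x. x \<in> {0..1} \<Longrightarrow> f x = g x"
  shows "x \<in> {0..1} \<Longrightarrow> (D01 ^^ j) f x = (D01 ^^ j) g x"
proof (induction j arbitrary: x)
  case (Suc j)
  then show ?case using D01_cong[of "(D01 ^^ j) f" "(D01 ^^ j) g" x] by simp
qed (use assms in simp)

lemma D01_funpow_Suc: "(D01 ^^ Suc j) f = (D01 ^^ j) (D01 f)"
  by (simp only: funpow_Suc_right o_apply)

lemma differentiable_on_cong:
  fixes f g :: "real \<Rightarrow> real"
  assumes "\<And>x. x \<in> {0..1} \<Longrightarrow> f x = g x"
  shows "f differentiable_on {0..1} \<longleftrightarrow> g differentiable_on {0..1::real}"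
proof -
  have *: "k differentiable_on {0..1}" if "h differentiable_on {0..1}" "\<And>x. x \<in> {0..1} \<Longrightarrow> h x = k x"
    for h k :: "real \<Rightarrow> real"
    unfolding differentiable_on_def
  proof
    fix x :: real assume x: "x \<in> {0..1}"
    have "h differentiable (at x within {0..1})" using that(1) x by (simp add: differentiable_on_def)
    then show "k differentiable (at x within {0..1})"
      by (rule differentiable_transform_within[OF _ zero_less_one x]) (rule that(2))
  qed
  show ?thesis using *[of f g] *[of g f] assms by auto
qed

lemma differentiable_on_D01:
  assumes "f differentiable_on {0..1}" "x \<in> {0..1}"
  shows "(f has_vector_derivative D01 f x) (at x within {0..1})"
  using assms unfolding differentiable_on_def D01_def
  by (simp add: vector_derivative_works)

lemma Ck01_Suc_iff: "f \<in> Ck01 (Suc k) \<longleftrightarrow> f differentiable_on {0..1} \<and> D01 f \<in> Ck01 k"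
proof -
  have "(\<forall>j<Suc k. (D01 ^^ j) f differentiable_on {0..1}) \<longleftrightarrow>
      f differentiable_on {0..1} \<and> (\<forall>j<k. (D01 ^^ j) (D01 f) differentiable_on {0..1})"
    unfolding All_less_Suc2 D01_funpow_Suc by simp
  moreover have "(\<forall>j\<le>Suc k. continuous_on {0..1} ((D01 ^^ j) f)) \<longleftrightarrow>
      continuous_on {0..1} f \<and> (\<forall>j\<le>k. continuous_on {0..1} ((D01 ^^ j) (D01 f)))"
    unfolding less_Suc_eq_le[symmetric] All_less_Suc2 D01_funpow_Suc by simp
  moreover have "continuous_on {0..1} f" if "f differentiable_on {0..1}"
    using that by (rule differentiable_imp_continuous_on)
  ultimately show ?thesis unfolding Ck01_def by blast
qed

lemma Ck01_continuous: "f \<in> Ck01 k \<Longrightarrow> continuous_on {0..1} f"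
  unfolding Ck01_def by (force dest: spec[of _ 0])

lemma Ck01_cong:
  assumes "\<And>x. x \<in> {0..1} \<Longrightarrow> f x = g x"
  shows "f \<in> Ck01 k \<longleftrightarrow> g \<in> Ck01 k"
proof -
  have "(D01 ^^ j) f differentiable_on {0..1} \<longleftrightarrow> (D01 ^^ j) g differentiable_on {0..1}" for j
    by (intro differentiable_on_cong D01_funpow_cong assms)
  moreover have "continuous_on {0..1} ((D01 ^^ j) f) \<longleftrightarrow> continuous_on {0..1} ((D01 ^^ j) g)" for j
    by (intro continuous_on_cong D01_funpow_cong assms refl)
  ultimately show ?thesis unfolding Ck01_def by simp
qed

text \<open>\<open>D01\<close> can differ from the given derivatives at finitely many points only,
  such as the kinks of degree 1 splines.\<close>

lemma L2_inner_D01: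
  assumes "is_prim s t" "is_prim s' t'"
  shows "L2_inner (D01 s) (D01 s') = L2_inner t t'"
proof -
  obtain F where F: "finite F"
    "\<And>x. x \<in> {0..1} - F \<Longrightarrow> (s has_vector_derivative t x) (at x within {0..1})"
    using is_prim_has_derivative[OF assms(1)] by blast
  obtain F' where F': "finite F'"
    "\<And>x. x \<in> {0..1} - F' \<Longrightarrow> (s' has_vector_derivative t' x) (at x within {0..1})"
    using is_prim_has_derivative[OF assms(2)] by blast
  show ?thesis
    by (rule L2_inner_spike[of "F \<union> F'"]) (use F F' D01_eq in auto)
qed

lemma pderiv_sum: "pderiv (\<Sum>i\<in>A. f i) = (\<Sum>i\<in>A. pderiv (f i))"
  by (induction A rule: infinite_finite_induct) (auto simp: pderiv_add)

lemma poly_antiderivative: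
  fixes Q :: "real poly"
  shows "\<exists>P. pderiv P = Q \<and> degree P \<le> Suc (degree Q)"
proof -
  define P where "P = (\<Sum>i\<le>degree Q. monom (coeff Q i / real (Suc i)) (Suc i))"
  have "pderiv P = (\<Sum>i\<le>degree Q. monom (coeff Q i) i)"
    unfolding P_def pderiv_sum by (intro sum.cong) (simp_all add: pderiv_monom)
  also have "\<dots> = Q" by (rule poly_as_sum_of_monoms)
  finally have "pderiv P = Q" .
  moreover have "degree P \<le> Suc (degree Q)"
    unfolding P_def by (intro degree_sum_le) (auto intro: order_trans[OF degree_monom_le])
  ultimately show ?thesis by blast
qed

lemma poly_has_vector_derivative:
  "(poly Q has_vector_derivative poly (pderiv Q) x) (at x within S)" for Q :: "real poly"
  using poly_DERIV[of Q x] has_vector_derivative_at_within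
  by (auto simp: has_real_derivative_iff_has_vector_derivative)

section \<open>Piecewise polynomials on the cells of the grid\<close>

definition cell :: "nat \<Rightarrow> nat \<Rightarrow> real set" where
  "cell M k = {max 0 ((real k - 1) / real M)..min 1 ((real k + 1) / real M)}"

lemma cell_nondegenerate:
  assumes "M > 0" "k \<le> M"
  shows "0 \<le> max 0 ((real k - 1) / real M)" "max 0 ((real k - 1) / real M) < min 1 ((real k + 1) / real M)"
    "min 1 ((real k + 1) / real M) \<le> 1" "cell M k \<subseteq> {0..1}"
proof -
  have "(real k - 1) / real M < 1" "0 < (real k + 1) / real M" "(real k - 1) / real M < (real k + 1) / real M"
    using assms by (simp_all add: divide_less_eq divide_strict_right_mono)
  then show "max 0 ((real k - 1) / real M) < min 1 ((real k + 1) / real M)" by simp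
qed (auto simp: cell_def)

text \<open>A derivative within \<open>[0, 1]\<close> is also one within the cell, a nondegenerate
  interval on which derivatives are unique up to its ends. So the polynomial of this cell decides
  even where another piece begins.\<close>

lemma derivative_on_cell:
  assumes M: "M > 0" "k \<le> M" and x: "x \<in> cell M k"
    and s: "(s has_vector_derivative d) (at x within {0..1})"
    and Q: "\<forall>x\<in>cell M k. s x = poly Q x"
  shows "d = poly (pderiv Q) x"
proof (rule vector_derivative_unique_within_closed_interval)
  show "max 0 ((real k - 1) / real M) < min 1 ((real k + 1) / real M)" by (rule cell_nondegenerate[OF M])
  have c: "cbox (max 0 ((real k - 1) / real M)) (min 1 ((real k + 1) / real M)) = cell M k"
    by (simp add: cell_def)
  show "x \<in> cbox (max 0 ((real k - 1) / real M)) (min 1 ((real k + 1) / real M))" using x c by simp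
  show "(s has_vector_derivative d) (at x within cbox (max 0 ((real k - 1) / real M)) (min 1 ((real k + 1) / real M)))"
    unfolding c by (rule has_vector_derivative_within_subset[OF s cell_nondegenerate(4)[OF M]])
  show "(s has_vector_derivative poly (pderiv Q) x) (at x within cbox (max 0 ((real k - 1) / real M)) (min 1 ((real k + 1) / real M)))"
    unfolding c by (rule has_vector_derivative_transform_within[OF poly_has_vector_derivative zero_less_one x])
      (use Q in simp)
qed

text \<open>The bridge between \<open>opt_spline_space\<close> and the recursion. After
  \<open>p\<close> derivatives \<open>a\<close> has been flipped \<open>p\<close> times, so the
  nodes in degree 0, which are the centers of the pieces, are the \<open>k\<close> with
  \<open>even k = (a = even p)\<close>.\<close>

definition cellwise_spline :: "nat \<Rightarrow> nat \<Rightarrow> bool \<Rightarrow> (real \<Rightarrow> real) \<Rightarrow> bool" where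
  "cellwise_spline M p a s \<longleftrightarrow> s \<in> Ck01 (p - 1) \<and>
     (\<forall>k\<le>M. even k = (a = even p) \<longrightarrow> (\<exists>Q::real poly. degree Q \<le> p \<and> (\<forall>x\<in>cell M k. s x = poly Q x))) \<and>
     (\<forall>\<alpha>\<le>p. even \<alpha> = a \<longrightarrow> (D01 ^^ \<alpha>) s 0 = 0) \<and>
     (\<forall>\<alpha>\<le>p. even \<alpha> = (a = even M) \<longrightarrow> (D01 ^^ \<alpha>) s 1 = 0)"

lemma All_le_Suc2: "(\<forall>\<alpha>\<le>Suc p. P \<alpha>) \<longleftrightarrow> P 0 \<and> (\<forall>\<alpha>\<le>p. P (Suc \<alpha>))"
  unfolding less_Suc_eq_le[symmetric] All_less_Suc2 ..

text \<open>For \<open>p \<ge> 1\<close> the derivative is continuous, so it agrees with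
  \<open>D01 s\<close> everywhere, and all parity conditions shift by one order. For degree 1 this
  fails at the break points, hence the separate base case.\<close>

lemma cellwise_spline_Suc:
  assumes M: "M > 0" and p: "p \<ge> 1"
  shows "cellwise_spline M (Suc p) a s \<longleftrightarrow>
    (\<exists>t. cellwise_spline M p (\<not> a) t \<and> is_prim s t \<and> end_zeros M a s)"
proof
  assume s: "cellwise_spline M (Suc p) a s"
  define t where "t = D01 s"
  have "s \<in> Ck01 (Suc (p - 1))" using s p by (simp add: cellwise_spline_def)
  then have diff: "s differentiable_on {0..1}" and t: "t \<in> Ck01 (p - 1)"
    by (auto simp: Ck01_Suc_iff t_def)
  have "is_prim s t"
  proof (rule is_primI[of _ _ "{}"])
    show "continuous_on {0..1} s" using diff by (rule differentiable_imp_continuous_on)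
    show "pc t" using t by (intro pc_continuous Ck01_continuous)
  qed (use differentiable_on_D01[OF diff] in \<open>auto simp: t_def\<close>)
  moreover have "end_zeros M a s"
    using s by (auto simp: cellwise_spline_def end_zeros_def All_le_Suc2)
  moreover have "cellwise_spline M p (\<not> a) t"
    unfolding cellwise_spline_def
  proof (intro conjI t allI impI)
    fix k assume k: "k \<le> M" "even k = ((\<not> a) = even p)"
    then have "even k = (a = even (Suc p))" by auto
    with s k obtain Q :: "real poly" where Q: "degree Q \<le> Suc p" "\<forall>x\<in>cell M k. s x = poly Q x"
      unfolding cellwise_spline_def by blast
    have "\<forall>x\<in>cell M k. t x = poly (pderiv Q) x"
      using derivative_on_cell[OF M k(1) _ _ Q(2)] differentiable_on_D01[OF diff] cell_nondegenerate(4)[OF M k(1)]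
      unfolding t_def by blast
    moreover have "degree (pderiv Q) \<le> p" using Q(1) by (simp add: degree_pderiv)
    ultimately show "\<exists>Q. degree Q \<le> p \<and> (\<forall>x\<in>cell M k. t x = poly Q x)" by blast
  qed (use s in \<open>auto simp: cellwise_spline_def t_def All_le_Suc2 D01_funpow_Suc simp del: funpow.simps\<close>)
  ultimately show "\<exists>t. cellwise_spline M p (\<not> a) t \<and> is_prim s t \<and> end_zeros M a s" by blast
next
  assume "\<exists>t. cellwise_spline M p (\<not> a) t \<and> is_prim s t \<and> end_zeros M a s"
  then obtain t where t: "cellwise_spline M p (\<not> a) t" and st: "is_prim s t" and ends: "end_zeros M a s" by blast
  have contt: "continuous_on {0..1} t" using t by (auto simp: cellwise_spline_def intro: Ck01_continuous)
  have der: "(s has_vector_derivative t x) (at x within {0..1})" if "x \<in> {0..1}" for x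
    using is_prim_has_derivative_at[OF st that] contt that by (simp add: continuous_on_eq_continuous_within)
  have D: "D01 s x = t x" if "x \<in> {0..1}" for x using D01_eq[OF that der[OF that]] .
  have diff: "s differentiable_on {0..1}"
    using der unfolding differentiable_on_def by (meson differentiableI_vector)
  have Djs: "(D01 ^^ Suc j) s x = (D01 ^^ j) t x" if "x \<in> {0..1}" for j x
    unfolding D01_funpow_Suc by (rule D01_funpow_cong[OF D that])
  have "s \<in> Ck01 (Suc (p - 1))"
    using t diff Ck01_cong[of "D01 s" t, OF D] by (auto simp: Ck01_Suc_iff cellwise_spline_def)
  then have "s \<in> Ck01 (Suc p - 1)" using p by simp
  moreover have "\<exists>Q::real poly. degree Q \<le> Suc p \<and> (\<forall>x\<in>cell M k. s x = poly Q x)"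
    if k: "k \<le> M" "even k = (a = even (Suc p))" for k
  proof -
    have "even k = ((\<not> a) = even p)" using k by auto
    with t k obtain Q :: "real poly" where Q: "degree Q \<le> p" "\<forall>x\<in>cell M k. t x = poly Q x"
      unfolding cellwise_spline_def by blast
    obtain P where P: "pderiv P = Q" "degree P \<le> Suc (degree Q)" using poly_antiderivative by blast
    define \<alpha> where "\<alpha> = max 0 ((real k - 1) / real M)"
    define R where "R = P + [:s \<alpha> - poly P \<alpha>:]"
    have "s x = poly R x" if x: "x \<in> cell M k" for x
    proof -
      have \<alpha>: "0 \<le> \<alpha>" "\<alpha> \<le> x" "x \<le> 1" "{\<alpha>..x} \<subseteq> cell M k"
        using x cell_nondegenerate[OF M k(1)] by (auto simp: cell_def \<alpha>_def)
      have "s x - s \<alpha> = integral {\<alpha>..x} t" by (rule is_prim_integral[OF st \<alpha>(1-3)])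
      also have "\<dots> = integral {\<alpha>..x} (poly Q)"
        by (rule Henstock_Kurzweil_Integration.integral_cong) (use Q(2) \<alpha>(4) in blast)
      also have "\<dots> = poly P x - poly P \<alpha>"
        using fundamental_theorem_of_calculus[OF \<alpha>(2), of "poly P" "poly Q"] poly_has_vector_derivative[of P] P(1)
        by (simp add: integral_unique)
      finally show ?thesis by (simp add: R_def)
    qed
    moreover have "degree R \<le> Suc p"
      unfolding R_def by (intro degree_add_le) (use P(2) Q(1) in auto)
    ultimately show ?thesis by blast
  qed
  moreover have "(\<forall>\<alpha>\<le>Suc p. even \<alpha> = a \<longrightarrow> (D01 ^^ \<alpha>) s 0 = 0)"
    "(\<forall>\<alpha>\<le>Suc p. even \<alpha> = (a = even M) \<longrightarrow> (D01 ^^ \<alpha>) s 1 = 0)"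
    using t ends unfolding All_le_Suc2 
    by (auto simp: cellwise_spline_def end_zeros_def Djs simp del: funpow.simps(2))
  ultimately show "cellwise_spline M (Suc p) a s" unfolding cellwise_spline_def by blast
qed

text \<open>A cell consists of the half cells on both sides of \<open>k\<close>, and
  \<open>k\<close> is the node of each. The right end of the cell is excluded because the steps are
  half-open.\<close>

lemma grid_cell:
  assumes M: "M > 0" and k: "k \<le> M" and x: "x \<in> cell M k" "x \<noteq> min 1 ((real k + 1) / real M)"
    and a: "even k = a"
  shows "(\<Sum>j\<in>inner_nodes M a. c j * node_step M j x) = (if k \<in> {1..<M} then c k else 0)"
proof -
  have b: "0 \<le> x" "x < 1" "real k - 1 \<le> x * real M" "x * real M < real k + 1"
  proof -
    have "0 \<le> x" "(real k - 1) / real M \<le> x" "x < 1" "x < (real k + 1) / real M"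
      using x by (auto simp: cell_def min_def split: if_splits)
    then show "0 \<le> x" "x < 1" "real k - 1 \<le> x * real M" "x * real M < real k + 1"
      using M by (simp_all add: divide_le_eq less_divide_eq)
  qed
  define m where "m = (if real k \<le> x * real M then k else k - 1)"
  have "x * real M < real M" using b M by simp
  then have mM: "m < M"
  proof (cases "real k \<le> x * real M")
    case True
    then have "real k < real M" using \<open>x * real M < real M\<close> by linarith
    then show ?thesis using True by (simp add: m_def)
  next
    case False
    moreover have "0 \<le> x * real M" using b(1) by simp
    ultimately have "k \<noteq> 0" by (cases k) auto
    then show ?thesis using False k by (auto simp: m_def)
  qed
  have "real m \<le> x * real M \<and> x * real M < real m + 1"
    using b M by (cases "k = 0") (auto simp: m_def of_nat_diff)
  then have mx: "real m / real M \<le> x" "x < (real m + 1) / real M" using M by (auto simp: field_simps)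
  have km: "k = (if even m = a then m else m + 1)"
    using a b M by (cases "k = 0") (auto simp: m_def)
  show ?thesis by (rule node_sum_eval[OF M mM mx km])
qed

text \<open>The derivative is assembled from the slopes of \<open>s\<close> on the cells, as
  \<open>D01 s\<close> is unspecified at break points. At an end without a prescribed zero, the
  condition on \<open>D01\<close> says that the halved end cell has slope 0, which matches the
  absence of end nodes from the step functions.\<close>

lemma cellwise_spline_1:
  assumes M: "M > 0"
  shows "cellwise_spline M (Suc 0) a s \<longleftrightarrow> s \<in> opt_space M (Suc 0) a"
proof
  assume s: "cellwise_spline M (Suc 0) a s"
  have cont: "continuous_on {0..1} s" using s by (auto simp: cellwise_spline_def intro: Ck01_continuous)
  have "\<exists>d. \<exists>e. k \<le> M \<longrightarrow> even k = (\<not> a) \<longrightarrow> (\<forall>x\<in>cell M k. s x = e + d * x)" for k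
  proof (cases "k \<le> M \<and> even k = (\<not> a)")
    case True
    then have "even k = (a = even (Suc 0))" by simp
    then obtain Q :: "real poly" where Q: "degree Q \<le> Suc 0" "\<forall>x\<in>cell M k. s x = poly Q x"
      using s True unfolding cellwise_spline_def by blast
    have "poly Q x = coeff Q 0 + coeff Q 1 * x" for x
      using Q(1) by (simp add: poly_altdef le_Suc_eq) (auto simp: coeff_eq_0)
    then show ?thesis using Q(2) by auto
  qed auto
  then obtain d e where de: "\<And>k x. k \<le> M \<Longrightarrow> even k = (\<not> a) \<Longrightarrow> x \<in> cell M k \<Longrightarrow> s x = e k + d k * x"
    by metis
  have der: "(s has_vector_derivative d k) (at x within {0..1})"
    if k: "k \<le> M" "even k = (\<not> a)" and x: "\<bar>x - real k / real M\<bar> < 1 / real M" "x \<in> {0..1}" for k x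
  proof (rule has_vector_derivative_transform_within)
    show "((\<lambda>x. e k + d k * x) has_vector_derivative d k) (at x within {0..1})"
      by (auto intro!: derivative_eq_intros)
    show "0 < 1 / real M - \<bar>x - real k / real M\<bar>" "x \<in> {0..1}" using x by simp_all
    fix y assume y: "y \<in> {0..1}" "dist y x < 1 / real M - \<bar>x - real k / real M\<bar>"
    then have "\<bar>y - real k / real M\<bar> < 1 / real M" by (auto simp: dist_real_def)
    then have "y \<in> cell M k" using y(1) by (auto simp: cell_def diff_divide_distrib add_divide_distrib)
    then show "e k + d k * y = s y" using de[OF k] by simp
  qed
  have d0: "d 0 = 0" if "\<not> a"
  proof -
    have "D01 s 0 = 0" using s that by (simp add: cellwise_spline_def All_le_Suc2)
    moreover have "D01 s 0 = d 0" using der[of 0 0] M that by (intro D01_eq) auto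
    ultimately show ?thesis by simp
  qed
  have d1: "d M = 0" if "even M = (\<not> a)"
  proof -
    have "D01 s 1 = 0" using s that by (simp add: cellwise_spline_def All_le_Suc2)
    moreover have "D01 s 1 = d M" using der[of M 1] M that by (intro D01_eq) auto
    ultimately show ?thesis by simp
  qed
  define t where "t x = (\<Sum>j\<in>inner_nodes M (\<not> a). d j * node_step M j x)" for x
  have t: "t \<in> opt_space M 0 (\<not> a)" by (auto simp: t_def)
  have "is_prim s t"
  proof (rule is_primI[OF cont opt_space_pc[OF t]])
    show "finite ((\<lambda>j. real j / real M) ` {..M})" by simp
    fix x assume x: "x \<in> {0..1} - (\<lambda>j. real j / real M) ` {..M}"
    define m where "m = nat \<lfloor>x * real M\<rfloor>"
    have m: "real m \<le> x * real M" "x * real M < real m + 1" using x by (auto simp: m_def)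
    have "x \<noteq> 1" using x M by (auto dest: bspec[of _ _ M] simp: image_iff)
    then have "x * real M < real M" using x M by simp
    then have mM: "m < M" using m by linarith
    have mne: "real m \<noteq> x * real M"
    proof
      assume "real m = x * real M"
      then have "x = real m / real M" using M by (simp add: field_simps)
      then show False using x mM by auto
    qed
    define k where "k = (if even m = (\<not> a) then m else m + 1)"
    have k: "k \<le> M" "even k = (\<not> a)" using mM by (auto simp: k_def)
    have "t x = (if k \<in> {1..<M} then d k else 0)"
      unfolding t_def using m M by (intro node_sum_eval[OF M mM _ _ k_def]) (auto simp: field_simps)
    also have "\<dots> = d k"
      using k d0 d1 by (cases "k = 0"; cases "k = M") auto
    finally have "t x = d k" .
    moreover have "\<bar>x - real k / real M\<bar> < 1 / real M"
    proof -
      have "\<bar>x * real M - real k\<bar> < 1" using m mne by (auto simp: k_def)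
      then show ?thesis using M by (simp add: abs_less_iff field_simps)
    qed
    ultimately show "(s has_vector_derivative t x) (at x within {0..1})" using der[OF k] x by simp
  qed
  moreover have "end_zeros M a s"
    using s by (auto simp: cellwise_spline_def end_zeros_def All_le_Suc2)
  ultimately show "s \<in> opt_space M (Suc 0) a" using t by auto
next
  assume "s \<in> opt_space M (Suc 0) a"
  then obtain t where t: "t \<in> opt_space M 0 (\<not> a)" and st: "is_prim s t" and ends: "end_zeros M a s" by auto
  obtain c where c: "\<forall>x\<in>{0..1}. t x = (\<Sum>j\<in>inner_nodes M (\<not> a). c j * node_step M j x)" using t by auto
  define d where "d k = (if k \<in> {1..<M} then c k else 0)" for k
  define \<alpha> where "\<alpha> k = max 0 ((real k - 1) / real M)" for k
  have lin: "s x = s (\<alpha> k) + d k * (x - \<alpha> k)" if k: "k \<le> M" "even k = (\<not> a)" and x: "x \<in> cell M k" for k x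
  proof -
    have \<alpha>: "0 \<le> \<alpha> k" "\<alpha> k \<le> x" "x \<le> 1" "{\<alpha> k..x} \<subseteq> cell M k"
      using x cell_nondegenerate[OF M k(1)] by (auto simp: cell_def \<alpha>_def)
    have "s x - s (\<alpha> k) = integral {\<alpha> k..x} t" by (rule is_prim_integral[OF st \<alpha>(1-3)])
    also have "\<dots> = integral {\<alpha> k..x} (\<lambda>_. d k)"
    proof (rule integral_spike)
      show "negligible {min 1 ((real k + 1) / real M)}" by simp
      fix y assume y: "y \<in> {\<alpha> k..x} - {min 1 ((real k + 1) / real M)}"
      then have "y \<in> cell M k" using \<alpha>(4) by auto
      then show "d k = t y"
        using c y grid_cell[OF M k(1) _ _ k(2), of y c] cell_nondegenerate(4)[OF M k(1)]
        unfolding d_def by auto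
    qed
    also have "\<dots> = d k * (x - \<alpha> k)" using \<alpha>(2) by simp
    finally show ?thesis by simp
  qed
  have cells: "\<exists>Q::real poly. degree Q \<le> Suc 0 \<and> (\<forall>x\<in>cell M k. s x = poly Q x)"
    if k: "k \<le> M" "even k = (\<not> a)" for k
    by (rule exI[of _ "[:s (\<alpha> k) - d k * \<alpha> k, d k:]"]) (use lin[OF k] in \<open>auto simp: algebra_simps\<close>)
  have flat: "D01 s x = 0" if k: "k \<le> M" "even k = (\<not> a)" "d k = 0" and x: "x = real k / real M" for k x
  proof (rule D01_eq)
    show x1: "x \<in> {0..1}" using k(1) M unfolding x by simp
    show "(s has_vector_derivative 0) (at x within {0..1})"
    proof (rule has_vector_derivative_transform_within[of "\<lambda>_. s (\<alpha> k)"])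
      show "0 < 1 / real M" using M by simp
      fix y assume y: "y \<in> {0..1}" "dist y x < 1 / real M"
      then have "y \<in> cell M k" using x
        by (auto simp: cell_def diff_divide_distrib add_divide_distrib dist_real_def)
      then show "s (\<alpha> k) = s y" using lin[OF k(1,2)] k(3) by simp
    qed (use x1 in auto)
  qed
  have "s \<in> Ck01 0" using is_prim_continuous[OF st] by (simp add: Ck01_def)
  moreover have "D01 s 0 = 0" if "\<not> a" using flat[of 0 0] that by (simp add: d_def)
  moreover have "D01 s 1 = 0" if "even M = (\<not> a)" using flat[of M 1] that M by (simp add: d_def)
  ultimately show "cellwise_spline M (Suc 0) a s"
    using ends cells by (auto simp: cellwise_spline_def end_zeros_def All_le_Suc2)
qed

theorem cellwise_spline_iff_opt_space:
  assumes "M > 0"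
  shows "cellwise_spline M (Suc q) a s \<longleftrightarrow> s \<in> opt_space M (Suc q) a"
proof (induction q arbitrary: a s)
  case 0
  show ?case by (rule cellwise_spline_1[OF assms])
next
  case (Suc q)
  have "1 \<le> Suc q" by simp
  show ?case
    unfolding cellwise_spline_Suc[OF assms \<open>1 \<le> Suc q\<close>] Suc.IH opt_space.simps(2)[of M "Suc q"]
    by (simp only: mem_Collect_eq Bex_def)
qed

section \<open>The optimal break points as grid points\<close>

fun grid_size :: "bc_type \<Rightarrow> nat \<Rightarrow> nat" where
  "grid_size Dirichlet n = 2 * n + 2"
| "grid_size Neumann n = 2 * n"
| "grid_size Mixed n = 2 * n + 1"

lemma grid_size_pos: "n \<ge> 1 \<Longrightarrow> grid_size i n > 0"
  by (cases i) auto

text \<open>The term \<open>of_bool ((i \<noteq> Neumann) = even p)\<close> is 1 exactly when 0 is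
  the center of the first piece, which is then halved.\<close>

lemma opt_breaks_length:
  "n \<ge> 1 \<Longrightarrow> length (opt_breaks p n i) - 1 =
    (grid_size i n + 1 + of_bool ((i \<noteq> Neumann) = even p)) div 2"
  by (cases i; cases "even p") (auto simp: opt_breaks_def)

text \<open>The break points have distance two grid steps, shifted by one step if the first piece is
  halved. For \<open>j = 0\<close> truncated subtraction absorbs the shift, and \<open>min 1\<close>
  cuts a last piece that is halved.\<close>

lemma opt_breaks_nth:
  assumes n: "n \<ge> 1" and m: "m = length (opt_breaks p n i) - 1" and j: "j \<le> m"
  shows "opt_breaks p n i ! j = min 1 (real (2 * j - of_bool ((i \<noteq> Neumann) = even p)) / real (grid_size i n))"
proof -
  have ge1: "1 \<le> real X / real G" if "G \<le> X" "G > 0" for X G :: nat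
    using that by (simp add: le_divide_eq)
  have le1: "real X / real G \<le> 1" if "X \<le> G" "G > 0" for X G :: nat
    using that by (simp add: divide_le_eq)
  consider "j = 0" | "j = m" "j > 0" | "0 < j" "j < m" using j by linarith
  then show ?thesis
  proof cases
    case 1
    then show ?thesis by (simp add: opt_breaks_def)
  next
    case 2
    then have "opt_breaks p n i ! j = 1" using m by (simp add: opt_breaks_def nth_append)
    moreover have "2 * j - of_bool ((i \<noteq> Neumann) = even p) \<ge> grid_size i n"
      using opt_breaks_length[OF n, of p i] 2 m n by (cases i; cases "even p") auto
    then have "1 \<le> real (2 * j - of_bool ((i \<noteq> Neumann) = even p)) / real (grid_size i n)"
      by (rule ge1[OF _ grid_size_pos[OF n]])
    ultimately show ?thesis by (simp only: min_absorb1)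
  next
    case 3
    have len: "m = length (inner_breaks p n i) + 1" using m by (simp add: opt_breaks_def)
    then have "opt_breaks p n i ! j = inner_breaks p n i ! (j - 1)"
      using 3 by (simp add: opt_breaks_def nth_append)
    also have "\<dots> = real (2 * j - of_bool ((i \<noteq> Neumann) = even p)) / real (grid_size i n)"
      using 3 len n by (cases i; cases "even p") (auto simp: of_nat_diff field_simps simp del: upt_Suc upt.simps)
    also have "\<dots> = min 1 \<dots>"
    proof -
      have "2 * j - of_bool ((i \<noteq> Neumann) = even p) \<le> grid_size i n"
        using opt_breaks_length[OF n, of p i] 3 m n by (cases i; cases "even p") auto
      from le1[OF this grid_size_pos[OF n]] show ?thesis by (rule min_absorb2[symmetric])
    qed
    finally show ?thesis .
  qed
qed

lemma poly_on_half_open: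
  fixes Q :: "real poly"
  assumes "continuous_on {\<alpha>..\<beta>} s" "\<alpha> < \<beta>" "\<forall>x\<in>{\<alpha>..<\<beta>}. s x = poly Q x" "x \<in> {\<alpha>..\<beta>}"
  shows "s x = poly Q x"
proof -
  have cl: "closure {\<alpha>..<\<beta>} = {\<alpha>..\<beta>}" using assms(2) by simp
  have "s x - poly Q x = 0"
    by (rule continuous_constant_on_closure[where S="{\<alpha>..<\<beta>}" and f="\<lambda>x. s x - poly Q x"])
      (use assms cl in \<open>auto intro!: continuous_intros\<close>)
  then show ?thesis by simp
qed

text \<open>Piece \<open>j\<close> is the cell centered at \<open>2 * j - 1 - \<sigma>\<close>, and
  these centers are all the grid points of the required parity. Continuity closes the half-open
  pieces.\<close>

lemma spline_pieces_iff_cells: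
  assumes n: "n \<ge> 1" and cont: "continuous_on {0..1} s"
    and M_def: "M = grid_size i n" and \<tau>_def: "\<tau> = opt_breaks p n i"
    and m_def: "m = length \<tau> - 1"
  shows "((\<forall>j\<in>{1..<m}. \<exists>q::real poly. degree q \<le> p \<and> (\<forall>x\<in>{\<tau> ! (j - 1)..<\<tau> ! j}. s x = poly q x)) \<and>
      (\<exists>q::real poly. degree q \<le> p \<and> (\<forall>x\<in>{\<tau> ! (m - 1)..\<tau> ! m}. s x = poly q x)))
    \<longleftrightarrow> (\<forall>k\<le>M. even k = ((i \<noteq> Neumann) = even p) \<longrightarrow>
        (\<exists>q::real poly. degree q \<le> p \<and> (\<forall>x\<in>cell M k. s x = poly q x)))"
    (is "?L \<longleftrightarrow> ?R")
proof -
  define \<sigma> :: nat where "\<sigma> = of_bool ((i \<noteq> Neumann) = even p)"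
  have \<sigma>: "\<sigma> \<le> 1" "even (1 + \<sigma>) = ((i \<noteq> Neumann) = even p)" by (auto simp: \<sigma>_def)
  have M: "M > 0" using grid_size_pos[OF n] by (simp add: M_def)
  have m: "m = (M + 1 + \<sigma>) div 2" using opt_breaks_length[OF n] by (simp add: m_def \<tau>_def M_def \<sigma>_def)
  have m1: "m \<ge> 1"
  proof (cases "M = 1")
    case True
    then have "i = Mixed \<and> n = 0" by (cases i) (auto simp: M_def)
    then show ?thesis using n by simp
  next
    case False
    then have "M \<ge> 2" using M by simp
    then show ?thesis unfolding m by simp
  qed
  have nth: "\<tau> ! j = min 1 (real (2 * j - \<sigma>) / real M)" if "j \<le> m" for j
    using opt_breaks_nth[OF n refl, of j p i] that by (simp add: m_def \<tau>_def M_def \<sigma>_def)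
  have piece: "{\<tau> ! (j - 1)..\<tau> ! j} = cell M (2 * j - 1 - \<sigma>)" "2 * j - 1 - \<sigma> \<le> M" "\<tau> ! (j - 1) < \<tau> ! j"
    "0 \<le> \<tau> ! (j - 1)" "\<tau> ! j \<le> 1" "even (2 * j - 1 - \<sigma>) = ((i \<noteq> Neumann) = even p)"
    if j: "j \<in> {1..m}" for j
  proof -
    define k where "k = 2 * j - 1 - \<sigma>"
    have k: "k \<le> M" using j unfolding k_def m by auto
    have j1: "real (2 * j - \<sigma>) = real k + 1" using j \<sigma>(1) by (simp add: k_def of_nat_diff)
    have jm: "j - 1 \<le> m" using j by auto
    have "\<tau> ! (j - 1) = max 0 ((real k - 1) / real M)"
    proof (cases "k = 0")
      case True
      then have "2 * (j - 1) - \<sigma> = 0" by (auto simp: k_def)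
      then show ?thesis using nth[OF jm] True j M by (simp add: max_def)
    next
      case False
      then have "real (2 * (j - 1) - \<sigma>) = real k - 1" by (auto simp: k_def of_nat_diff)
      then have "\<tau> ! (j - 1) = min 1 ((real k - 1) / real M)" using nth[OF jm] by simp
      moreover have "(real k - 1) / real M \<le> 1" "0 \<le> (real k - 1) / real M"
        using k M False by (auto simp: divide_le_eq)
      ultimately show ?thesis by simp
    qed
    moreover have "\<tau> ! j = min 1 ((real k + 1) / real M)" using nth[of j] j j1 by simp
    ultimately show "{\<tau> ! (j - 1)..\<tau> ! j} = cell M k" "\<tau> ! (j - 1) < \<tau> ! j" "0 \<le> \<tau> ! (j - 1)" "\<tau> ! j \<le> 1"
      using cell_nondegenerate[OF M k] by (simp_all only: cell_def)
    show "k \<le> M" by (rule k)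
    have "even k = even (1 + \<sigma>)" using j \<sigma>(1) unfolding k_def by (cases "\<sigma> = 0") (auto elim: oddE)
    then show "even k = ((i \<noteq> Neumann) = even p)" by (simp only: \<sigma>(2))
  qed
  have closed: "(\<forall>x\<in>{\<tau> ! (j - 1)..<\<tau> ! j}. s x = poly q x) \<longleftrightarrow> (\<forall>x\<in>{\<tau> ! (j - 1)..\<tau> ! j}. s x = poly q x)"
    if j: "j \<in> {1..m}" for j and q :: "real poly"
  proof -
    have "continuous_on {\<tau> ! (j - 1)..\<tau> ! j} s"
      by (rule continuous_on_subset[OF cont]) (use piece(4,5)[OF j] in auto)
    then show ?thesis using poly_on_half_open[OF _ piece(3)[OF j], of s q] by auto
  qed
  have "?L \<longleftrightarrow> (\<forall>j\<in>{1..m}. \<exists>q::real poly. degree q \<le> p \<and> (\<forall>x\<in>{\<tau> ! (j - 1)..\<tau> ! j}. s x = poly q x))"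
  proof -
    have "{1..m} = insert m {1..<m}" using m1 by auto
    then show ?thesis using closed by (simp add: conj_commute)
  qed
  also have "\<dots> \<longleftrightarrow> ?R"
  proof
    assume L: "\<forall>j\<in>{1..m}. \<exists>q::real poly. degree q \<le> p \<and> (\<forall>x\<in>{\<tau> ! (j - 1)..\<tau> ! j}. s x = poly q x)"
    show ?R
    proof (intro allI impI)
      fix k assume k: "k \<le> M" "even k = ((i \<noteq> Neumann) = even p)"
      define j where "j = (k + 1 + \<sigma>) div 2"
      have ev: "even (k + 1 + \<sigma>)" using k(2) \<sigma>(2) by auto
      then have k_eq: "k = 2 * j - 1 - \<sigma>" unfolding j_def by auto
      have "k \<noteq> 0 \<or> \<sigma> = 1" using ev \<sigma>(1) by (cases "\<sigma> = 0") (auto elim: oddE)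
      then have j: "j \<in> {1..m}" unfolding j_def m using k(1) \<sigma>(1) by (auto intro!: div_le_mono)
      show "\<exists>q::real poly. degree q \<le> p \<and> (\<forall>x\<in>cell M k. s x = poly q x)"
        using L[rule_format, OF j] unfolding piece(1)[OF j] k_eq .
    qed
  next
    assume R: ?R
    show "\<forall>j\<in>{1..m}. \<exists>q::real poly. degree q \<le> p \<and> (\<forall>x\<in>{\<tau> ! (j - 1)..\<tau> ! j}. s x = poly q x)"
    proof
      fix j assume j: "j \<in> {1..m}"
      show "\<exists>q::real poly. degree q \<le> p \<and> (\<forall>x\<in>{\<tau> ! (j - 1)..\<tau> ! j}. s x = poly q x)"
        using R piece(2,6)[OF j] unfolding piece(1)[OF j] by blast
    qed
  qed
  finally show ?thesis .
qed

lemma spline_bc_iff: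
  "spline_bc p i s \<longleftrightarrow>
     (\<forall>\<alpha>\<le>p. even \<alpha> = (i \<noteq> Neumann) \<longrightarrow> (D01 ^^ \<alpha>) s 0 = 0) \<and>
     (\<forall>\<alpha>\<le>p. even \<alpha> = ((i \<noteq> Neumann) = even (grid_size i n)) \<longrightarrow> (D01 ^^ \<alpha>) s 1 = 0)"
  by (cases i) auto

theorem opt_spline_space_iff:
  assumes n: "n \<ge> 1" and p: "p \<ge> 1"
  shows "s \<in> opt_spline_space p n i \<longleftrightarrow> s \<in> opt_space (grid_size i n) p (i \<noteq> Neumann)"
proof -
  have "s \<in> opt_spline_space p n i \<longleftrightarrow> cellwise_spline (grid_size i n) p (i \<noteq> Neumann) s"
  proof (cases "s \<in> Ck01 (p - 1)")
    case True
    show ?thesis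
      unfolding opt_spline_space_def spline_space_def cellwise_spline_def mem_Collect_eq Let_def
        spline_pieces_iff_cells[OF n Ck01_continuous[OF True] refl refl refl] spline_bc_iff[of p i s n]
      by (simp only: conj_assoc)
  next
    case False
    then show ?thesis by (simp add: opt_spline_space_def spline_space_def cellwise_spline_def)
  qed
  also have "\<dots> \<longleftrightarrow> s \<in> opt_space (grid_size i n) p (i \<noteq> Neumann)"
    using cellwise_spline_iff_opt_space[OF grid_size_pos[OF n], of i "p - 1"] p by simp
  finally show ?thesis .
qed

section \<open>The exact eigenpairs\<close>

text \<open>Sine, cosine and all their derivatives in one family: differentiation is a quarter turn,
  from \<open>r\<close> to \<open>Suc r\<close>, with a factor \<open>w\<close>.\<close>

definition trig :: "nat \<Rightarrow> real \<Rightarrow> real \<Rightarrow> real" where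
  "trig r w x = sin (w * x + real r * (pi / 2))"

lemma trig_0: "trig 0 w x = sin (w * x)" and trig_1: "trig (Suc 0) w x = cos (w * x)"
  by (simp_all add: trig_def sin_add)

lemma trig_Suc_Suc: "trig (Suc (Suc r)) w x = - trig r w x"
proof -
  have "w * x + real (Suc (Suc r)) * (pi / 2) = (w * x + real r * (pi / 2)) + pi"
    by (simp add: algebra_simps)
  then show ?thesis by (simp only: trig_def sin_periodic_pi)
qed

lemma trig_has_vector_derivative:
  "(trig r w has_vector_derivative w * trig (Suc r) w x) (at x within S)"
proof -
  have "trig (Suc r) w x = cos (w * x + real r * (pi / 2))"
  proof -
    have "w * x + real (Suc r) * (pi / 2) = (w * x + real r * (pi / 2)) + pi / 2"
      by (simp add: algebra_simps add_divide_distrib)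
    moreover have "sin (z + pi / 2) = cos z" for z :: real by (simp add: sin_add)
    ultimately show ?thesis by (simp only: trig_def)
  qed
  moreover have "(trig r w has_real_derivative cos (w * x + real r * (pi / 2)) * w) (at x within S)"
    unfolding trig_def by (auto intro!: derivative_eq_intros)
  ultimately show ?thesis
    by (simp add: has_real_derivative_iff_has_vector_derivative mult.commute)
qed

lemma continuous_on_trig: "continuous_on S (trig r w)"
  unfolding trig_def by (intro continuous_intros)

lemma is_prim_trig: "is_prim (\<lambda>x. c * trig r w x) (\<lambda>x. c * (w * trig (Suc r) w x))"
  by (intro is_prim_cmult is_primI[of _ _ "{}"] pc_continuous continuous_intros continuous_on_trig
      trig_has_vector_derivative) simp

lemma sin_nat_pi_half: "even k \<Longrightarrow> sin (real k * (pi / 2)) = 0"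
  using sin_zero_iff[of "real k * (pi / 2)"] by blast

text \<open>At 1 the argument of the sine is \<open>(K + r) * (pi / 2)\<close>, so only parities
  matter, and \<open>K\<close> may be the size of another mesh.\<close>

lemma end_zeros_trig:
  assumes "even K = even M"
  shows "end_zeros M (even r) (\<lambda>x. c * trig r (real K * (pi / 2)) x)"
proof -
  have "trig r (real K * (pi / 2)) 0 = 0" if "even r"
    using sin_nat_pi_half[OF that] by (simp add: trig_def)
  moreover have "trig r (real K * (pi / 2)) 1 = 0" if "even r = even M"
  proof -
    have "trig r (real K * (pi / 2)) 1 = sin (real (K + r) * (pi / 2))"
      by (simp add: trig_def distrib_right add_divide_distrib)
    also have "\<dots> = 0" using that assms by (intro sin_nat_pi_half) auto
    finally show ?thesis .
  qed
  ultimately show ?thesis by (simp add: end_zeros_def)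
qed

definition phase :: "bc_type \<Rightarrow> nat" where
  "phase i = (if i = Neumann then 1 else 0)"

text \<open>Ties the \<open>l\<close>-th frequency to the mesh with \<open>l - 1\<close> in place of
  \<open>n\<close>: \<open>l = n + 1\<close> belongs to the mesh at hand, smaller \<open>l\<close>
  to the coarser meshes of the lower bound.\<close>

definition freq :: "bc_type \<Rightarrow> nat \<Rightarrow> real" where
  "freq i l = real (grid_size i (l - 1)) * (pi / 2)"

lemma D01_trig: "x \<in> {0..1} \<Longrightarrow> D01 (\<lambda>x. c * trig r w x) x = c * w * trig (Suc r) w x"
  using has_vector_derivative_mult_right[OF trig_has_vector_derivative, of c r w x "{0..1}"]
  by (intro D01_eq) (simp_all add: mult.assoc)

lemma Ck01_trig: "(\<lambda>x. c * trig r w x) \<in> Ck01 k"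
proof (induction k arbitrary: c r)
  case 0
  show ?case by (auto simp: Ck01_def intro!: continuous_intros continuous_on_trig)
next
  case (Suc k)
  have "D01 (\<lambda>x. c * trig r w x) \<in> Ck01 k"
    using Ck01_cong[of "D01 (\<lambda>x. c * trig r w x)" "\<lambda>x. c * w * trig (Suc r) w x", OF D01_trig]
      Suc[of "c * w" "Suc r"] by simp
  moreover have "(\<lambda>x. c * trig r w x) differentiable_on {0..1}"
    unfolding differentiable_on_def
    using has_vector_derivative_mult_right[OF trig_has_vector_derivative] differentiableI_vector by blast
  ultimately show ?case by (simp add: Ck01_Suc_iff)
qed

lemma freq_nonneg: "freq i l \<ge> 0"
  by (simp add: freq_def)

lemma exact_eigenpair_trig:
  assumes l: "l \<ge> 1"
  shows "exact_eigenpair i (\<lambda>x. 1 * trig (phase i) (freq i l) x) (freq i l)"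
proof -
  let ?w = "freq i l" and ?u = "\<lambda>x. 1 * trig (phase i) (freq i l) x"
  have D1: "D01 ?u x = ?w * trig (Suc (phase i)) ?w x" if "x \<in> {0..1}" for x
    using D01_trig[OF that, of 1] by simp
  have D2: "(D01 ^^ 2) ?u x = - ?w\<^sup>2 * ?u x" if x: "x \<in> {0..1}" for x
  proof -
    have "(D01 ^^ 2) ?u x = D01 (D01 ?u) x" by (simp add: numeral_2_eq_2)
    also have "\<dots> = D01 (\<lambda>x. ?w * trig (Suc (phase i)) ?w x) x" by (rule D01_cong[OF D1 x])
    also have "\<dots> = ?w * ?w * trig (Suc (Suc (phase i))) ?w x" by (rule D01_trig[OF x])
    finally show ?thesis by (simp add: trig_Suc_Suc power2_eq_square)
  qed
  have ends: "end_zeros (grid_size i (l - 1)) (even r) (\<lambda>x. 1 * trig r ?w x)" for r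
    unfolding freq_def by (intro end_zeros_trig refl)
  have bc: "satisfies_bc i ?u"
    using ends[of "phase i"] ends[of "Suc (phase i)"] D1
    by (cases i) (auto simp: end_zeros_def phase_def)
  have nz: "\<exists>x\<in>{0..1}. ?u x \<noteq> 0"
  proof (cases "i = Neumann")
    case True
    then show ?thesis by (intro bexI[of _ 0]) (auto simp: phase_def trig_1)
  next
    case False
    then have "grid_size i (l - 1) \<ge> 1" by (cases i) auto
    then have w: "?w \<ge> pi / 2" by (simp add: freq_def)
    then have w0: "?w > 0" using pi_half_gt_zero by linarith
    then have "pi / (2 * ?w) \<in> {0..1}" using w by (simp add: divide_le_eq)
    moreover have "?u (pi / (2 * ?w)) = 1"
      using False w0 by (simp add: phase_def trig_0)
    ultimately show ?thesis by force
  qed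
  show ?thesis
    unfolding exact_eigenpair_def using bc nz D2 Ck01_trig[of 1 "phase i" ?w 2] freq_nonneg by auto
qed

text \<open>Rotating the vector \<open>(d, w u)\<close> by the angle \<open>w x\<close> gives two
  first integrals of the equation. Solving them for \<open>w u\<close> and \<open>d\<close> yields
  combinations of sine and cosine, and the boundary conditions select the frequency. For
  \<open>w = 0\<close> only \<open>d\<close> is determined, and \<open>u\<close> is affine.\<close>

lemma exact_eigenpair_explicit:
  assumes "exact_eigenpair i u w"
  shows "\<exists>l\<ge>1. w = freq i l \<and> (\<exists>c. \<forall>x\<in>{0..1}. u x = c * trig (phase i) w x)"
proof -
  define d where "d = D01 u"
  have w: "w \<ge> 0" and uC: "u \<in> Ck01 (Suc (Suc 0))" and nz: "\<exists>x\<in>{0..1}. u x \<noteq> 0"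
    and bc: "satisfies_bc i u" and "\<forall>x\<in>{0<..<1}. - D01 d x = w\<^sup>2 * u x"
    using assms by (auto simp: exact_eigenpair_def numeral_2_eq_2 d_def)
  then have ode: "D01 d x = - w\<^sup>2 * u x" if "0 < x" "x < 1" for x
    using that by (metis greaterThanLessThan_iff minus_minus mult_minus_left)
  have diff: "u differentiable_on {0..1}" "d differentiable_on {0..1}"
    using uC by (auto simp: Ck01_Suc_iff d_def)
  have cont: "continuous_on {0..1} u" "continuous_on {0..1} d"
    using diff by (auto intro: differentiable_imp_continuous_on)
  have der: "(u has_real_derivative d x) (at x)" "(d has_real_derivative - w\<^sup>2 * u x) (at x)"
    if x: "0 < x" "x < 1" for x
  proof -
    have *: "at x within {0..1} = at x" using x by (intro at_within_interior) auto
    show "(u has_real_derivative d x) (at x)" "(d has_real_derivative - w\<^sup>2 * u x) (at x)"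
      using differentiable_on_D01[OF diff(1), of x] differentiable_on_D01[OF diff(2), of x] x ode[OF x]
      by (auto simp: * d_def has_real_derivative_iff_has_vector_derivative)
  qed
  have "d x * cos (w * x) + w * u x * sin (w * x) = d 0 * cos (w * 0) + w * u 0 * sin (w * 0)"
    if "x \<in> {0..1}" for x
  proof (rule DERIV_isconst2[of 0 1])
    show "continuous_on {0..1} (\<lambda>x. d x * cos (w * x) + w * u x * sin (w * x))"
      by (intro continuous_intros cont)
    show "((\<lambda>x. d x * cos (w * x) + w * u x * sin (w * x)) has_real_derivative 0) (at x)"
      if "0 < x" "x < 1" for x
      by (rule derivative_eq_intros der that refl)+ (simp add: power2_eq_square algebra_simps)
  qed (use that in auto)
  then have P: "d x * cos (w * x) + w * u x * sin (w * x) = d 0" if "x \<in> {0..1}" for x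
    using that by simp
  have "d x * sin (w * x) - w * u x * cos (w * x) = d 0 * sin (w * 0) - w * u 0 * cos (w * 0)"
    if "x \<in> {0..1}" for x
  proof (rule DERIV_isconst2[of 0 1])
    show "continuous_on {0..1} (\<lambda>x. d x * sin (w * x) - w * u x * cos (w * x))"
      by (intro continuous_intros cont)
    show "((\<lambda>x. d x * sin (w * x) - w * u x * cos (w * x)) has_real_derivative 0) (at x)"
      if "0 < x" "x < 1" for x
      by (rule derivative_eq_intros der that refl)+ (simp add: power2_eq_square algebra_simps)
  qed (use that in auto)
  then have Q: "d x * sin (w * x) - w * u x * cos (w * x) = - w * u 0" if "x \<in> {0..1}" for x
    using that by simp
  have wu: "w * u x = d 0 * sin (w * x) + w * u 0 * cos (w * x)"
    and dx: "d x = d 0 * cos (w * x) - w * u 0 * sin (w * x)" if x: "x \<in> {0..1}" for x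
  proof -
    have "w * u x = w * u x * ((sin (w * x))\<^sup>2 + (cos (w * x))\<^sup>2)" by simp
    also have "\<dots> = (d x * cos (w * x) + w * u x * sin (w * x)) * sin (w * x)
        - (d x * sin (w * x) - w * u x * cos (w * x)) * cos (w * x)"
      by (simp only: power2_eq_square ring_distribs mult.assoc mult.commute mult.left_commute)
    finally show "w * u x = d 0 * sin (w * x) + w * u 0 * cos (w * x)"
      unfolding P[OF x] Q[OF x] by simp
    have "d x = d x * ((sin (w * x))\<^sup>2 + (cos (w * x))\<^sup>2)" by simp
    also have "\<dots> = (d x * cos (w * x) + w * u x * sin (w * x)) * cos (w * x)
        + (d x * sin (w * x) - w * u x * cos (w * x)) * sin (w * x)"
      by (simp only: power2_eq_square ring_distribs mult.assoc mult.commute mult.left_commute)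
    finally show "d x = d 0 * cos (w * x) - w * u 0 * sin (w * x)"
      unfolding P[OF x] Q[OF x] by simp
  qed
  show ?thesis
  proof (cases "w = 0")
    case True
    have lin0: "u x - d 0 * x = u 0 - d 0 * 0" if "x \<in> {0..1}" for x
    proof (rule DERIV_isconst2[of 0 1])
      show "continuous_on {0..1} (\<lambda>x. u x - d 0 * x)" by (intro continuous_intros cont)
      show "((\<lambda>x. u x - d 0 * x) has_real_derivative 0) (at x)" if "0 < x" "x < 1" for x
        using dx[of x] True that by (auto intro!: derivative_eq_intros der)
    qed (use that in auto)
    have lin: "u x = u 0 + d 0 * x" if "x \<in> {0..1}" for x using lin0[OF that] by linarith
    have i: "i = Neumann"
    proof (rule ccontr)
      assume "i \<noteq> Neumann"
      then have "u 0 = 0 \<and> d 0 = 0"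
        using bc lin[of 1] dx[of 1] True by (cases i) (auto simp: d_def)
      then have "u x = 0" if "x \<in> {0..1}" for x using lin[OF that] by simp
      then show False using nz by blast
    qed
    then have "d 0 = 0" using bc by (simp add: d_def)
    then have "u x = u 0" if "x \<in> {0..1}" for x using lin[OF that] by simp
    moreover have "trig (phase i) w x = 1" for x using True i by (simp add: phase_def trig_1)
    ultimately have "\<forall>x\<in>{0..1}. u x = u 0 * trig (phase i) w x" by (simp only: mult_1_right) blast
    moreover have "w = freq i 1" using True i by (simp add: freq_def)
    ultimately show ?thesis by blast
  next
    case False
    then have w0: "w > 0" using w by simp
    define A B where "A = d 0 / w" and "B = u 0"
    have ux: "u x = A * sin (w * x) + B * cos (w * x)" if "x \<in> {0..1}" for x
      using wu[OF that] w0 by (simp add: A_def B_def field_simps)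
    have sinz: "\<exists>k. even k \<and> k > 0 \<and> w = real k * (pi / 2)" if s0: "sin w = 0"
    proof -
      have "w \<noteq> - (real k * (pi / 2))" for k
        using w0 mult_nonneg_nonneg[of "real k" "pi / 2"] pi_half_gt_zero by linarith
      then obtain k where "even k" "w = real k * (pi / 2)"
        using s0 sin_zero_iff[of w] by blast
      then show ?thesis using w0 by (intro exI[of _ k]) (auto intro: Nat.gr0I)
    qed
    have cosz: "\<exists>k. odd k \<and> w = real k * (pi / 2)" if c0: "cos w = 0"
    proof -
      have "w \<noteq> - (real k * (pi / 2))" for k
        using w0 mult_nonneg_nonneg[of "real k" "pi / 2"] pi_half_gt_zero by linarith
      then show ?thesis using c0 cos_zero_iff[of w] by blast
    qed
    show ?thesis
    proof (cases i)
      case Dirichlet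
      then have B: "B = 0" using bc by (simp add: B_def)
      then have u: "\<forall>x\<in>{0..1}. u x = A * trig (phase i) w x"
        using ux Dirichlet by (simp add: phase_def trig_0)
      then have "A \<noteq> 0" using nz by auto
      moreover have "u 1 = 0" using bc Dirichlet by simp
      ultimately have "sin w = 0" using u Dirichlet by (auto simp: phase_def trig_0)
      then obtain k where "even k" "k > 0" "w = real k * (pi / 2)" using sinz by blast
      then have "w = freq i (k div 2)" "k div 2 \<ge> 1"
        using Dirichlet by (auto simp: freq_def elim!: evenE)
      then show ?thesis using u by blast
    next
      case Neumann
      then have d0: "d 0 = 0" using bc by (simp add: d_def)
      then have u: "\<forall>x\<in>{0..1}. u x = B * trig (phase i) w x"
        using ux Neumann by (simp add: phase_def trig_1 A_def)
      then have "B \<noteq> 0" using nz by auto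
      moreover have "d 1 = 0" using bc Neumann by (simp add: d_def)
      ultimately have "sin w = 0" using dx[of 1] d0 w0 by (simp add: B_def)
      then obtain k where "even k" "k > 0" "w = real k * (pi / 2)" using sinz by blast
      then have "w = freq i (k div 2 + 1)" "k div 2 + 1 \<ge> 1"
        using Neumann by (auto simp: freq_def elim!: evenE)
      then show ?thesis using u by blast
    next
      case Mixed
      then have B: "B = 0" using bc by (simp add: B_def)
      then have u: "\<forall>x\<in>{0..1}. u x = A * trig (phase i) w x"
        using ux Mixed by (simp add: phase_def trig_0)
      then have "A \<noteq> 0" using nz by auto
      moreover have "d 1 = 0" using bc Mixed by (simp add: d_def)
      ultimately have "cos w = 0" using dx[of 1] B by (simp add: A_def B_def)
      then obtain k where "odd k" "w = real k * (pi / 2)" using cosz by blast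
      then have "w = freq i (k div 2 + 1)" "k div 2 + 1 \<ge> 1"
        using Mixed by (auto simp: freq_def elim!: oddE)
      then show ?thesis using u by blast
    qed
  qed
qed

lemma freq_strict_mono: "1 \<le> k \<Longrightarrow> k < l \<Longrightarrow> freq i k < freq i l"
  unfolding freq_def by (cases i) auto

text \<open>Strict growth gives \<open>l \<le> \<kappa> l\<close>, so the preimage of
  \<open>l\<close> is at most \<open>l\<close>; a smaller preimage would already be a fixed
  point.\<close>

lemma strict_mono_bijection_id:
  fixes \<kappa> :: "nat \<Rightarrow> nat"
  assumes ge: "\<And>l. l \<ge> 1 \<Longrightarrow> \<kappa> l \<ge> 1" and mono: "\<And>k l. 1 \<le> k \<Longrightarrow> k < l \<Longrightarrow> \<kappa> k < \<kappa> l"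
    and surj: "\<And>l. l \<ge> 1 \<Longrightarrow> \<exists>k\<ge>1. \<kappa> k = l" and l: "l \<ge> 1"
  shows "\<kappa> l = l"
  using l
proof (induction l rule: less_induct)
  case (less l)
  have le: "l \<le> \<kappa> l" if "l \<ge> 1" for l using that
  proof (induction l rule: dec_induct)
    case (step m)
    then show ?case using mono[of m "Suc m"] by simp
  qed (use ge in simp)
  obtain k where k: "k \<ge> 1" "\<kappa> k = l" using surj[OF less.prems] by blast
  then have "k \<le> l" using le[of k] by simp
  then show ?case using less.IH[of k] k by (cases "k = l") auto
qed

text \<open>Both \<open>\<omega>\<close> and \<open>freq i\<close> enumerate the same set of
  frequencies in strictly increasing order, so they coincide.\<close>

theorem exact_eigenpairs_explicit:
  assumes ex: "exact_eigenpairs i u \<omega>" and l: "l \<ge> 1"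
  shows "\<omega> l = freq i l" and "\<exists>c. \<forall>x\<in>{0..1}. u l x = c * trig (phase i) (\<omega> l) x"
proof -
  have pair: "exact_eigenpair i (u k) (\<omega> k)" if "k \<ge> 1" for k
    using ex that by (simp add: exact_eigenpairs_def)
  have freq_inj: "k = k'" if "1 \<le> k" "1 \<le> k'" "freq i k = freq i k'" for k k'
    using freq_strict_mono[of k k' i] freq_strict_mono[of k' k i] that by (metis less_irrefl linorder_neqE_nat)
  have "\<forall>k. \<exists>m. k \<ge> 1 \<longrightarrow> m \<ge> 1 \<and> \<omega> k = freq i m" using exact_eigenpair_explicit[OF pair] by blast
  then obtain \<kappa> where \<kappa>: "\<And>k. k \<ge> 1 \<Longrightarrow> \<kappa> k \<ge> 1 \<and> \<omega> k = freq i (\<kappa> k)" by metis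
  have "\<kappa> l = l"
  proof (rule strict_mono_bijection_id[OF _ _ _ l])
    fix k assume k: "k \<ge> (1::nat)"
    show "\<kappa> k \<ge> 1" using \<kappa>[OF k] by simp
    obtain m where m: "m \<ge> 1" "freq i k = \<omega> m"
      using ex exact_eigenpair_trig[OF k, of i] unfolding exact_eigenpairs_def by blast
    then have "\<kappa> m = k" using freq_inj[of k "\<kappa> m"] \<kappa>[OF m(1)] k by simp
    then show "\<exists>m\<ge>1. \<kappa> m = k" using m by blast
  next
    fix k m :: nat assume km: "1 \<le> k" "k < m"
    then have "\<omega> k < \<omega> m" using ex by (auto simp: exact_eigenpairs_def strict_mono_on_def)
    show "\<kappa> k < \<kappa> m"
    proof (rule ccontr)
      assume "\<not> \<kappa> k < \<kappa> m"
      then have "freq i (\<kappa> m) \<le> freq i (\<kappa> k)"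
        using freq_strict_mono[of "\<kappa> m" "\<kappa> k" i] \<kappa>[of m] km by (cases "\<kappa> k = \<kappa> m") auto
      then show False using \<open>\<omega> k < \<omega> m\<close> \<kappa>[of k] \<kappa>[of m] km by simp
    qed
  qed
  then show "\<omega> l = freq i l" using \<kappa>[OF l] by simp
  show "\<exists>c. \<forall>x\<in>{0..1}. u l x = c * trig (phase i) (\<omega> l) x"
    using exact_eigenpair_explicit[OF pair[OF l]] by blast
qed

section \<open>The discrete eigenvalue problem\<close>

text \<open>Takes the place of dimension counts in both eigenvalue bounds. One condition at a time
  is eliminated by solving it for a pivot unknown \<open>k0\<close>.\<close>

lemma underdetermined_system:
  fixes \<phi> :: "'a \<Rightarrow> 'b \<Rightarrow> real"
  assumes "finite A" "finite B" "card A < card B"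
  shows "\<exists>c. (\<exists>k\<in>B. c k \<noteq> 0) \<and> (\<forall>j\<in>A. (\<Sum>k\<in>B. c k * \<phi> j k) = 0)"
  using assms
proof (induction A arbitrary: B \<phi> rule: finite_induct)
  case empty
  then have "B \<noteq> {}" by auto
  then show ?case by (intro exI[of _ "\<lambda>_. 1"]) auto
next
  case (insert j A)
  show ?case
  proof (cases "\<forall>k\<in>B. \<phi> j k = 0")
    case True
    obtain c where "\<exists>k\<in>B. c k \<noteq> 0" "\<forall>j\<in>A. (\<Sum>k\<in>B. c k * \<phi> j k) = 0"
      using insert.IH[of B \<phi>] insert.prems insert.hyps by auto
    then show ?thesis using True by (intro exI[of _ c]) auto
  next
    case False
    then obtain k0 where k0: "k0 \<in> B" "\<phi> j k0 \<noteq> 0" by blast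
    define B' where "B' = B - {k0}"
    \<comment> \<open>The conditions left for the other unknowns once the coefficient of
      \<open>k0\<close> has been expressed through them.\<close>
    define \<psi> where "\<psi> i k = \<phi> i k - \<phi> i k0 * (\<phi> j k / \<phi> j k0)" for i k
    have B': "finite B'" "B = insert k0 B'" "k0 \<notin> B'" using insert.prems k0 by (auto simp: B'_def)
    then have "card A < card B'" using insert by simp
    then obtain c where c: "\<exists>k\<in>B'. c k \<noteq> 0" "\<forall>i\<in>A. (\<Sum>k\<in>B'. c k * \<psi> i k) = 0"
      using insert.IH[of B' \<psi>] B' by blast
    define s where "s = (\<Sum>k\<in>B'. c k * \<phi> j k)"
    define c' where "c' k = (if k = k0 then - s / \<phi> j k0 else c k)" for k
    have split: "(\<Sum>k\<in>B. c' k * \<phi> i k) = - s / \<phi> j k0 * \<phi> i k0 + (\<Sum>k\<in>B'. c k * \<phi> i k)" for i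
    proof -
      have "(\<Sum>k\<in>B'. c' k * \<phi> i k) = (\<Sum>k\<in>B'. c k * \<phi> i k)"
        using B'(3) by (intro sum.cong) (auto simp: c'_def)
      then show ?thesis unfolding B'(2) using B'(1,3) by (simp add: c'_def)
    qed
    have "(\<Sum>k\<in>B. c' k * \<phi> i k) = 0" if "i \<in> A" for i
    proof -
      have "0 = (\<Sum>k\<in>B'. c k * \<phi> i k - \<phi> i k0 / \<phi> j k0 * (c k * \<phi> j k))"
        using c(2) that by (simp add: \<psi>_def algebra_simps)
      also have "\<dots> = (\<Sum>k\<in>B'. c k * \<phi> i k) - \<phi> i k0 / \<phi> j k0 * s"
        by (simp only: sum_subtractf sum_distrib_left s_def)
      finally show ?thesis unfolding split by simp
    qed
    moreover have "(\<Sum>k\<in>B. c' k * \<phi> j k) = 0"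
      unfolding split using k0(2) by (simp add: s_def)
    moreover have "\<exists>k\<in>B. c' k \<noteq> 0" using c(1) B' by (auto simp: c'_def)
    ultimately show ?thesis by blast
  qed
qed

lemma L2_inner_orthogonal_sums:
  assumes S: "finite S" and pcb: "\<And>k. k \<in> S \<Longrightarrow> pc (b k)"
    and orth: "\<And>j k. j \<in> S \<Longrightarrow> k \<in> S \<Longrightarrow> j \<noteq> k \<Longrightarrow> L2_inner (b j) (b k) = 0"
  shows "L2_inner (\<lambda>x. \<Sum>k\<in>S. c k * b k x) (\<lambda>x. \<Sum>k\<in>S. c k * b k x) = (\<Sum>k\<in>S. (c k)\<^sup>2 * L2_inner (b k) (b k))"
proof -
  have "L2_inner (\<lambda>x. \<Sum>k\<in>S. c k * b k x) (\<lambda>x. \<Sum>k\<in>S. c k * b k x)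
      = (\<Sum>j\<in>S. \<Sum>k\<in>S. c j * (c k * L2_inner (b j) (b k)))"
    by (simp add: L2_inner_sum_left L2_inner_sum_right pc_sum pc_cmult pcb
        L2_inner_cmult_left L2_inner_cmult_right sum_distrib_left)
  also have "\<dots> = (\<Sum>j\<in>S. \<Sum>k\<in>S. if k = j then (c j)\<^sup>2 * L2_inner (b j) (b j) else 0)"
    by (intro sum.cong refl) (auto simp: orth power2_eq_square)
  also have "\<dots> = (\<Sum>k\<in>S. (c k)\<^sup>2 * L2_inner (b k) (b k))" using S by (simp add: sum.delta)
  finally show ?thesis .
qed

lemma L2_inner_pos:
  assumes "continuous_on {0..1} f" "x \<in> {0..1}" "f x \<noteq> 0"
  shows "L2_inner f f > 0"
proof (rule ccontr)
  assume "\<not> L2_inner f f > 0"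
  then have "integral {0..1} (\<lambda>x. f x * f x) = 0"
    using L2_inner_nonneg[of f] by (simp add: L2_inner_def)
  moreover have "continuous_on (cbox 0 1) (\<lambda>x. f x * f x)" using assms(1) by (auto intro!: continuous_intros)
  ultimately have "\<forall>x\<in>cbox 0 1. f x * f x = 0"
    using integral_eq_0_iff[of 0 1 "\<lambda>x. f x * f x"] by auto
  then show False using assms by simp
qed

lemma is_prim_unique:
  assumes "is_prim s t" "is_prim s t'"
  shows "L2_inner t g = L2_inner t' g"
proof -
  obtain F where F: "finite F"
    "\<And>x. x \<in> {0..1} - F \<Longrightarrow> (s has_vector_derivative t x) (at x within {0..1})"
    using is_prim_has_derivative[OF assms(1)] by blast
  obtain F' where F': "finite F'"
    "\<And>x. x \<in> {0..1} - F' \<Longrightarrow> (s has_vector_derivative t' x) (at x within {0..1})"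
    using is_prim_has_derivative[OF assms(2)] by blast
  show ?thesis
    by (rule L2_inner_spike[of "F \<union> F'"]) (use F F' D01_eq[of _ s] in auto, metis+)
qed

text \<open>Serves the zero frequency: a function without energy is constant in norm, by the
  Poincare inequality on the whole interval.\<close>

lemma L2_norm_zero_deriv:
  assumes "is_prim v g" "L2_norm g = 0"
  shows "L2_norm (\<lambda>x. v x - v 0) = 0"
proof -
  have "integral {0..1} (\<lambda>x. (v x - v 0)\<^sup>2) \<le> (2 * (1 - 0) / pi)\<^sup>2 * integral {0..1} (\<lambda>x. (g x)\<^sup>2)"
    by (rule poincare_endpoint[OF assms(1)]) auto
  also have "integral {0..1} (\<lambda>x. (g x)\<^sup>2) = 0"
    using assms(2) by (simp add: L2_norm_def L2_inner_def power2_eq_square)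
  finally have "(L2_norm (\<lambda>x. v x - v 0))\<^sup>2 \<le> 0"
    unfolding L2_norm_sq L2_inner_def by (simp add: power2_eq_square)
  then show ?thesis by simp
qed

text \<open>Isolates what the estimates use, so that splines, trigonometric functions and the three
  types drop out. \<open>t j\<close> is the derivative of \<open>uh j\<close>, and
  \<open>f l m\<close> the \<open>m\<close>-th derivative of the \<open>l\<close>-th exact
  eigenfunction with frequency \<open>w l\<close>. \<open>w_coarse\<close> provides the mesh that
  belongs to \<open>w l\<close>, with few enough step functions.\<close>

locale galerkin =
  fixes M q n :: nat and a :: bool and uh t :: "nat \<Rightarrow> real \<Rightarrow> real" and wh w :: "nat \<Rightarrow> real"
    and f :: "nat \<Rightarrow> nat \<Rightarrow> real \<Rightarrow> real"
  assumes M: "M > 0"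
    and t: "\<And>j. j \<in> {1..n} \<Longrightarrow> t j \<in> opt_space M q (\<not> a)"
    and uh_prim: "\<And>j. j \<in> {1..n} \<Longrightarrow> is_prim (uh j) (t j)"
    and uh_ends: "\<And>j. j \<in> {1..n} \<Longrightarrow> end_zeros M a (uh j)"
    and weak: "\<And>j v g. j \<in> {1..n} \<Longrightarrow> v \<in> opt_space M (Suc q) a \<Longrightarrow> is_prim v g \<Longrightarrow>
        L2_inner (t j) g = (wh j)\<^sup>2 * L2_inner (uh j) v"
    and orth: "\<And>j k. j \<in> {1..n} \<Longrightarrow> k \<in> {1..n} \<Longrightarrow> j \<noteq> k \<Longrightarrow> L2_inner (uh j) (uh k) = 0"
    and uh_pos: "\<And>j. j \<in> {1..n} \<Longrightarrow> L2_inner (uh j) (uh j) > 0"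
    and span: "\<And>s. s \<in> opt_space M (Suc q) a \<Longrightarrow> \<exists>c. \<forall>x\<in>{0..1}. s x = (\<Sum>l=1..n. c l * uh l x)"
    and wh_nonneg: "\<And>j. j \<in> {1..n} \<Longrightarrow> wh j \<ge> 0" and wh_mono: "mono_on {1..n} wh"
    and f_prim: "\<And>l m. is_prim (f l m) (f l (Suc m))"
    and f_ends: "\<And>l m. l \<ge> 1 \<Longrightarrow> end_zeros M (a = even m) (f l m)"
    and f_ode: "\<And>l m x. f l (Suc (Suc m)) x = - (w l)\<^sup>2 * f l m x"
    and f_pos: "\<And>l. l \<ge> 1 \<Longrightarrow> L2_inner (f l 0) (f l 0) > 0"
    and w_nonneg: "\<And>l. w l \<ge> 0" and w_mono: "\<And>k l. 1 \<le> k \<Longrightarrow> k < l \<Longrightarrow> w k < w l"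
    and w_Suc_n: "approx_const M * w (n + 1) = 1"
    and w_coarse: "\<And>l. l \<in> {1..n} \<Longrightarrow> w l > 0 \<Longrightarrow>
        \<exists>K>0. even K = even M \<and> approx_const K * w l = 1 \<and> card (inner_nodes K a) < l"
begin

lemma pcs: "j \<in> {1..n} \<Longrightarrow> pc (t j)" "j \<in> {1..n} \<Longrightarrow> pc (uh j)" "pc (f l m)"
  using t opt_space_pc is_prim_pc[OF uh_prim] is_prim_pc[OF f_prim] by blast+

lemma uh_mem: "j \<in> {1..n} \<Longrightarrow> uh j \<in> opt_space M (Suc q) a"
  using t uh_prim uh_ends by auto

lemma t_inner: "j \<in> {1..n} \<Longrightarrow> k \<in> {1..n} \<Longrightarrow> L2_inner (t j) (t k) = (wh j)\<^sup>2 * L2_inner (uh j) (uh k)"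
  by (intro weak uh_mem uh_prim)

lemma wh_le: "j \<in> {1..n} \<Longrightarrow> k \<in> {1..n} \<Longrightarrow> j \<le> k \<Longrightarrow> wh j \<le> wh k"
  using wh_mono by (simp add: mono_on_def)

lemma w_le: "1 \<le> k \<Longrightarrow> k \<le> l \<Longrightarrow> w k \<le> w l"
  using w_mono[of k l] by (cases "k = l") auto

lemma end_zeros_sum:
  "(\<And>k. k \<in> S \<Longrightarrow> end_zeros M b (v k)) \<Longrightarrow> end_zeros M b (\<lambda>x. \<Sum>k\<in>S. c k * v k x)"
  by (auto simp: end_zeros_def intro!: sum.neutral)

text \<open>A combination \<open>v\<close> of the first \<open>l\<close> discrete eigenfunctions
  satisfies \<open>L2_norm g \<le> wh l * L2_norm v\<close>. Orthogonality to the coarse step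
  functions makes \<open>v\<close> no longer than any of its approximation errors, so the coarse
  estimate gives \<open>w l * L2_norm v \<le> L2_norm g\<close>.\<close>

theorem lower_bound:
  assumes l: "l \<in> {1..n}"
  shows "w l \<le> wh l"
proof (cases "w l = 0")
  case False
  then have "w l > 0" using w_nonneg[of l] by simp
  then obtain K where K: "K > 0" "even K = even M" "approx_const K * w l = 1" "card (inner_nodes K a) < l"
    using w_coarse[OF l] by blast
  have sub: "{1..l} \<subseteq> {1..n}" using l by auto
  obtain c where c: "\<exists>k\<in>{1..l}. c k \<noteq> 0"
    "\<forall>j\<in>inner_nodes K a. (\<Sum>k\<in>{1..l}. c k * L2_inner (uh k) (node_step K j)) = 0"
    using underdetermined_system[of "inner_nodes K a" "{1..l}" "\<lambda>j k. L2_inner (uh k) (node_step K j)"] K(4)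
    by auto
  define v where "v x = (\<Sum>k\<in>{1..l}. c k * uh k x)" for x
  define g where "g x = (\<Sum>k\<in>{1..l}. c k * t k x)" for x
  have vg: "is_prim v g" unfolding v_def g_def using sub by (intro is_prim_sum is_prim_cmult uh_prim) auto
  have pcv: "pc v" "pc g" using is_prim_pc[OF vg] is_prim_pc_deriv[OF vg] .
  have "end_zeros M a v" unfolding v_def using sub by (intro end_zeros_sum uh_ends) auto
  then have "end_zeros K a v" using K(2) by (simp add: end_zeros_def)
  then obtain s where s: "s \<in> opt_space K 0 a" "L2_norm (\<lambda>x. v x - s x) \<le> approx_const K * L2_norm g"
    using step_approximation[OF K(1) vg] by blast
  have pc_s: "pc s" using s(1) by (rule opt_space_pc)
  obtain d where d: "\<forall>x\<in>{0..1}. s x = (\<Sum>j\<in>inner_nodes K a. d j * node_step K j x)" using s(1) by auto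
  have "L2_inner v s = L2_inner v (\<lambda>x. \<Sum>j\<in>inner_nodes K a. d j * node_step K j x)"
    by (rule L2_inner_cong) (use d in auto)
  also have "\<dots> = (\<Sum>j\<in>inner_nodes K a. d j * L2_inner v (node_step K j))"
    by (simp add: L2_inner_sum_right pc_cmult pc_node_step pcv L2_inner_cmult_right)
  also have "\<dots> = 0"
  proof (intro sum.neutral ballI)
    fix j assume j: "j \<in> inner_nodes K a"
    have "L2_inner v (node_step K j) = (\<Sum>k\<in>{1..l}. c k * L2_inner (uh k) (node_step K j))"
      unfolding v_def using sub
      by (subst L2_inner_sum_left) (auto intro!: pc_cmult pcs pc_node_step simp: L2_inner_cmult_left)
    then show "d j * L2_inner v (node_step K j) = 0" using c(2) j by simp
  qed
  finally have "(L2_norm v)\<^sup>2 \<le> (L2_norm (\<lambda>x. v x - s x))\<^sup>2"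
    using L2_pythagoras[OF pcv(1) pc_s] by simp
  then have "L2_norm v \<le> L2_norm (\<lambda>x. v x - s x)" by (rule power2_le_imp_le) (rule L2_norm_nonneg)
  also note s(2)
  finally have "w l * L2_norm v \<le> w l * (approx_const K * L2_norm g)"
    using w_nonneg by (intro mult_left_mono) auto
  also have "\<dots> = L2_norm g"
  proof -
    have "w l * (approx_const K * L2_norm g) = (approx_const K * w l) * L2_norm g" by simp
    then show ?thesis unfolding K(3) by simp
  qed
  also have "\<dots> \<le> wh l * L2_norm v"
  proof (rule power2_le_imp_le)
    \<comment> \<open>The derivatives \<open>t k\<close> are orthogonal too, by the weak
      form.\<close>
    have "(L2_norm g)\<^sup>2 = (\<Sum>k\<in>{1..l}. (c k)\<^sup>2 * L2_inner (t k) (t k))"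
      unfolding L2_norm_sq g_def[abs_def]
      by (rule L2_inner_orthogonal_sums) (use sub pcs orth in \<open>auto simp: t_inner subset_iff\<close>)
    also have "\<dots> \<le> (\<Sum>k\<in>{1..l}. (wh l)\<^sup>2 * ((c k)\<^sup>2 * L2_inner (uh k) (uh k)))"
    proof (rule sum_mono)
      fix k assume k: "k \<in> {1..l}"
      then have kn: "k \<in> {1..n}" using sub by blast
      have "(wh k)\<^sup>2 \<le> (wh l)\<^sup>2" using wh_le[OF kn l] wh_nonneg[OF kn] k by (intro power_mono) auto
      then have "(wh k)\<^sup>2 * ((c k)\<^sup>2 * L2_inner (uh k) (uh k)) \<le> (wh l)\<^sup>2 * ((c k)\<^sup>2 * L2_inner (uh k) (uh k))"
        by (rule mult_right_mono) (simp add: L2_inner_nonneg)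
      then show "(c k)\<^sup>2 * L2_inner (t k) (t k) \<le> (wh l)\<^sup>2 * ((c k)\<^sup>2 * L2_inner (uh k) (uh k))"
        using kn by (simp add: t_inner mult.left_commute)
    qed
    also have "\<dots> = (wh l)\<^sup>2 * (L2_norm v)\<^sup>2"
      unfolding L2_norm_sq v_def[abs_def] sum_distrib_left[symmetric]
      by (subst L2_inner_orthogonal_sums) (use sub pcs orth in \<open>auto simp: subset_iff\<close>)
    finally show "(L2_norm g)\<^sup>2 \<le> (wh l * L2_norm v)\<^sup>2" by (simp add: power_mult_distrib)
  qed (use wh_nonneg[OF l] in \<open>simp add: L2_norm_nonneg\<close>)
  finally have "w l * L2_norm v \<le> wh l * L2_norm v" .
  moreover have "L2_norm v > 0"
  proof -
    obtain k where k: "k \<in> {1..l}" "c k \<noteq> 0" using c(1) by blast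
    have "(L2_norm v)\<^sup>2 = (\<Sum>k\<in>{1..l}. (c k)\<^sup>2 * L2_inner (uh k) (uh k))"
      unfolding L2_norm_sq v_def[abs_def]
      by (rule L2_inner_orthogonal_sums) (use sub pcs orth in \<open>auto simp: subset_iff\<close>)
    also have "\<dots> > 0"
      using k sub uh_pos by (intro sum_pos2[of _ k]) (auto simp: L2_inner_nonneg subset_iff)
    finally show ?thesis using L2_norm_nonneg[of v] by (simp add: zero_less_power2)
  qed
  ultimately show ?thesis by simp
qed (use wh_nonneg[OF l] in simp)

section \<open>Exact eigenfunctions and their derivatives\<close>

lemma f_inner_Suc:
  assumes "j \<ge> 1" "k \<ge> 1"
  shows "L2_inner (f j (Suc m)) (f k (Suc m)) = (w k)\<^sup>2 * L2_inner (f j m) (f k m)"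
proof -
  have "L2_inner (f j m) (f k (Suc (Suc m))) + L2_inner (f j (Suc m)) (f k (Suc m))
      = f j m 1 * f k (Suc m) 1 - f j m 0 * f k (Suc m) 0"
    by (rule L2_integration_by_parts[OF f_prim f_prim])
  \<comment> \<open>Consecutive derivatives satisfy complementary end conditions.\<close>
  also have "\<dots> = 0"
    using f_ends[OF assms(1), of m] f_ends[OF assms(2), of "Suc m"] by (auto simp: end_zeros_def)
  finally have "L2_inner (f j (Suc m)) (f k (Suc m)) = - L2_inner (f j m) (f k (Suc (Suc m)))" by simp
  also have "L2_inner (f j m) (f k (Suc (Suc m))) = L2_inner (f j m) (\<lambda>x. - (w k)\<^sup>2 * f k m x)"
    by (rule L2_inner_cong) (simp_all add: f_ode)
  also have "\<dots> = - (w k)\<^sup>2 * L2_inner (f j m) (f k m)" by (rule L2_inner_cmult_right)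
  finally show ?thesis by simp
qed

text \<open>The left-hand side of the shift formula \<open>f_inner_Suc\<close> is symmetric in
  \<open>j\<close> and \<open>k\<close>, while the factors \<open>(w j)\<^sup>2\<close> and
  \<open>(w k)\<^sup>2\<close> on the right differ.\<close>

lemma f_orth:
  assumes "j \<ge> 1" "k \<ge> 1" "j \<noteq> k"
  shows "L2_inner (f j m) (f k m) = 0"
proof -
  have "(w k)\<^sup>2 * L2_inner (f j m) (f k m) = (w j)\<^sup>2 * L2_inner (f j m) (f k m)"
    using f_inner_Suc[OF assms(1,2), of m] f_inner_Suc[OF assms(2,1), of m] by (simp add: L2_inner_commute)
  moreover have "w k \<noteq> w j" using w_mono[of j k] w_mono[of k j] assms by (metis less_irrefl linorder_neqE_nat)
  then have "(w k)\<^sup>2 \<noteq> (w j)\<^sup>2" using w_nonneg by (simp add: power2_eq_iff_nonneg)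
  ultimately show ?thesis by simp
qed

lemma f_norm: "l \<ge> 1 \<Longrightarrow> L2_inner (f l m) (f l m) = (w l)\<^sup>2 ^ m * L2_inner (f l 0) (f l 0)"
  by (induction m) (simp_all add: f_inner_Suc)

text \<open>An inverse inequality of Bernstein type: orthogonality persists at every order, and each
  derivative multiplies a component by at most \<open>w l\<close>.\<close>

lemma f_sum_norm:
  assumes l: "l \<ge> 1"
  shows "L2_norm (\<lambda>x. \<Sum>k\<in>{1..l}. c k * f k m x) \<le> w l ^ m * L2_norm (\<lambda>x. \<Sum>k\<in>{1..l}. c k * f k 0 x)"
proof (rule power2_le_imp_le)
  have *: "(L2_norm (\<lambda>x. \<Sum>k\<in>{1..l}. c k * f k m x))\<^sup>2 = (\<Sum>k\<in>{1..l}. (c k)\<^sup>2 * L2_inner (f k m) (f k m))" for m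
    unfolding L2_norm_sq by (rule L2_inner_orthogonal_sums) (auto simp: pcs f_orth)
  have "(\<Sum>k\<in>{1..l}. (c k)\<^sup>2 * L2_inner (f k m) (f k m))
      \<le> (\<Sum>k\<in>{1..l}. (w l)\<^sup>2 ^ m * ((c k)\<^sup>2 * L2_inner (f k 0) (f k 0)))"
  proof (rule sum_mono)
    fix k assume k: "k \<in> {1..l}"
    have "(w k)\<^sup>2 ^ m \<le> (w l)\<^sup>2 ^ m" using w_le[of k l] w_nonneg k by (intro power_mono) auto
    then have "(w k)\<^sup>2 ^ m * ((c k)\<^sup>2 * L2_inner (f k 0) (f k 0)) \<le> (w l)\<^sup>2 ^ m * ((c k)\<^sup>2 * L2_inner (f k 0) (f k 0))"
      by (rule mult_right_mono) (simp add: L2_inner_nonneg)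
    then show "(c k)\<^sup>2 * L2_inner (f k m) (f k m) \<le> (w l)\<^sup>2 ^ m * ((c k)\<^sup>2 * L2_inner (f k 0) (f k 0))"
      using k by (simp add: f_norm[of k m] mult.left_commute)
  qed
  also have "\<dots> = (w l ^ m)\<^sup>2 * (L2_norm (\<lambda>x. \<Sum>k\<in>{1..l}. c k * f k 0 x))\<^sup>2"
    unfolding *[of 0] sum_distrib_left by (simp add: power_even_eq power_mult[symmetric] mult.commute)
  finally show "(L2_norm (\<lambda>x. \<Sum>k\<in>{1..l}. c k * f k m x))\<^sup>2
      \<le> (w l ^ m * L2_norm (\<lambda>x. \<Sum>k\<in>{1..l}. c k * f k 0 x))\<^sup>2"
    unfolding *[of m] by (simp add: power_mult_distrib)
qed (simp add: w_nonneg L2_norm_nonneg)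

text \<open>With \<open>q = p - 1\<close> the exponent is \<open>p + 1\<close>; it is the number of
  factors \<open>approx_const M\<close> in \<open>ritz_pair_error_smooth\<close>.\<close>

definition \<theta> :: "nat \<Rightarrow> real" where
  "\<theta> l = (w l / w (n + 1)) ^ (q + 2)"

lemma w_Suc_n_pos: "w (n + 1) > 0"
proof -
  have "w (n + 1) \<noteq> 0"
  proof
    assume "w (n + 1) = 0"
    then show False using w_Suc_n by simp
  qed
  then show ?thesis using w_nonneg[of "n + 1"] by linarith
qed

lemma theta_bounds:
  assumes "l \<in> {1..n}"
  shows "0 \<le> \<theta> l" "\<theta> l < 1"
proof -
  have 1: "0 \<le> w l / w (n + 1)" using w_nonneg by simp
  then show "0 \<le> \<theta> l" unfolding \<theta>_def by (rule zero_le_power)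
  have "w l / w (n + 1) < 1" using w_mono[of l "n + 1"] assms w_Suc_n_pos by simp
  then show "\<theta> l < 1" unfolding \<theta>_def by (rule power_less_one_iff[THEN iffD2, OF 1, OF conjI, rotated]) simp
qed

section \<open>The Ritz projection in the discrete eigenbasis\<close>

lemma ritz_error_theta:
  assumes l: "l \<ge> 1" and v: "\<And>m x. v m x = (\<Sum>k\<in>{1..l}. c k * f k m x)"
    and ritz: "ritz_pair M q a (v 0) (v 1) s \<tau>"
  shows "L2_norm (\<lambda>x. v 0 x - s x) \<le> \<theta> l * L2_norm (v 0)"
proof -
  have "L2_norm (\<lambda>x. v 0 x - s x) \<le> approx_const M ^ (q + 2) * L2_norm (v (q + 2))"
  proof (rule ritz_pair_error_smooth[OF M _ _ ritz])
    show "is_prim (v m) (v (Suc m))" for m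
      unfolding v[abs_def] by (intro is_prim_sum is_prim_cmult f_prim)
    show "end_zeros M (a = even m) (v m)" for m
      unfolding v[abs_def] by (intro end_zeros_sum f_ends) simp
  qed
  also have "\<dots> \<le> approx_const M ^ (q + 2) * (w l ^ (q + 2) * L2_norm (v 0))"
    using f_sum_norm[OF l, of c "q + 2"] approx_const_pos[OF M] unfolding v[abs_def]
    by (intro mult_left_mono) auto
  also have "\<dots> = (approx_const M * w l) ^ (q + 2) * L2_norm (v 0)"
    by (simp only: power_mult_distrib mult.assoc)
  also have "approx_const M * w l = w l / w (n + 1)"
    using w_Suc_n w_Suc_n_pos by (simp add: field_simps)
  finally show ?thesis by (simp add: \<theta>_def)
qed

text \<open>For \<open>wh j = 0\<close> the energy identity says nothing about the coefficient. But
  then \<open>t j\<close> has norm 0, and integration by parts against a primitive of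
  \<open>s - v\<close>, available in the Neumann case by the mean condition, shows that
  \<open>uh j\<close> is orthogonal to \<open>v - s\<close>.\<close>

lemma ritz_coefficient:
  assumes j: "j \<in> {1..n}" and v: "is_prim v g" "end_zeros M a v" and ritz: "ritz_pair M q a v g s \<tau>"
  shows "(wh j)\<^sup>2 * L2_inner (uh j) s = L2_inner (t j) g"
    and "wh j = 0 \<Longrightarrow> L2_inner (uh j) s = L2_inner (uh j) v"
proof -
  have \<tau>: "\<tau> \<in> opt_space M q (\<not> a)" "is_prim s \<tau>" "end_zeros M a s"
    and orth': "L2_inner (\<lambda>x. g x - \<tau> x) (t j) = 0"
    and mean: "\<not> a \<Longrightarrow> even M \<Longrightarrow> integral {0..1} (\<lambda>x. v x - s x) = 0"
    using ritz t[OF j] by (auto simp: ritz_pair_def)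
  have pc': "pc g" "pc \<tau>" "pc v" "pc s"
    using is_prim_pc_deriv[OF v(1)] opt_space_pc[OF \<tau>(1)] is_prim_pc[OF v(1)] is_prim_pc[OF \<tau>(2)] .
  have "L2_inner (t j) g = L2_inner (t j) \<tau>"
    using orth'[unfolded L2_inner_diff_left[OF pc'(1,2) pcs(1)[OF j]]]
    by (simp add: L2_inner_commute[of "t j"])
  then show "(wh j)\<^sup>2 * L2_inner (uh j) s = L2_inner (t j) g"
    using weak[OF j ritz_pair_mem[OF ritz] \<tau>(2)] by simp
  assume wh0: "wh j = 0"
  define e where "e x = v x - s x" for x
  have pce: "pc e" unfolding e_def by (intro pc_diff pc')
  obtain z where z: "is_prim z (\<lambda>x. - e x)" "end_zeros M (\<not> a) z"
    using dual_primitive_exists[OF pce, of a M] mean by (auto simp: e_def[abs_def])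
  have "L2_norm (t j) = 0" using t_inner[OF j j] wh0 by (simp add: L2_norm_def)
  then have "L2_inner (t j) z = 0"
    using L2_Cauchy_Schwarz[OF pcs(1)[OF j] is_prim_pc[OF z(1)]] by simp
  moreover have "L2_inner (uh j) (\<lambda>x. - e x) + L2_inner (t j) z = uh j 1 * z 1 - uh j 0 * z 0"
    by (rule L2_integration_by_parts[OF uh_prim[OF j] z(1)])
  moreover have "uh j 1 * z 1 - uh j 0 * z 0 = 0"
    using uh_ends[OF j] z(2) by (auto simp: end_zeros_def)
  ultimately have "L2_inner (uh j) (\<lambda>x. - 1 * e x) = 0" by simp
  then have "L2_inner (uh j) e = 0" unfolding L2_inner_cmult_right by simp
  then show "L2_inner (uh j) s = L2_inner (uh j) v"
    using pc' pcs(2)[OF j] by (simp add: e_def[abs_def] L2_inner_diff_right)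
qed

lemma expansion:
  assumes s: "s \<in> opt_space M (Suc q) a" "is_prim s \<tau>"
  defines "d \<equiv> \<lambda>j. L2_inner (uh j) s / L2_inner (uh j) (uh j)"
  shows "\<And>x. x \<in> {0..1} \<Longrightarrow> s x = (\<Sum>j=1..n. d j * uh j x)"
    and "(L2_norm s)\<^sup>2 = (\<Sum>j=1..n. (d j)\<^sup>2 * L2_inner (uh j) (uh j))"
    and "(L2_norm \<tau>)\<^sup>2 = (\<Sum>j=1..n. (wh j)\<^sup>2 * ((d j)\<^sup>2 * L2_inner (uh j) (uh j)))"
proof -
  obtain c where c: "\<forall>x\<in>{0..1}. s x = (\<Sum>l=1..n. c l * uh l x)" using span[OF s(1)] by blast
  have "c j = d j" if j: "j \<in> {1..n}" for j
  proof -
    have "L2_inner (uh j) s = L2_inner (uh j) (\<lambda>x. \<Sum>l=1..n. c l * uh l x)"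
      by (rule L2_inner_cong) (use c in auto)
    also have "\<dots> = (\<Sum>l=1..n. c l * L2_inner (uh j) (uh l))"
      using j by (subst L2_inner_sum_right) (auto intro!: pc_cmult pcs simp: L2_inner_cmult_right)
    also have "\<dots> = (\<Sum>l=1..n. if l = j then c j * L2_inner (uh j) (uh j) else 0)"
      by (intro sum.cong refl) (use j orth in auto)
    also have "\<dots> = c j * L2_inner (uh j) (uh j)" using j by (simp add: sum.delta)
    finally show ?thesis using uh_pos[OF j] by (simp add: d_def)
  qed
  then have cd: "(\<Sum>l=1..n. c l * uh l x) = (\<Sum>l=1..n. d l * uh l x)" for x
    by (intro sum.cong) auto
  show ex: "s x = (\<Sum>j=1..n. d j * uh j x)" if "x \<in> {0..1}" for x
    using c that cd by simp
  show "(L2_norm s)\<^sup>2 = (\<Sum>j=1..n. (d j)\<^sup>2 * L2_inner (uh j) (uh j))"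
  proof -
    have "(L2_norm s)\<^sup>2 = L2_inner (\<lambda>x. \<Sum>j=1..n. d j * uh j x) (\<lambda>x. \<Sum>j=1..n. d j * uh j x)"
      unfolding L2_norm_sq by (rule L2_inner_cong) (use ex in auto)
    also have "\<dots> = (\<Sum>j=1..n. (d j)\<^sup>2 * L2_inner (uh j) (uh j))"
      by (rule L2_inner_orthogonal_sums) (auto simp: pcs orth)
    finally show ?thesis .
  qed
  have prim': "is_prim s (\<lambda>x. \<Sum>j=1..n. d j * t j x)"
    by (rule is_prim_cong[OF is_prim_sum[OF is_prim_cmult[OF uh_prim]]]) (use ex in auto)
  have pc\<tau>: "pc \<tau>" using s(2) by (rule is_prim_pc_deriv)
  \<comment> \<open>Only one of the two factors \<open>\<tau>\<close> is expanded, so that the weak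
    form applies to the other.\<close>
  have "(L2_norm \<tau>)\<^sup>2 = L2_inner (\<lambda>x. \<Sum>j=1..n. d j * t j x) \<tau>"
    unfolding L2_norm_sq by (rule is_prim_unique[OF s(2) prim'])
  also have "\<dots> = (\<Sum>j=1..n. d j * L2_inner (t j) \<tau>)"
    using pc\<tau> by (subst L2_inner_sum_left) (auto intro!: pc_cmult pcs simp: L2_inner_cmult_left)
  also have "\<dots> = (\<Sum>j=1..n. (wh j)\<^sup>2 * ((d j)\<^sup>2 * L2_inner (uh j) (uh j)))"
  proof (intro sum.cong refl)
    fix j assume j: "j \<in> {1..n}"
    have "L2_inner (uh j) s = d j * L2_inner (uh j) (uh j)" using uh_pos[OF j] by (simp add: d_def)
    then show "d j * L2_inner (t j) \<tau> = (wh j)\<^sup>2 * ((d j)\<^sup>2 * L2_inner (uh j) (uh j))"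
      using weak[OF j s] by (simp add: power2_eq_square)
  qed
  finally show "(L2_norm \<tau>)\<^sup>2 = (\<Sum>j=1..n. (wh j)\<^sup>2 * ((d j)\<^sup>2 * L2_inner (uh j) (uh j)))" .
qed

text \<open>The chain is \<open>wh l * (1 - \<theta> l) * L2_norm (v 0) \<le> wh l * L2_norm s \<le>
  L2_norm \<tau> \<le> L2_norm (v 1) \<le> w l * L2_norm (v 0)\<close>; the factor
  \<open>1 - \<theta> l\<close> is the loss in passing from \<open>v 0\<close> to its Ritz
  projection \<open>s\<close>.\<close>

theorem upper_bound:
  assumes l: "l \<in> {1..n}"
  shows "wh l \<le> w l / (1 - \<theta> l)"
proof -
  have l1: "l \<ge> 1" using l by simp
  \<comment> \<open>Functionals of the exact functions whose vanishing at \<open>v\<close> makes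
    \<open>s\<close> orthogonal to \<open>uh j\<close>: the energy pairing if \<open>wh j\<close> is
    nonzero, the plain inner product otherwise.\<close>
  define \<phi> where "\<phi> j k = (if wh j = 0 then L2_inner (uh j) (f k 0) else L2_inner (t j) (f k 1))" for j k
  obtain c where c: "\<exists>k\<in>{1..l}. c k \<noteq> 0" "\<forall>j\<in>{1..<l}. (\<Sum>k\<in>{1..l}. c k * \<phi> j k) = 0"
    using underdetermined_system[of "{1..<l}" "{1..l}" \<phi>] l1 by auto
  define v where "v m x = (\<Sum>k\<in>{1..l}. c k * f k m x)" for m x
  have v: "is_prim (v 0) (v 1)" "end_zeros M a (v 0)"
  proof -
    show "is_prim (v 0) (v 1)" unfolding v_def One_nat_def by (intro is_prim_sum is_prim_cmult f_prim)
    show "end_zeros M a (v 0)" unfolding v_def using f_ends[of _ 0] by (intro end_zeros_sum) auto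
  qed
  obtain s \<tau> where ritz: "ritz_pair M q a (v 0) (v 1) s \<tau>" using ritz_pair_exists[OF M v] by blast
  have s: "s \<in> opt_space M (Suc q) a" "is_prim s \<tau>"
    using ritz_pair_mem[OF ritz] ritz by (auto simp: ritz_pair_def)
  have zero: "L2_inner (uh j) s = 0" if j: "j \<in> {1..<l}" for j
  proof -
    have jn: "j \<in> {1..n}" using j l by auto
    have sums: "L2_inner h (v m) = (\<Sum>k\<in>{1..l}. c k * L2_inner h (f k m))" if "pc h" for h m
      unfolding v_def using that by (subst L2_inner_sum_right) (auto intro!: pc_cmult pcs simp: L2_inner_cmult_right)
    show ?thesis
    proof (cases "wh j = 0")
      case True
      then have "L2_inner (uh j) s = L2_inner (uh j) (v 0)" by (rule ritz_coefficient(2)[OF jn v ritz])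
      also have "\<dots> = 0" using c(2)[rule_format, OF j] True sums[OF pcs(2)[OF jn]] by (simp add: \<phi>_def)
      finally show ?thesis .
    next
      case False
      have "(wh j)\<^sup>2 * L2_inner (uh j) s = L2_inner (t j) (v 1)" by (rule ritz_coefficient(1)[OF jn v ritz])
      also have "\<dots> = 0" using c(2)[rule_format, OF j] False sums[OF pcs(1)[OF jn]] by (simp add: \<phi>_def)
      finally show ?thesis using False by simp
    qed
  qed
  \<comment> \<open>Only coefficients with \<open>j \<ge> l\<close> survive, and there
    \<open>wh j \<ge> wh l\<close>.\<close>
  have "(wh l)\<^sup>2 * (L2_norm s)\<^sup>2 \<le> (L2_norm \<tau>)\<^sup>2"
    unfolding expansion(2,3)[OF s] sum_distrib_left
  proof (rule sum_mono)
    fix j assume j: "j \<in> {1..n}"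
    show "(wh l)\<^sup>2 * ((L2_inner (uh j) s / L2_inner (uh j) (uh j))\<^sup>2 * L2_inner (uh j) (uh j))
        \<le> (wh j)\<^sup>2 * ((L2_inner (uh j) s / L2_inner (uh j) (uh j))\<^sup>2 * L2_inner (uh j) (uh j))"
    proof (cases "j < l")
      case False
      then have "(wh l)\<^sup>2 \<le> (wh j)\<^sup>2" using wh_le[OF l j] wh_nonneg[OF l] by (intro power_mono) auto
      then show ?thesis by (rule mult_right_mono) (simp add: L2_inner_nonneg)
    qed (use zero j in simp)
  qed
  then have "(wh l * L2_norm s)\<^sup>2 \<le> (L2_norm \<tau>)\<^sup>2" by (simp add: power_mult_distrib)
  then have 1: "wh l * L2_norm s \<le> L2_norm \<tau>" by (rule power2_le_imp_le) (rule L2_norm_nonneg)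
  have pc': "pc (v 0)" "pc (v 1)" "pc s" "pc \<tau>"
    using is_prim_pc[OF v(1)] is_prim_pc_deriv[OF v(1)] is_prim_pc[OF s(2)] is_prim_pc_deriv[OF s(2)] .
  have 2: "L2_norm \<tau> \<le> L2_norm (v 1)"
  proof (rule power2_le_imp_le)
    have \<tau>: "\<tau> \<in> opt_space M q (\<not> a)" and o: "\<And>t'. t' \<in> opt_space M q (\<not> a) \<Longrightarrow> L2_inner (\<lambda>x. v 1 x - \<tau> x) t' = 0"
      using ritz by (auto simp: ritz_pair_def)
    have "L2_inner (\<lambda>x. v 1 x - \<tau> x) (\<lambda>x. - 1 * \<tau> x) = 0"
      unfolding L2_inner_cmult_right using o[OF \<tau>] by simp
    then have "(L2_norm (\<lambda>x. (v 1 x - \<tau> x) - (- 1 * \<tau> x)))\<^sup>2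
        = (L2_norm (\<lambda>x. v 1 x - \<tau> x))\<^sup>2 + (L2_norm (\<lambda>x. - 1 * \<tau> x))\<^sup>2"
      by (intro L2_pythagoras pc_diff pc_cmult pc')
    moreover have "L2_norm (\<lambda>x. - 1 * \<tau> x) = L2_norm \<tau>" unfolding L2_norm_cmult by simp
    ultimately show "(L2_norm \<tau>)\<^sup>2 \<le> (L2_norm (v 1))\<^sup>2" by simp
  qed (rule L2_norm_nonneg)
  have 3: "L2_norm (v 1) \<le> w l * L2_norm (v 0)"
    using f_sum_norm[OF l1, of c 1] by (simp add: v_def[abs_def])
  have "L2_norm (\<lambda>x. v 0 x - s x) \<le> \<theta> l * L2_norm (v 0)"
    by (rule ritz_error_theta[OF l1 v_def ritz])
  moreover have "L2_norm (v 0) \<le> L2_norm (\<lambda>x. v 0 x - s x) + L2_norm s"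
    using L2_norm_triangle[of "\<lambda>x. v 0 x - s x" s] pc' by (simp add: pc_diff)
  ultimately have "(1 - \<theta> l) * L2_norm (v 0) \<le> L2_norm s" by (simp add: algebra_simps)
  then have "wh l * ((1 - \<theta> l) * L2_norm (v 0)) \<le> wh l * L2_norm s"
    using wh_nonneg[OF l] by (rule mult_left_mono)
  with 1 2 3 have "(wh l * (1 - \<theta> l)) * L2_norm (v 0) \<le> w l * L2_norm (v 0)"
    by (simp only: mult.assoc)
  moreover have "L2_norm (v 0) > 0"
  proof -
    obtain k where k: "k \<in> {1..l}" "c k \<noteq> 0" using c(1) by blast
    have "(L2_norm (v 0))\<^sup>2 = (\<Sum>k\<in>{1..l}. (c k)\<^sup>2 * L2_inner (f k 0) (f k 0))"
      unfolding L2_norm_sq v_def[abs_def]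
      by (rule L2_inner_orthogonal_sums) (auto simp: pcs f_orth)
    also have "\<dots> > 0"
      using k f_pos by (intro sum_pos2[of _ k]) (auto simp: L2_inner_nonneg)
    finally show ?thesis using L2_norm_nonneg[of "v 0"] by (simp add: zero_less_power2)
  qed
  ultimately have "wh l * (1 - \<theta> l) \<le> w l" by simp
  then show ?thesis using theta_bounds(2)[OF l] by (simp add: le_divide_eq)
qed

section \<open>Errors of the eigenfunctions\<close>

lemma bessel:
  assumes "pc e" "S \<subseteq> {1..n}"
  shows "(\<Sum>j\<in>S. (L2_inner e (uh j))\<^sup>2 / L2_inner (uh j) (uh j)) \<le> (L2_norm e)\<^sup>2"
proof -
  have S: "finite S" using assms(2) finite_subset by blast
  define b where "b j = L2_inner e (uh j) / L2_inner (uh j) (uh j)" for j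
  define P where "P x = (\<Sum>j\<in>S. b j * uh j x)" for x
  have pcP: "pc P" unfolding P_def using assms(2) by (intro pc_sum pc_cmult pcs) auto
  have "L2_inner e P = (\<Sum>j\<in>S. b j * L2_inner e (uh j))"
    unfolding P_def using assms by (subst L2_inner_sum_right) (auto intro!: pc_cmult pcs simp: L2_inner_cmult_right)
  also have "\<dots> = (\<Sum>j\<in>S. (L2_inner e (uh j))\<^sup>2 / L2_inner (uh j) (uh j))"
    by (simp add: b_def power2_eq_square)
  finally have eP: "L2_inner e P = (\<Sum>j\<in>S. (L2_inner e (uh j))\<^sup>2 / L2_inner (uh j) (uh j))" .
  have "L2_inner P P = (\<Sum>j\<in>S. (b j)\<^sup>2 * L2_inner (uh j) (uh j))"
    unfolding P_def[abs_def] by (rule L2_inner_orthogonal_sums[OF S]) (use assms(2) pcs orth in \<open>auto simp: subset_iff\<close>)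
  also have "\<dots> = L2_inner e P"
    unfolding eP
  proof (intro sum.cong refl)
    fix j assume "j \<in> S"
    then have "L2_inner (uh j) (uh j) > 0" using assms(2) uh_pos by blast
    then show "(b j)\<^sup>2 * L2_inner (uh j) (uh j) = (L2_inner e (uh j))\<^sup>2 / L2_inner (uh j) (uh j)"
      by (simp add: b_def power2_eq_square)
  qed
  finally have PP: "L2_inner P P = L2_inner e P" .
  have "0 \<le> L2_inner (\<lambda>x. e x - P x) (\<lambda>x. e x - P x)" by (rule L2_inner_nonneg)
  also have "\<dots> = (L2_norm e)\<^sup>2 - L2_inner e P"
    unfolding L2_inner_diff_diff[OF assms(1) pcP] PP by (simp add: L2_norm_sq)
  finally show ?thesis unfolding eP by simp
qed

text \<open>Let \<open>E\<close> be the Ritz error of \<open>u\<close>. For \<open>j\<close> other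
  than \<open>l\<close>, the component of the projection along \<open>uh j\<close> is at most
  \<open>\<rho>\<close> times that of \<open>u - s\<close>, and Bessel's inequality sums this to
  \<open>\<rho> * E\<close>. So \<open>u\<close> is within \<open>(1 + \<rho>) * E\<close> of
  \<open>d l * uh l\<close>; passing to the normalized \<open>uh l\<close> costs at most the same
  again, hence the factor 2.\<close>

theorem eigenfunction_error:
  assumes l: "l \<in> {1..n}" and wl: "w l > 0"
    and norms: "L2_norm (f l 0) = L2_norm (uh l)" and pos: "L2_inner (f l 0) (uh l) > 0"
    and \<rho>: "\<rho> \<ge> 0" "\<And>j. j \<in> {1..n} - {l} \<Longrightarrow> (w l)\<^sup>2 \<noteq> (wh j)\<^sup>2 \<and> (w l)\<^sup>2 / \<bar>(w l)\<^sup>2 - (wh j)\<^sup>2\<bar> \<le> \<rho>"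
  shows "L2_norm (\<lambda>x. f l 0 x - uh l x) \<le> 2 * (1 + \<rho>) * (\<theta> l * L2_norm (f l 0))"
proof -
  have l1: "l \<ge> 1" using l by simp
  define u where "u = f l 0"
  have u: "is_prim u (f l 1)" "end_zeros M a u" using f_prim[of l 0] f_ends[OF l1, of 0] by (simp_all add: u_def)
  obtain s \<tau> where ritz: "ritz_pair M q a u (f l 1) s \<tau>" using ritz_pair_exists[OF M u] by blast
  have s: "s \<in> opt_space M (Suc q) a" "is_prim s \<tau>"
    using ritz_pair_mem[OF ritz] ritz by (auto simp: ritz_pair_def)
  have pc': "pc u" "pc s" "pc (uh l)" using is_prim_pc[OF u(1)] is_prim_pc[OF s(2)] pcs(2)[OF l] .
  define E where "E = L2_norm (\<lambda>x. u x - s x)"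
  have E: "E \<le> \<theta> l * L2_norm u"
  proof -
    \<comment> \<open>A combination with a single nonzero coefficient, to which the estimate for
      sums applies.\<close>
    define v where "v m x = (\<Sum>k\<in>{1..l}. (if k = l then 1 else 0) * f k m x)" for m x
    have "v m = f l m" for m
      using l1 by (auto simp: v_def if_distrib[of "\<lambda>c. c * _"] sum.delta cong: if_cong)
    then show ?thesis
      using ritz_error_theta[OF l1 v_def, of s \<tau>] ritz by (simp add: u_def E_def)
  qed
  have coef: "(wh j)\<^sup>2 * L2_inner (uh j) s = (w l)\<^sup>2 * L2_inner (uh j) u" if j: "j \<in> {1..n}" for j
  proof -
    have "L2_inner (uh j) (f l 2) + L2_inner (t j) (f l 1) = uh j 1 * f l 1 1 - uh j 0 * f l 1 0"
      using f_prim[of l 1] by (intro L2_integration_by_parts uh_prim[OF j]) (simp add: numeral_2_eq_2)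
    also have "\<dots> = 0" using uh_ends[OF j] f_ends[OF l1, of 1] by (auto simp: end_zeros_def)
    finally have "L2_inner (t j) (f l 1) = - L2_inner (uh j) (f l 2)" by simp
    also have "L2_inner (uh j) (f l 2) = L2_inner (uh j) (\<lambda>x. - (w l)\<^sup>2 * u x)"
      by (rule L2_inner_cong) (simp_all add: f_ode u_def numeral_2_eq_2)
    also have "\<dots> = - (w l)\<^sup>2 * L2_inner (uh j) u" by (rule L2_inner_cmult_right)
    finally show ?thesis using ritz_coefficient(1)[OF j u ritz] by simp
  qed
  define d where "d j = L2_inner (uh j) s / L2_inner (uh j) (uh j)" for j
  have ex: "s x = (\<Sum>j=1..n. d j * uh j x)" if "x \<in> {0..1}" for x
    unfolding d_def by (rule expansion(1)[OF s that])
  define J where "J = {1..n} - {l}"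
  have rest: "s x - d l * uh l x = (\<Sum>j\<in>J. d j * uh j x)" if "x \<in> {0..1}" for x
    unfolding ex[OF that] J_def using l by (simp add: sum_diff1)
  have "(L2_norm (\<lambda>x. s x - d l * uh l x))\<^sup>2 = (\<Sum>j\<in>J. (d j)\<^sup>2 * L2_inner (uh j) (uh j))"
  proof -
    have eq: "L2_norm (\<lambda>x. s x - d l * uh l x) = L2_norm (\<lambda>x. \<Sum>j\<in>J. d j * uh j x)"
      by (rule L2_norm_cong[OF rest])
    show ?thesis
      unfolding eq L2_norm_sq by (rule L2_inner_orthogonal_sums) (auto simp: J_def pcs orth)
  qed
  also have "\<dots> \<le> (\<Sum>j\<in>J. \<rho>\<^sup>2 * ((L2_inner (\<lambda>x. u x - s x) (uh j))\<^sup>2 / L2_inner (uh j) (uh j)))"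
  proof (rule sum_mono)
    fix j assume j: "j \<in> J"
    then have jn: "j \<in> {1..n}" by (simp add: J_def)
    define \<epsilon> where "\<epsilon> = L2_inner (\<lambda>x. u x - s x) (uh j)"
    have ne: "(w l)\<^sup>2 - (wh j)\<^sup>2 \<noteq> 0" and le: "(w l)\<^sup>2 / \<bar>(w l)\<^sup>2 - (wh j)\<^sup>2\<bar> \<le> \<rho>"
      using \<rho>(2)[of j] j by (auto simp: J_def)
    have \<epsilon>: "\<epsilon> = L2_inner (uh j) u - L2_inner (uh j) s"
      unfolding \<epsilon>_def L2_inner_commute[of "uh j"] by (rule L2_inner_diff_left[OF pc'(1,2) pcs(2)[OF jn]])
    \<comment> \<open>Writing the component of \<open>u\<close> as that of \<open>s\<close> plus
      \<open>\<epsilon>\<close> in \<open>coef\<close> leaves the difference of the squared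
      frequencies as the factor that \<open>\<rho>\<close> controls.\<close>
    have "(w l)\<^sup>2 * \<epsilon> = - ((w l)\<^sup>2 - (wh j)\<^sup>2) * L2_inner (uh j) s"
      unfolding \<epsilon> using coef[OF jn] by (simp add: algebra_simps)
    then have "\<bar>(w l)\<^sup>2 * \<epsilon>\<bar> = \<bar>(w l)\<^sup>2 - (wh j)\<^sup>2\<bar> * \<bar>L2_inner (uh j) s\<bar>"
      by (simp only: abs_mult abs_minus_cancel)
    then have "\<bar>L2_inner (uh j) s\<bar> = (w l)\<^sup>2 / \<bar>(w l)\<^sup>2 - (wh j)\<^sup>2\<bar> * \<bar>\<epsilon>\<bar>"
      using ne by (simp add: abs_mult field_simps)
    also have "\<dots> \<le> \<rho> * \<bar>\<epsilon>\<bar>" by (rule mult_right_mono[OF le]) simp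
    finally have "\<bar>L2_inner (uh j) s\<bar>\<^sup>2 \<le> (\<rho> * \<bar>\<epsilon>\<bar>)\<^sup>2" by (rule power_mono) simp
    then have "(L2_inner (uh j) s)\<^sup>2 / L2_inner (uh j) (uh j) \<le> \<rho>\<^sup>2 * \<epsilon>\<^sup>2 / L2_inner (uh j) (uh j)"
      using uh_pos[OF jn] by (intro divide_right_mono) (auto simp: power_mult_distrib)
    moreover have "(d j)\<^sup>2 * L2_inner (uh j) (uh j) = (L2_inner (uh j) s)\<^sup>2 / L2_inner (uh j) (uh j)"
      using uh_pos[OF jn] by (simp add: d_def power2_eq_square)
    ultimately show "(d j)\<^sup>2 * L2_inner (uh j) (uh j) \<le> \<rho>\<^sup>2 * (\<epsilon>\<^sup>2 / L2_inner (uh j) (uh j))" by simp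
  qed
  also have "\<dots> \<le> \<rho>\<^sup>2 * E\<^sup>2"
    unfolding sum_distrib_left[symmetric] E_def
    by (intro mult_left_mono bessel pc_diff pc') (auto simp: J_def)
  finally have "(L2_norm (\<lambda>x. s x - d l * uh l x))\<^sup>2 \<le> (\<rho> * E)\<^sup>2" by (simp add: power_mult_distrib)
  then have "L2_norm (\<lambda>x. s x - d l * uh l x) \<le> \<rho> * E"
    by (rule power2_le_imp_le) (use \<rho>(1) in \<open>simp add: E_def L2_norm_nonneg\<close>)
  moreover have "L2_norm (\<lambda>x. u x - d l * uh l x) \<le> E + L2_norm (\<lambda>x. s x - d l * uh l x)"
    unfolding E_def by (intro L2_norm_triangle_diff pc' pc_cmult)
  ultimately have 1: "L2_norm (\<lambda>x. u x - d l * uh l x) \<le> (1 + \<rho>) * E" by (simp add: algebra_simps)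
  \<comment> \<open>The sign normalization enters here: for \<open>d l > 0\<close> the norm of
    \<open>(d l - 1) * uh l\<close> is the difference of the norms of \<open>d l * uh l\<close> and
    \<open>u\<close>.\<close>
  have dpos: "d l > 0"
  proof -
    have "(wh l)\<^sup>2 * L2_inner (uh l) s > 0"
      unfolding coef[OF l] using wl pos by (simp add: u_def L2_inner_commute)
    then have "L2_inner (uh l) s > 0" by (simp add: zero_less_mult_iff)
    then show ?thesis using uh_pos[OF l] by (simp add: d_def)
  qed
  have "L2_norm (\<lambda>x. d l * uh l x - uh l x) = \<bar>d l - 1\<bar> * L2_norm (uh l)"
    using L2_norm_cmult[of "d l - 1" "uh l"] by (simp add: left_diff_distrib)
  also have "\<dots> = \<bar>L2_norm (\<lambda>x. d l * uh l x) - L2_norm u\<bar>"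
  proof -
    have "L2_norm (\<lambda>x. d l * uh l x) - L2_norm u = (d l - 1) * L2_norm (uh l)"
      using dpos norms by (simp add: L2_norm_cmult u_def algebra_simps)
    then show ?thesis by (simp add: abs_mult L2_norm_nonneg)
  qed
  also have "\<dots> \<le> L2_norm (\<lambda>x. u x - d l * uh l x)"
  proof -
    have pcd: "pc (\<lambda>x. d l * uh l x)" by (intro pc_cmult pc')
    have "L2_norm u \<le> L2_norm (\<lambda>x. u x - d l * uh l x) + L2_norm (\<lambda>x. d l * uh l x)"
      using L2_norm_triangle[OF pc_diff[OF pc'(1) pcd] pcd] by simp
    moreover have "L2_norm (\<lambda>x. d l * uh l x) \<le> L2_norm (\<lambda>x. u x - d l * uh l x) + L2_norm u"
      using L2_norm_triangle[OF pc_diff[OF pcd pc'(1)] pc'(1)]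
      by (simp add: L2_norm_minus_commute[of u])
    ultimately show ?thesis by linarith
  qed
  finally have "L2_norm (\<lambda>x. d l * uh l x - uh l x) \<le> (1 + \<rho>) * E" using 1 by linarith
  moreover have "L2_norm (\<lambda>x. u x - uh l x)
      \<le> L2_norm (\<lambda>x. u x - d l * uh l x) + L2_norm (\<lambda>x. d l * uh l x - uh l x)"
    by (intro L2_norm_triangle_diff pc' pc_cmult)
  ultimately have "L2_norm (\<lambda>x. u x - uh l x) \<le> 2 * ((1 + \<rho>) * E)" using 1 by linarith
  also have "\<dots> = 2 * (1 + \<rho>) * E" by simp
  also have "\<dots> \<le> 2 * (1 + \<rho>) * (\<theta> l * L2_norm u)"
    using E \<rho>(1) by (intro mult_left_mono) auto
  finally show ?thesis by (simp add: u_def)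
qed

text \<open>The exceptional case of constant eigenfunctions, in the Neumann problem.\<close>

theorem eigenfunction_exact:
  assumes l: "l \<in> {1..n}" and wl: "w l = 0"
    and norms: "L2_norm (f l 0) = L2_norm (uh l)" and pos: "L2_inner (f l 0) (uh l) > 0"
  shows "L2_norm (\<lambda>x. f l 0 x - uh l x) = 0"
proof -
  have l1: "l \<ge> 1" using l by simp
  have "wh l = 0" using upper_bound[OF l] wh_nonneg[OF l] wl by simp
  then have "L2_norm (t l) = 0" using t_inner[OF l l] by (simp add: L2_norm_def)
  then have uh0: "L2_norm (\<lambda>x. uh l x - uh l 0) = 0" by (rule L2_norm_zero_deriv[OF uh_prim[OF l]])
  have "L2_norm (f l (Suc 0)) = 0" using f_inner_Suc[OF l1 l1, of 0] wl by (simp add: L2_norm_def)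
  then have u0: "L2_norm (\<lambda>x. f l 0 x - f l 0 0) = 0" by (rule L2_norm_zero_deriv[OF f_prim])
  \<comment> \<open>Both functions are constant in norm; equal norms and a positive inner product
    identify the two constants.\<close>
  define u d c where "u = f l 0" and "d = uh l 0" and "c = f l 0 0"
  have pc': "pc u" "pc (uh l)" "pc (\<lambda>x. c)" "pc (\<lambda>x. d)" using pcs l by (auto simp: u_def pc_const)
  have zero: "L2_inner (\<lambda>x. h x - k) g = 0" if "L2_norm (\<lambda>x. h x - k) = 0" "pc h" "pc g" for h g and k :: real
    using L2_Cauchy_Schwarz[OF pc_diff[OF that(2) pc_const] that(3), of k] that(1) by simp
  have cc: "L2_inner (\<lambda>x. c) (\<lambda>x. d) = c * d" for c d by (simp add: L2_inner_def)
  have ui: "L2_inner u g = L2_inner (\<lambda>x. c) g" if "pc g" for g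
    using zero[of u c g] u0 that pc' by (simp add: L2_inner_diff_left u_def c_def)
  have hi: "L2_inner (uh l) g = L2_inner (\<lambda>x. d) g" if "pc g" for g
    using zero[of "uh l" d g] uh0 that pc' by (simp add: L2_inner_diff_left d_def)
  have "L2_inner u u = c * c" "L2_inner (uh l) (uh l) = d * d" "L2_inner u (uh l) = c * d"
    using ui[OF pc'(1)] ui[OF pc'(3)] hi[OF pc'(2)] hi[OF pc'(4)] hi[OF pc'(3)] ui[OF pc'(2)]
    by (simp_all add: cc L2_inner_commute[of "\<lambda>x. c" u] L2_inner_commute[of "\<lambda>x. d" "uh l"]
        L2_inner_commute[of "\<lambda>x. c" "uh l"] mult.commute)
  moreover have "L2_inner u u = L2_inner (uh l) (uh l)"
    using norms by (simp add: u_def flip: L2_norm_sq)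
  ultimately have "c * c = d * d" "c * d > 0" using pos by (simp_all add: u_def)
  then have "c = d" by (auto simp: square_eq_iff)
  have "L2_norm (\<lambda>x. u x - uh l x) \<le> L2_norm (\<lambda>x. u x - c) + L2_norm (\<lambda>x. c - uh l x)"
    by (intro L2_norm_triangle_diff pc')
  also have "\<dots> = 0"
    using u0 uh0 \<open>c = d\<close> L2_norm_minus_commute[of "\<lambda>x. c" "uh l"] by (simp add: u_def c_def d_def)
  finally show ?thesis using L2_norm_nonneg[of "\<lambda>x. u x - uh l x"] by (simp add: u_def)
qed

end

section \<open>Return to the concrete eigenvalue problems\<close>

lemma card_inner_nodes_less:
  assumes "l \<ge> 1"
  shows "card (inner_nodes (grid_size i (l - 1)) (i \<noteq> Neumann)) < l"
proof -
  \<comment> \<open>The inner nodes are odd grid points for Neumann and even ones otherwise,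
    numbered from 1 to \<open>l - 1\<close>.\<close>
  define g :: "nat \<Rightarrow> nat" where "g k = (if i = Neumann then 2 * k - 1 else 2 * k)" for k
  have "inner_nodes (grid_size i (l - 1)) (i \<noteq> Neumann) \<subseteq> g ` {1..<l}"
  proof
    fix j assume j: "j \<in> inner_nodes (grid_size i (l - 1)) (i \<noteq> Neumann)"
    show "j \<in> g ` {1..<l}"
    proof (rule image_eqI)
      show "j = g ((j + 1) div 2)" "(j + 1) div 2 \<in> {1..<l}"
        using j by (cases i; auto simp: inner_nodes_def g_def elim!: evenE oddE)+
    qed
  qed
  then have "card (inner_nodes (grid_size i (l - 1)) (i \<noteq> Neumann)) \<le> card {1..<l}"
    by (rule surj_card_le[rotated]) simp
  then show ?thesis using assms by simp
qed

text \<open>Separates the void case of an infinite constant from a real bound \<open>\<rho>\<close>,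
  to which the real-valued error estimate applies.\<close>

lemma separation_constant_cases:
  assumes "\<omega> l > 0"
  obtains "separation_constant n \<omega> \<omega>h l = \<infinity>"
  | \<rho> where "separation_constant n \<omega> \<omega>h l = ereal \<rho>" "\<rho> \<ge> 0"
    "\<And>j. j \<in> {1..n} - {l} \<Longrightarrow> (\<omega> l)\<^sup>2 \<noteq> (\<omega>h j)\<^sup>2 \<and> (\<omega> l)\<^sup>2 / \<bar>(\<omega> l)\<^sup>2 - (\<omega>h j)\<^sup>2\<bar> \<le> \<rho>"
proof -
  define J where "J = {1..n} - {l}"
  define Q where "Q = (\<lambda>j. separation_quotient (\<omega> l) (\<omega>h j))"
  define R where "R = separation_constant n \<omega> \<omega>h l"
  show thesis
  proof (cases "J = {}")
    case True
    then have "R = ereal 0" by (simp add: R_def separation_constant_def J_def zero_ereal_def)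
    then show thesis by (rule that(2)[folded R_def]) (use True in \<open>auto simp: J_def\<close>)
  next
    case False
    then have R: "R = Max (Q ` J)" by (simp add: R_def separation_constant_def J_def Q_def)
    have fin: "finite (Q ` J)" "Q ` J \<noteq> {}" using False by (auto simp: J_def)
    have le: "Q j \<le> R" if "j \<in> J" for j unfolding R using fin that by auto
    obtain j0 where j0: "j0 \<in> J" "R = Q j0" using Max_in[OF fin] R by auto
    show thesis
    proof (cases "R = \<infinity>")
      case True
      then show thesis by (rule that(1)[folded R_def])
    next
      case False
      have ne: "(\<omega> l)\<^sup>2 - (\<omega>h j)\<^sup>2 \<noteq> 0" if "j \<in> J" for j
        using le[OF that] False by (auto simp: Q_def separation_quotient_def)
      then have Q: "Q j = ereal ((\<omega> l)\<^sup>2 / \<bar>(\<omega> l)\<^sup>2 - (\<omega>h j)\<^sup>2\<bar>)" if "j \<in> J" for j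
        using that by (simp add: Q_def separation_quotient_def)
      show thesis
      proof (rule that(2)[folded R_def J_def])
        show "R = ereal ((\<omega> l)\<^sup>2 / \<bar>(\<omega> l)\<^sup>2 - (\<omega>h j0)\<^sup>2\<bar>)" using j0 Q by simp
        fix j assume j: "j \<in> J"
        show "(\<omega> l)\<^sup>2 \<noteq> (\<omega>h j)\<^sup>2 \<and> (\<omega> l)\<^sup>2 / \<bar>(\<omega> l)\<^sup>2 - (\<omega>h j)\<^sup>2\<bar> \<le> (\<omega> l)\<^sup>2 / \<bar>(\<omega> l)\<^sup>2 - (\<omega>h j0)\<^sup>2\<bar>"
          using le[OF j] ne[OF j] j0 Q[OF j] Q[OF j0(1)] by simp
      qed simp
    qed
  qed
qed

theorem proposition4p1:
  fixes n p :: nat and i :: bc_type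
    and u uh :: "nat \<Rightarrow> real \<Rightarrow> real" and \<omega> \<omega>h :: "nat \<Rightarrow> real"
  assumes "n \<ge> 1" and "p \<ge> 1"
    and "exact_eigenpairs i u \<omega>"
    and "discrete_eigenbasis (opt_spline_space p n i) n uh \<omega>h"
  shows "\<forall>l\<in>{1..n}.
      (\<omega> l \<le> \<omega>h l \<and> \<omega>h l \<le> \<omega> l / (1 - (\<omega> l / \<omega> (n + 1)) ^ (p + 1))) \<and>
      (L2_norm (u l) = L2_norm (uh l) \<and> L2_inner (u l) (uh l) > 0 \<longrightarrow>
        ereal (L2_norm (\<lambda>x. u l x - uh l x) / L2_norm (u l))
          \<le> 2 * (1 + separation_constant n \<omega> \<omega>h l) * ereal ((\<omega> l / \<omega> (n + 1)) ^ (p + 1)))"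
proof -
  note n = assms(1) and p = assms(2) and exact = assms(3) and disc = assms(4)
  define M a q where "M = grid_size i n" and "a = (i \<noteq> Neumann)" and "q = p - 1"
  have M: "M > 0" using grid_size_pos[OF n] by (simp add: M_def)
  have pq: "p = Suc q" using p by (simp add: q_def)
  have S: "s \<in> opt_spline_space p n i \<longleftrightarrow> s \<in> opt_space M (Suc q) a" for s
    using opt_spline_space_iff[OF n p] by (simp add: M_def a_def pq)
  have \<omega>: "\<omega> l = freq i l" if "l \<ge> 1" for l
    by (rule exact_eigenpairs_explicit(1)[OF exact that])
  have "\<forall>l. \<exists>c. l \<ge> 1 \<longrightarrow> (\<forall>x\<in>{0..1}. u l x = c * trig (phase i) (freq i l) x)"
    using exact_eigenpairs_explicit(2)[OF exact] \<omega> by metis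
  then obtain c where c: "\<And>l x. l \<ge> 1 \<Longrightarrow> x \<in> {0..1} \<Longrightarrow> u l x = c l * trig (phase i) (freq i l) x"
    by metis
  \<comment> \<open>The derivatives of \<open>u l\<close> in closed form: each order brings a factor
    \<open>freq i l\<close> and a quarter turn of \<open>trig\<close>.\<close>
  define f where "f l m x = (c l * freq i l ^ m) * trig (phase i + m) (freq i l) x" for l m x
  have uf: "u l x = f l 0 x" if "l \<ge> 1" "x \<in> {0..1}" for l x using c[OF that] by (simp add: f_def)
  have eig: "discrete_eigenpair (opt_spline_space p n i) (uh j) (\<omega>h j)" if "j \<in> {1..n}" for j
    using disc that by (simp add: discrete_eigenbasis_def)
  then have mem: "uh j \<in> opt_space M (Suc q) a" if "j \<in> {1..n}" for j
    using that S by (simp add: discrete_eigenpair_def)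
  then have "\<forall>j. \<exists>t. j \<in> {1..n} \<longrightarrow> t \<in> opt_space M q (\<not> a) \<and> is_prim (uh j) t \<and> end_zeros M a (uh j)"
    by auto
  then obtain t where t: "\<And>j. j \<in> {1..n} \<Longrightarrow> t j \<in> opt_space M q (\<not> a)"
    "\<And>j. j \<in> {1..n} \<Longrightarrow> is_prim (uh j) (t j)" "\<And>j. j \<in> {1..n} \<Longrightarrow> end_zeros M a (uh j)"
    by metis
  interpret galerkin M q n a uh t \<omega>h "freq i" f
  proof
    show "L2_inner (t j) g = (\<omega>h j)\<^sup>2 * L2_inner (uh j) v"
      if "j \<in> {1..n}" "v \<in> opt_space M (Suc q) a" "is_prim v g" for j v g
      using eig[OF that(1)] that(2) L2_inner_D01[OF t(2)[OF that(1)] that(3)]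
      unfolding discrete_eigenpair_def S[symmetric] by metis
    show "L2_inner (uh j) (uh k) = 0" if "j \<in> {1..n}" "k \<in> {1..n}" "j \<noteq> k" for j k
      using disc that by (simp add: discrete_eigenbasis_def)
    show "L2_inner (uh j) (uh j) > 0" if "j \<in> {1..n}" for j
      using eig[OF that] L2_inner_pos[OF is_prim_continuous[OF t(2)[OF that]]]
      unfolding discrete_eigenpair_def by blast
    show "\<exists>c. \<forall>x\<in>{0..1}. s x = (\<Sum>l = 1..n. c l * uh l x)" if "s \<in> opt_space M (Suc q) a" for s
      using disc that unfolding discrete_eigenbasis_def S[symmetric] by blast
    show "\<omega>h j \<ge> 0" if "j \<in> {1..n}" for j using eig[OF that] by (simp add: discrete_eigenpair_def)
    show "mono_on {1..n} \<omega>h" using disc by (simp add: discrete_eigenbasis_def)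
    show "is_prim (f l m) (f l (Suc m))" for l m
    proof -
      have "f l (Suc m) = (\<lambda>x. c l * freq i l ^ m * (freq i l * trig (Suc (phase i + m)) (freq i l) x))"
        by (auto simp: f_def)
      then show ?thesis using is_prim_trig[of "c l * freq i l ^ m" "phase i + m" "freq i l"]
        by (simp add: f_def[abs_def])
    qed
    show "end_zeros M (a = even m) (f l m)" if "l \<ge> 1" for l m
    proof -
      \<comment> \<open>\<open>phase i\<close> is 0 exactly if \<open>a\<close> holds, so this
        parity carries the alternation of the end conditions.\<close>
      have "even (phase i + m) = (a = even m)" by (auto simp: phase_def a_def)
      moreover have "even (grid_size i (l - 1)) = even M" by (cases i) (auto simp: M_def)
      ultimately show ?thesis
        using end_zeros_trig[of "grid_size i (l - 1)" M "phase i + m" "c l * freq i l ^ m"]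
        by (simp add: f_def[abs_def] freq_def)
    qed
    show "f l (Suc (Suc m)) x = - (freq i l)\<^sup>2 * f l m x" for l m x
      by (simp add: f_def trig_Suc_Suc power2_eq_square)
    show "L2_inner (f l 0) (f l 0) > 0" if l: "l \<ge> 1" for l
    proof -
      have "\<exists>x\<in>{0..1}. u l x \<noteq> 0"
        using exact l by (simp add: exact_eigenpairs_def exact_eigenpair_def)
      then obtain x where x: "x \<in> {0..1}" "f l 0 x \<noteq> 0" using uf[OF l] by auto
      have "continuous_on {0..1} (f l 0)"
        unfolding f_def by (intro continuous_intros continuous_on_trig)
      then show ?thesis using x by (rule L2_inner_pos)
    qed
    show "approx_const M * freq i (n + 1) = 1"
      using M by (simp add: approx_const_def freq_def M_def)
    show "\<exists>K>0. even K = even M \<and> approx_const K * freq i l = 1 \<and> card (inner_nodes K a) < l"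
      if l: "l \<in> {1..n}" and pos: "freq i l > 0" for l
    proof (intro exI conjI)
      \<comment> \<open>A positive frequency rules out the empty mesh, which occurs for Neumann with
        \<open>l = 1\<close>.\<close>
      show K: "grid_size i (l - 1) > 0"
        using pos by (cases "grid_size i (l - 1)") (auto simp: freq_def)
      show "even (grid_size i (l - 1)) = even M" by (cases i) (auto simp: M_def)
      show "approx_const (grid_size i (l - 1)) * freq i l = 1"
        using K by (simp add: approx_const_def freq_def)
      show "card (inner_nodes (grid_size i (l - 1)) a) < l"
        unfolding a_def using l by (intro card_inner_nodes_less) simp
    qed
  qed (use M t freq_nonneg freq_strict_mono in auto)
  show ?thesis
  proof (rule ballI)
    fix l assume l: "l \<in> {1..n}"
    then have l1: "l \<ge> 1" by simp
    have th: "(\<omega> l / \<omega> (n + 1)) ^ (p + 1) = \<theta> l"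
      using \<omega>[OF l1] \<omega>[of "n + 1"] by (simp add: \<theta>_def pq)
    have bounds: "\<omega> l \<le> \<omega>h l \<and> \<omega>h l \<le> \<omega> l / (1 - \<theta> l)"
      using lower_bound[OF l] upper_bound[OF l] \<omega>[OF l1] by simp
    have error: "ereal (L2_norm (\<lambda>x. u l x - uh l x) / L2_norm (u l))
          \<le> 2 * (1 + separation_constant n \<omega> \<omega>h l) * ereal (\<theta> l)"
      if norms: "L2_norm (u l) = L2_norm (uh l)" and pos: "L2_inner (u l) (uh l) > 0"
    proof -
      have eqs: "L2_norm (u l) = L2_norm (f l 0)" "L2_inner (u l) (uh l) = L2_inner (f l 0) (uh l)"
        "L2_norm (\<lambda>x. u l x - uh l x) = L2_norm (\<lambda>x. f l 0 x - uh l x)"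
        using uf[OF l1] by (auto intro!: L2_norm_cong L2_inner_cong)
      have norms': "L2_norm (f l 0) = L2_norm (uh l)" and pos': "L2_inner (f l 0) (uh l) > 0"
        using norms pos eqs by simp_all
      show ?thesis
      proof (cases "freq i l = 0")
        case True
        \<comment> \<open>The right-hand side is 0 even for an infinite separation constant, since
          \<open>\<infinity> * 0 = 0\<close> in \<open>ereal\<close>; so the eigenfunction error has
          to vanish exactly.\<close>
        then have "\<theta> l = 0" by (simp add: \<theta>_def)
        moreover have "L2_norm (\<lambda>x. u l x - uh l x) = 0"
          using eigenfunction_exact[OF l True norms' pos'] eqs by simp
        ultimately show ?thesis by (simp add: zero_ereal_def[symmetric])
      next
        case False
        then have fpos: "freq i l > 0" using freq_nonneg[of i l] by simp
        then have wpos: "\<omega> l > 0" using \<omega>[OF l1] by simp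
        \<comment> \<open>A positive factor keeps an infinite separation constant infinite, which
          settles that case.\<close>
        have \<theta>pos: "\<theta> l > 0" using fpos w_Suc_n_pos by (simp add: \<theta>_def)
        from wpos show ?thesis
        proof (cases rule: separation_constant_cases[of \<omega> l n \<omega>h])
          case 1
          then show ?thesis using \<theta>pos by simp
        next
          case (2 \<rho>)
          have "L2_norm (\<lambda>x. f l 0 x - uh l x) \<le> 2 * (1 + \<rho>) * (\<theta> l * L2_norm (f l 0))"
            by (rule eigenfunction_error[OF l fpos norms' pos' 2(2)]) (use 2(3) \<omega>[OF l1] in simp)
          moreover have "L2_norm (f l 0) > 0" using f_pos[OF l1] by (simp add: L2_norm_def)
          ultimately have "L2_norm (\<lambda>x. u l x - uh l x) / L2_norm (u l) \<le> 2 * (1 + \<rho>) * \<theta> l"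
            unfolding eqs by (simp add: divide_le_eq mult.assoc)
          then have "ereal (L2_norm (\<lambda>x. u l x - uh l x) / L2_norm (u l)) \<le> ereal (2 * (1 + \<rho>) * \<theta> l)"
            by simp
          also have "\<dots> = 2 * (1 + ereal \<rho>) * ereal (\<theta> l)"
            by (simp add: one_ereal_def numeral_eq_ereal)
          finally show ?thesis unfolding 2(1) .
        qed
      qed
    qed
    show "(\<omega> l \<le> \<omega>h l \<and> \<omega>h l \<le> \<omega> l / (1 - (\<omega> l / \<omega> (n + 1)) ^ (p + 1))) \<and>
      (L2_norm (u l) = L2_norm (uh l) \<and> L2_inner (u l) (uh l) > 0 \<longrightarrow>
        ereal (L2_norm (\<lambda>x. u l x - uh l x) / L2_norm (u l))
          \<le> 2 * (1 + separation_constant n \<omega> \<omega>h l) * ereal ((\<omega> l / \<omega> (n + 1)) ^ (p + 1)))"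
      unfolding th using bounds error by blast
  qed
qed

end
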